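(* Suppose that $(W,S)$ is a Coxeter system with $S$ finite such that its Coxeter graph has all edges labelled by $3$ or $\infty$, i.e., all entries of the Coxeter matrix of $(W,S)$ lie in $\{1,2,3,\infty\}$. Then for each $n\in\mathbb N$: (1) the set $\Sigma_n(W)$ of $n$-small roots is a bipodal subset of $\Phi^+$; (2) the set $L_n(W)$ of $n$-low elements is a finite Garside shadow in $(W,S)$.
   Context: Here $\mathbb N=\{0,1,2,\dots\}$. Let $\ell$ be the length function of $(W,S)$. For $w=uv$ in $W$ with $\ell(w)=\ell(u)+\ell(v)$, $u$ is called a prefix of $w$ and $v$ a suffix of $w$. The (right) weak order on $W$ is $u\leq_R w$ iff $u$ is a prefix of $w$. A subset $X\subseteq W$ is bounded if there is $g\in W$ with $x\leq_R g$ for all $x\in X$; every bounded $X$ has a least upper bound $\bigvee X$ for $\leq_R$, called its join. A Garside shadow in $(W,S)$ is a subset $A\subseteq W$ containing $S$ such that (i) if $X\subseteq A$ is bounded then $\bigvee X\in A$, and (ii) every suffix of an element of $A$ is in $A$. Geometric representation and roots. Fix a geometric representation of $(W,S)$: a real vector space $V$ with a symmetric bilinear form $B$, and a simple system $\Delta=\{\alpha_s : s\in S\}\subseteq V$ (finite, indexed bijectively by $S$) such that: $\sum_{\alpha\in\Delta}a_\alpha\alpha=0$ with all $a_\alpha\ge 0$ implies all $a_\alpha=0$; $B(\alpha,\beta)\in\,]-\infty,-1]\cup\{-\cos(\pi/k): k\in\mathbb N, k\geq 2\}$ for distinct $\alpha,\beta\in\Delta$; $B(\alpha,\alpha)=1$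 for $\alpha\in\Delta$; and $W$ is faithfully represented in the group of linear maps preserving $B$, with $s\in S$ acting by $v\mapsto v-2B(\alpha_s,v)\alpha_s$. (So $B(\alpha_s,\alpha_t)=-\cos(\pi/m_{st})$ if the order $m_{st}$ of $st$ is finite, and $B(\alpha_s,\alpha_t)\le -1$ iff $m_{st}=\infty$.) For $A\subseteq V$, $\operatorname{cone}(A)$ is the set of non-negative linear combinations of vectors of $A$. The root system is $\Phi=W(\Delta)$, with positive roots $\Phi^+=\operatorname{cone}(\Delta)\cap\Phi$ and negative roots $\Phi^-=-\Phi^+$; $\Phi=\Phi^+\sqcup\Phi^-$. For $\beta\in\Phi$, $s_\beta\in W$ is the reflection $v\mapsto v-2B(\beta,v)\beta$. Put $\operatorname{cone}_\Phi(A)=\operatorname{cone}(A)\cap\Phi$. The (left) inversion set of $w\in W$ is $N(w)=\Phi^+\cap w(\Phi^-)$. $n$-small roots and $n$-low elements. For $\alpha,\beta\in\Phi^+$, write $\alpha\preceq\beta$ if for all $w\in W$, $\beta\in N(w)$ implies $\alpha\in N(w)$; write $\alpha\prec\beta$ if moreover $\alpha\neq\beta$. The $\infty$-depth of $\beta\in\Phi^+$ is $\operatorname{dp}_\infty(\beta)=|\{\alpha\in\Phi^+ : \alpha\prec\beta\}|$, and $\Sigma_n(W)=\{\beta\in\Phi^+:\operatorname{dp}_\infty(\beta)\le n\}$ is the set of $n$-small roots. An element $w\in W$ is $n$-low if $N(w)=\operatorname{cone}_\Phi(A)$ for some $A\subseteq\Sigma_n(W)$. Reflection subgroups and bipodality.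 For a reflection subgroup $W'$ of $W$ (a subgroup generated by reflections $s_\beta$, $\beta\in\Phi$), put $\Phi_{W'}=\{\beta\in\Phi: s_\beta\in W'\}$, $\Phi_{W'}^+=\Phi_{W'}\cap\Phi^+$, and let $\Delta_{W'}=\{\alpha\in\Phi^+: N(s_\alpha)\cap\Phi_{W'}=\{\alpha\}\}$ be its canonical simple system. A maximal dihedral reflection subgroup is a subgroup $W'$ generated by $\{s_\beta:\beta\in P\cap\Phi\}$, where $P$ is a plane (2-dimensional linear subspace) of $V$ containing at least two positive roots; then $\Phi_{W'}=P\cap\Phi$ and $\Delta_{W'}=\{\alpha,\beta\}$ consists of two positive roots with $\Phi^+_{W'}=\operatorname{cone}(\alpha,\beta)\cap\Phi$. A subset $A\subseteq\Phi^+$ is bipodal if for every maximal dihedral reflection subgroup $W'$ of $W$: $A\cap(\Phi_{W'}^+\setminus\Delta_{W'})\neq\emptyset$ implies $\Delta_{W'}\subseteq A$. *)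

theory Defs
  imports
    "HOL-Analysis.Convex"
    "HOL-Analysis.Linear_Algebra"
    "HOL-Library.Extended_Nat"
    "HOL-Algebra.Multiplicative_Group"
    "HOL-Algebra.Generated_Groups"
    "HOL-Algebra.Lattice"
begin

section \<open>Coxeter systems\<close>

context group
begin

text \<open>\<^const>\<open>ord\<close> is \<open>0\<close> on elements of infinite order; the Coxeter matrix has \<open>\<infinity>\<close> there.\<close>

definition coxeter_matrix :: "'a \<Rightarrow> 'a \<Rightarrow> enat" where
  "coxeter_matrix s t = (if ord (s \<otimes> t) = 0 then \<infinity> else enat (ord (s \<otimes> t)))"

definition word_prod :: "'a list \<Rightarrow> 'a" where
  "word_prod ws = foldr (\<otimes>) ws \<one>"

text \<open>
  The congruence on words over \<open>S\<close> generated by the relations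
  \<open>(s t)\<^bsup>m(s,t)\<^esup> = 1\<close>, \<open>m(s,t) < \<infinity>\<close>. As \<open>m(s,s) = 1\<close> for involutions, these include
  \<open>s\<^sup>2 = 1\<close>, so formal inverses are not needed and the quotient of the free monoid by this
  congruence is the group presented by these relations.
\<close>

inductive coxeter_equiv :: "'a set \<Rightarrow> 'a list \<Rightarrow> 'a list \<Rightarrow> bool" for S where
  refl: "set us \<subseteq> S \<Longrightarrow> coxeter_equiv S us us"
| sym: "coxeter_equiv S us vs \<Longrightarrow> coxeter_equiv S vs us"
| trans: "coxeter_equiv S us vs \<Longrightarrow> coxeter_equiv S vs ws \<Longrightarrow> coxeter_equiv S us ws"
| relation: "\<lbrakk>set us \<subseteq> S; set vs \<subseteq> S; s \<in> S; t \<in> S; coxeter_matrix s t = enat m\<rbrakk>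
    \<Longrightarrow> coxeter_equiv S (us @ concat (replicate m [s, t]) @ vs) (us @ vs)"

end

text \<open>
  \<open>S\<close> is a set of involutions generating \<open>G\<close>, and \<open>G\<close> is presented by the generators \<open>S\<close> and
  the relations \<open>(s t)\<^bsup>m(s,t)\<^esup> = 1\<close>, where \<open>m(s,t)\<close> is the order of \<open>s t\<close>. The relations hold in
  \<open>G\<close> by definition of \<open>m\<close>; the last axiom says that they imply all others.
\<close>

locale coxeter_system = group G for G (structure) +
  fixes S :: "'a set"
  assumes S_subset: "S \<subseteq> carrier G"
    and S_generates: "generate G S = carrier G"
    and S_involutions: "s \<in> S \<Longrightarrow> ord s = 2"
    and S_presents: "\<lbrakk>set ws \<subseteq> S; word_prod ws = \<one>\<rbrakk> \<Longrightarrow> coxeter_equiv S ws []"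
begin

definition len :: "'a \<Rightarrow> nat" where
  "len w = (LEAST n. \<exists>ws. set ws \<subseteq> S \<and> length ws = n \<and> word_prod ws = w)"

definition is_prefix :: "'a \<Rightarrow> 'a \<Rightarrow> bool" where
  "is_prefix u w \<longleftrightarrow> u \<in> carrier G \<and> (\<exists>v\<in>carrier G. w = u \<otimes> v \<and> len w = len u + len v)"

definition is_suffix :: "'a \<Rightarrow> 'a \<Rightarrow> bool" where
  "is_suffix v w \<longleftrightarrow> v \<in> carrier G \<and> (\<exists>u\<in>carrier G. w = u \<otimes> v \<and> len w = len u + len v)"

definition weak_order :: "'a gorder" where
  "weak_order = \<lparr>carrier = carrier G, eq = (=), le = is_prefix\<rparr>"

definition bounded_above :: "'a set \<Rightarrow> bool" where
  "bounded_above X \<longleftrightarrow> (\<exists>g\<in>carrier G. \<forall>x\<in>X. x \<sqsubseteq>\<^bsub>weak_order\<^esub> g)"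

definition garside_shadow :: "'a set \<Rightarrow> bool" where
  "garside_shadow A \<longleftrightarrow> A \<subseteq> carrier G \<and> S \<subseteq> A \<and>
     (\<forall>X\<subseteq>A. bounded_above X \<longrightarrow> \<Squnion>\<^bsub>weak_order\<^esub> X \<in> A) \<and>
     (\<forall>w\<in>A. \<forall>v. is_suffix v w \<longrightarrow> v \<in> A)"

end

section \<open>Geometric representations\<close>

text \<open>
  The cone of a set, the set of non-negative linear combinations of its elements, is the
  library's convex cone hull (so the cone of the empty set is \<open>{0}\<close>):
\<close>

lemma convex_cone_hull_nonneg_combinations:
  fixes A :: "'v::real_vector set"
  shows "convex_cone hull A = {(\<Sum>a\<in>F. c a *\<^sub>R a) |F c. finite F \<and> F \<subseteq> A \<and> (\<forall>a\<in>F. c a \<ge> 0)}"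
    (is "_ = ?R")
proof (rule hull_unique)
  show "A \<subseteq> ?R"
  proof
    fix a assume "a \<in> A"
    then show "a \<in> ?R"
      by (intro CollectI exI[of _ "{a}"] exI[of _ "\<lambda>_. 1"]) simp
  qed
  show "convex_cone ?R"
    unfolding convex_cone_iff
  proof (intro conjI ballI allI impI)
    show "0 \<in> ?R"
      by (intro CollectI exI[of _ "{}"] exI[of _ "\<lambda>_. 0"]) simp
  next
    fix x y assume "x \<in> ?R" "y \<in> ?R"
    then obtain F c H d where x: "x = (\<Sum>a\<in>F. c a *\<^sub>R a)" "finite F" "F \<subseteq> A" "\<forall>a\<in>F. c a \<ge> 0"
      and y: "y = (\<Sum>a\<in>H. d a *\<^sub>R a)" "finite H" "H \<subseteq> A" "\<forall>a\<in>H. d a \<ge> 0"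
      by blast
    define e where "e a = (if a \<in> F then c a else 0) + (if a \<in> H then d a else 0)" for a
    have "x = (\<Sum>a\<in>F \<union> H. (if a \<in> F then c a else 0) *\<^sub>R a)"
      unfolding x(1) using x(2) y(2) by (intro sum.mono_neutral_cong_left) auto
    moreover have "y = (\<Sum>a\<in>F \<union> H. (if a \<in> H then d a else 0) *\<^sub>R a)"
      unfolding y(1) using x(2) y(2) by (intro sum.mono_neutral_cong_left) auto
    ultimately have "x + y = (\<Sum>a\<in>F \<union> H. e a *\<^sub>R a)"
      by (simp only: e_def scaleR_add_left sum.distrib)
    then show "x + y \<in> ?R"
      using x y by (intro CollectI exI[of _ "F \<union> H"] exI[of _ e]) (auto simp: e_def)
  next
    fix x and r :: real assume "x \<in> ?R" "r \<ge> 0"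
    then obtain F c where x: "x = (\<Sum>a\<in>F. c a *\<^sub>R a)" "finite F" "F \<subseteq> A" "\<forall>a\<in>F. c a \<ge> 0"
      by blast
    then show "r *\<^sub>R x \<in> ?R"
      using \<open>r \<ge> 0\<close>
      by (intro CollectI exI[of _ F] exI[of _ "\<lambda>a. r * c a"]) (simp add: scaleR_sum_right)
  qed
next
  fix T assume T: "A \<subseteq> T" "convex_cone T"
  have "(\<Sum>a\<in>F. c a *\<^sub>R a) \<in> T" if "finite F" "F \<subseteq> A" "\<forall>a\<in>F. c a \<ge> 0" for F c
    using that
    by (induction F) (use T in \<open>auto simp: convex_cone_iff\<close>)
  then show "?R \<subseteq> T" by blast
qed

definition isometry_group :: "('v::real_vector \<Rightarrow> 'v \<Rightarrow> real) \<Rightarrow> ('v \<Rightarrow> 'v) monoid" where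
  "isometry_group B = \<lparr>carrier = {f. linear f \<and> bij f \<and> (\<forall>x y. B (f x) (f y) = B x y)},
     mult = (\<circ>), one = id\<rparr>"

definition reflection :: "('v::real_vector \<Rightarrow> 'v \<Rightarrow> real) \<Rightarrow> 'v \<Rightarrow> 'v \<Rightarrow> 'v" where
  "reflection B \<beta> v = v - (2 * B \<beta> v) *\<^sub>R \<beta>"

text \<open>
  \<open>\<alpha> s\<close> is the simple root of \<open>s \<in> S\<close> and \<open>\<rho>\<close> is the action of \<open>G\<close> on the vector space;
  \<^const>\<open>mon\<close> is the set of injective homomorphisms. The simple roots need not be linearly
  independent.
\<close>

locale geometric_representation = coxeter_system G S for G (structure) and S +
  fixes B :: "'v::real_vector \<Rightarrow> 'v \<Rightarrow> real"
    and \<alpha> :: "'a \<Rightarrow> 'v"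
    and \<rho> :: "'a \<Rightarrow> 'v \<Rightarrow> 'v"
  assumes finite_S: "finite S"
    and B_bilinear: "bilinear B"
    and B_sym: "B x y = B y x"
    and \<alpha>_inj: "inj_on \<alpha> S"
    and \<alpha>_positively_independent:
      "\<lbrakk>\<And>\<beta>. \<beta> \<in> \<alpha> ` S \<Longrightarrow> a \<beta> \<ge> 0; (\<Sum>\<beta>\<in>\<alpha> ` S. a \<beta> *\<^sub>R \<beta>) = 0\<rbrakk> \<Longrightarrow> \<forall>\<beta>\<in>\<alpha> ` S. a \<beta> = 0"
    and B_distinct: "\<lbrakk>\<beta> \<in> \<alpha> ` S; \<gamma> \<in> \<alpha> ` S; \<beta> \<noteq> \<gamma>\<rbrakk>
      \<Longrightarrow> B \<beta> \<gamma> \<in> {..-1} \<union> {- cos (pi / real k) | k. k \<ge> 2}"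
    and B_unit: "\<beta> \<in> \<alpha> ` S \<Longrightarrow> B \<beta> \<beta> = 1"
    and \<rho>_faithful: "\<rho> \<in> mon G (isometry_group B)"
    and \<rho>_simple: "s \<in> S \<Longrightarrow> \<rho> s = reflection B (\<alpha> s)"
begin

definition roots :: "'v set" (\<open>\<Phi>\<close>) where
  "\<Phi> = (\<Union>w\<in>carrier G. \<rho> w ` \<alpha> ` S)"

definition pos_roots :: "'v set" (\<open>\<Phi>\<^sup>+\<close>) where
  "\<Phi>\<^sup>+ = (convex_cone hull (\<alpha> ` S)) \<inter> \<Phi>"

definition neg_roots :: "'v set" (\<open>\<Phi>\<^sup>-\<close>) where
  "\<Phi>\<^sup>- = uminus ` \<Phi>\<^sup>+"

definition root_cone :: "'v set \<Rightarrow> 'v set" where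
  "root_cone A = (convex_cone hull A) \<inter> \<Phi>"

text \<open>The element of \<open>G\<close> acting as the reflection in a root; unique as \<open>\<rho>\<close> is faithful.\<close>

definition refl_elt :: "'v \<Rightarrow> 'a" where
  "refl_elt \<beta> = (THE w. w \<in> carrier G \<and> \<rho> w = reflection B \<beta>)"

definition inversion_set :: "'a \<Rightarrow> 'v set" where
  "inversion_set w = \<Phi>\<^sup>+ \<inter> \<rho> w ` \<Phi>\<^sup>-"

definition dominated :: "'v \<Rightarrow> 'v \<Rightarrow> bool"  (infix \<open>\<preceq>\<close> 50) where
  "\<beta> \<preceq> \<gamma> \<longleftrightarrow> (\<forall>w\<in>carrier G. \<gamma> \<in> inversion_set w \<longrightarrow> \<beta> \<in> inversion_set w)"

definition inf_depth :: "'v \<Rightarrow> enat" where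
  "inf_depth \<beta> = (let D = {\<gamma>\<in>\<Phi>\<^sup>+. \<gamma> \<preceq> \<beta> \<and> \<gamma> \<noteq> \<beta>} in if finite D then enat (card D) else \<infinity>)"

definition small_roots :: "nat \<Rightarrow> 'v set" where
  "small_roots n = {\<beta>\<in>\<Phi>\<^sup>+. inf_depth \<beta> \<le> enat n}"

definition low_elements :: "nat \<Rightarrow> 'a set" where
  "low_elements n = {w\<in>carrier G. \<exists>A\<subseteq>small_roots n. inversion_set w = root_cone A}"

definition subgroup_roots :: "'a set \<Rightarrow> 'v set" where
  "subgroup_roots W' = {\<beta>\<in>\<Phi>. refl_elt \<beta> \<in> W'}"

definition canonical_simple_system :: "'a set \<Rightarrow> 'v set" where
  "canonical_simple_system W' =
     {\<beta>\<in>\<Phi>\<^sup>+. inversion_set (refl_elt \<beta>) \<inter> subgroup_roots W' = {\<beta>}}"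

definition maximal_dihedral :: "'a set \<Rightarrow> bool" where
  "maximal_dihedral W' \<longleftrightarrow>
     (\<exists>P. subspace P \<and> dim P = 2 \<and> (\<exists>\<beta>\<in>P \<inter> \<Phi>\<^sup>+. \<exists>\<gamma>\<in>P \<inter> \<Phi>\<^sup>+. \<beta> \<noteq> \<gamma>) \<and>
        W' = generate G (refl_elt ` (P \<inter> \<Phi>)))"

definition bipodal :: "'v set \<Rightarrow> bool" where
  "bipodal A \<longleftrightarrow> A \<subseteq> \<Phi>\<^sup>+ \<and>
     (\<forall>W'. maximal_dihedral W' \<longrightarrow>
        A \<inter> ((subgroup_roots W' \<inter> \<Phi>\<^sup>+) - canonical_simple_system W') \<noteq> {} \<longrightarrow>
        canonical_simple_system W' \<subseteq> A)"

end

end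

theory Submission
  imports Defs
begin

text \<open>
  A root is negative or positive, and \<open>w(\<alpha> s)\<close> is positive if and only if \<open>w s\<close> is longer than \<open>w\<close>
  (lemma \<open>ascent_iff\<close>). This makes the weak order the inclusion order of the finite sets \<open>N w\<close> of
  inversions. Everything else rests on a property of the depth \<open>dp\<close>, the number of positive roots
  that a root strictly dominates, and on one of the form.

  The first property holds for all reflections: if \<open>B \<epsilon> \<delta> \<le> 0\<close> for positive roots, then \<open>\<delta>\<close> is at most as
  deep as its mirror image in \<open>\<epsilon>\<close> (\<open>dp_le_dp_refl\<close>). The second property depends on the labels: two roots
  whose product is strictly between \<open>-1\<close> and \<open>1\<close> have product \<open>0\<close>, \<open>1/2\<close> or \<open>-1/2\<close>
  (\<open>B_root_values\<close>), so that finite maximal dihedral subgroups are of type A1 x A1 or A2. If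
  the product is \<open>\<ge> 1\<close>, one of the roots dominates the other (\<open>dom_or_dom\<close>).

  Bipodality asks that the simple roots of a plane are at most as deep as the other positive roots
  \<open>\<gamma>\<close> of the plane. If the simple root \<open>\<delta>\<close> has a positive product with \<open>\<gamma>\<close>, then either \<open>\<gamma>\<close> dominates
  \<open>\<delta>\<close>, or \<open>\<gamma>\<close> is the sum of \<open>\<delta>\<close> and a root \<open>\<epsilon>\<close>, hence the mirror image of \<open>\<delta>\<close> in \<open>\<epsilon>\<close>. If the product
  is not positive, reflecting \<open>\<gamma>\<close> in a root of the plane leads to the first case or to \<open>\<delta>\<close> itself
  (\<open>dp_le_in_plane\<close>).

  There are finitely many small roots because in an infinite ascending path of the root poset with
  bounded depth the products with the relevant simple roots would eventually take finitely many values,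
  and a repetition of these values forces a strict dominance between roots of equal depth
  (\<open>no_infinite_chain\<close>). An element is determined by its inversions, so there are finitely many low
  elements.

  The inversion set of a join is the set of roots in the cone of the union of the inversion sets
  (\<open>ex_join\<close>), so low elements are closed under joins. For suffixes, \<open>w\<close> is low if and only if the extreme
  inversions of \<open>w\<close> are small (\<open>low_elements_iff\<close>). When the first letter \<open>s\<close> of \<open>s w\<close> is removed, every
  extreme inversion \<open>\<beta>\<close> of \<open>w\<close> is at most as deep as some extreme inversion of \<open>s w\<close> in the plane
  of \<open>\<alpha> s\<close> and \<open>\<beta>\<close> (\<open>dp_le_of_N1_S\<close>).
\<close>

section \<open>Words and lengths\<close>

context coxeter_system
begin

lemma S_closed [simp]: "s \<in> S \<Longrightarrow> s \<in> carrier G"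
  using S_subset by blast

lemma S_square:
  assumes "s \<in> S" shows "s \<otimes> s = \<one>"
proof -
  have "s [^] (2::nat) = \<one>"
    using pow_eq_id[of s 2] S_involutions[OF assms] assms by simp
  then show ?thesis using assms by (simp add: numeral_2_eq_2)
qed

lemma S_inv: "s \<in> S \<Longrightarrow> inv s = s"
  by (simp add: S_square inv_equality)

lemma S_cancel: "s \<in> S \<Longrightarrow> w \<in> carrier G \<Longrightarrow> s \<otimes> (s \<otimes> w) = w"
  by (simp add: S_square m_assoc[symmetric])

lemma S_cancel_right: "s \<in> S \<Longrightarrow> w \<in> carrier G \<Longrightarrow> w \<otimes> s \<otimes> s = w"
  by (simp add: S_square m_assoc)

lemma word_prod_simps [simp]: "word_prod [] = \<one>" "word_prod (s # ws) = s \<otimes> word_prod ws"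
  by (simp_all add: word_prod_def)

lemma word_prod_closed [simp]: "set ws \<subseteq> S \<Longrightarrow> word_prod ws \<in> carrier G"
  by (induction ws) auto

lemma word_prod_append:
  "set us \<subseteq> S \<Longrightarrow> set vs \<subseteq> S \<Longrightarrow> word_prod (us @ vs) = word_prod us \<otimes> word_prod vs"
  by (induction us) (auto simp: m_assoc)

lemma word_prod_rev: "set ws \<subseteq> S \<Longrightarrow> word_prod (rev ws) = inv (word_prod ws)"
  by (induction ws) (auto simp: word_prod_append inv_mult_group S_inv)

lemma ex_word:
  assumes "w \<in> carrier G"
  shows "\<exists>ws. set ws \<subseteq> S \<and> word_prod ws = w"
proof -
  have "w \<in> generate G S" using assms S_generates by simp
  then show ?thesis
  proof (induction rule: generate.induct)
    case one
    show ?case by (intro exI[of _ "[]"]) simp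
  next
    case (incl h)
    then show ?case by (intro exI[of _ "[h]"]) simp
  next
    case (inv h)
    then show ?case by (intro exI[of _ "[h]"]) (simp add: S_inv)
  next
    case (eng h1 h2)
    then show ?case by (metis word_prod_append set_append Un_subset_iff)
  qed
qed

lemma ex_reduced_word:
  assumes "w \<in> carrier G"
  obtains ws where "set ws \<subseteq> S" "length ws = len w" "word_prod ws = w"
proof -
  let ?P = "\<lambda>n. \<exists>ws. set ws \<subseteq> S \<and> length ws = n \<and> word_prod ws = w"
  obtain ws where "set ws \<subseteq> S" "word_prod ws = w" using ex_word[OF assms] by blast
  then have "?P (length ws)" by blast
  then have "?P (len w)" unfolding len_def by (rule LeastI[of ?P])
  then show ?thesis using that by blast
qed

lemma len_word_le: "set ws \<subseteq> S \<Longrightarrow> len (word_prod ws) \<le> length ws"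
  unfolding len_def by (rule Least_le) blast

lemma len_one [simp]: "len \<one> = 0"
  using len_word_le[of "[]"] by simp

lemma len_eq_0: "w \<in> carrier G \<Longrightarrow> len w = 0 \<longleftrightarrow> w = \<one>"
  by (metis ex_reduced_word len_one length_0_conv word_prod_simps(1))

lemma len_mult_le:
  assumes "u \<in> carrier G" "v \<in> carrier G"
  shows "len (u \<otimes> v) \<le> len u + len v"
proof -
  obtain us where us: "set us \<subseteq> S" "length us = len u" "word_prod us = u"
    using ex_reduced_word[OF assms(1)] .
  obtain vs where vs: "set vs \<subseteq> S" "length vs = len v" "word_prod vs = v"
    using ex_reduced_word[OF assms(2)] .
  show ?thesis using len_word_le[of "us @ vs"] us vs by (simp add: word_prod_append)
qed

lemma len_inv:
  assumes "w \<in> carrier G" shows "len (inv w) = len w"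
proof -
  have le: "len (inv v) \<le> len v" if v: "v \<in> carrier G" for v
  proof -
    obtain vs where vs: "set vs \<subseteq> S" "length vs = len v" "word_prod vs = v"
      using ex_reduced_word[OF v] .
    show ?thesis using len_word_le[of "rev vs"] vs by (simp add: word_prod_rev)
  qed
  show ?thesis using le[of w] le[of "inv w"] assms by simp
qed

lemma len_S_le: "s \<in> S \<Longrightarrow> len s \<le> 1"
  using len_word_le[of "[s]"] by simp

text \<open>
  The defining relations have even length, so the parity of a word depends only on its product.
\<close>

lemma coxeter_equiv_even: "coxeter_equiv S us vs \<Longrightarrow> even (length us) = even (length vs)"
  by (induction rule: coxeter_equiv.induct) (auto simp: length_concat sum_list_replicate)

lemma word_parity:
  assumes "set us \<subseteq> S" "set vs \<subseteq> S" "word_prod us = word_prod vs"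
  shows "even (length us) = even (length vs)"
proof -
  have "word_prod (us @ rev vs) = \<one>"
    using assms by (simp add: word_prod_append word_prod_rev)
  then have "coxeter_equiv S (us @ rev vs) []"
    using S_presents[of "us @ rev vs"] assms by simp
  then show ?thesis using coxeter_equiv_even[of "us @ rev vs" "[]"] by simp
qed

lemma len_parity:
  assumes "w \<in> carrier G" "s \<in> S"
  shows "even (len (w \<otimes> s)) \<noteq> even (len w)"
proof -
  obtain ws where ws: "set ws \<subseteq> S" "length ws = len w" "word_prod ws = w"
    using ex_reduced_word[OF assms(1)] .
  obtain vs where vs: "set vs \<subseteq> S" "length vs = len (w \<otimes> s)" "word_prod vs = w \<otimes> s"
    using ex_reduced_word[of "w \<otimes> s"] assms by auto
  have "even (length vs) = even (length (ws @ [s]))"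
    using ws vs assms by (intro word_parity) (auto simp: word_prod_append)
  then show ?thesis using ws vs by simp
qed

lemma len_mult_S:
  assumes "w \<in> carrier G" "s \<in> S"
  shows "len (w \<otimes> s) = Suc (len w) \<or> len w = Suc (len (w \<otimes> s))"
proof -
  have "len (w \<otimes> s) \<le> Suc (len w)"
    using len_mult_le[of w s] len_S_le[of s] assms by simp
  moreover have "len w \<le> Suc (len (w \<otimes> s))"
    using len_mult_le[of "w \<otimes> s" s] len_S_le[of s] assms by (simp add: S_cancel_right)
  moreover have "len (w \<otimes> s) \<noteq> len w" using len_parity[OF assms] by auto
  ultimately show ?thesis by linarith
qed

lemma len_S_mult:
  assumes "w \<in> carrier G" "s \<in> S"
  shows "len (s \<otimes> w) = Suc (len w) \<or> len w = Suc (len (s \<otimes> w))"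
proof -
  have "len (inv w \<otimes> s) = len (s \<otimes> w)"
    using len_inv[of "s \<otimes> w"] assms by (simp add: inv_mult_group S_inv)
  then show ?thesis using len_mult_S[of "inv w" s] assms by (simp add: len_inv)
qed

lemma ex_left_descent:
  assumes "w \<in> carrier G" "w \<noteq> \<one>"
  obtains s where "s \<in> S" "len w = Suc (len (s \<otimes> w))"
proof -
  obtain ws where ws: "set ws \<subseteq> S" "length ws = len w" "word_prod ws = w"
    using ex_reduced_word[OF assms(1)] .
  then obtain s vs where [simp]: "ws = s # vs" using assms(2) by (cases ws) auto
  have "s \<otimes> w = word_prod vs" using ws S_cancel[of s "word_prod vs"] by auto
  then have "len (s \<otimes> w) < len w" using len_word_le[of vs] ws by auto
  then show ?thesis using that[of s] len_S_mult[of w s] assms ws by fastforce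
qed

lemma ex_right_descent:
  assumes "w \<in> carrier G" "w \<noteq> \<one>"
  obtains s where "s \<in> S" "len w = Suc (len (w \<otimes> s))"
proof -
  have "inv w \<noteq> \<one>" using assms inv_eq_1_iff by blast
  then obtain s where s: "s \<in> S" "len (inv w) = Suc (len (s \<otimes> inv w))"
    using ex_left_descent[of "inv w"] assms by auto
  moreover have "len (s \<otimes> inv w) = len (w \<otimes> s)"
    using len_inv[of "w \<otimes> s"] s assms by (simp add: inv_mult_group S_inv)
  ultimately show ?thesis using that[of s] len_inv assms by simp
qed

text \<open>
  Every element is reached from \<open>\<one>\<close> by multiplications on the left that raise the length; most
  statements about inversion sets are proved along such a path.
\<close>

lemma len_induct [consumes 1, case_names one mult]:
  assumes "w \<in> carrier G" "P \<one>"
    and step: "\<And>s w. \<lbrakk>s \<in> S; w \<in> carrier G; len (s \<otimes> w) = Suc (len w); P w\<rbrakk> \<Longrightarrow> P (s \<otimes> w)"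
  shows "P w"
  using assms(1)
proof (induction "len w" arbitrary: w rule: less_induct)
  case less
  show ?case
  proof (cases "w = \<one>")
    case False
    then obtain s where s: "s \<in> S" "len w = Suc (len (s \<otimes> w))"
      using ex_left_descent less.prems by blast
    then have "P (s \<otimes> w)" using less by auto
    then show ?thesis using step[of s "s \<otimes> w"] s less.prems by (simp add: S_cancel)
  qed (use assms in simp)
qed

end

section \<open>The representation and the cone of the simple roots\<close>

context geometric_representation
begin

lemma rho_linear: "w \<in> carrier G \<Longrightarrow> linear (\<rho> w)"
  and rho_B: "w \<in> carrier G \<Longrightarrow> B (\<rho> w x) (\<rho> w y) = B x y"
  using \<rho>_faithful by (auto simp: mon_def hom_def isometry_group_def Pi_iff)

lemma rho_mult: "u \<in> carrier G \<Longrightarrow> v \<in> carrier G \<Longrightarrow> \<rho> (u \<otimes> v) x = \<rho> u (\<rho> v x)"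
  using \<rho>_faithful by (auto simp: mon_def hom_def isometry_group_def)

lemma rho_inj: "u \<in> carrier G \<Longrightarrow> v \<in> carrier G \<Longrightarrow> (\<And>x. \<rho> u x = \<rho> v x) \<Longrightarrow> u = v"
  using \<rho>_faithful by (auto simp: mon_def dest: inj_onD)

lemma rho_one [simp]: "\<rho> \<one> x = x"
proof -
  have "bij (\<rho> \<one>)" using \<rho>_faithful by (auto simp: mon_def hom_def isometry_group_def Pi_iff)
  moreover have "\<rho> \<one> (\<rho> \<one> x) = \<rho> \<one> x" using rho_mult[of \<one> \<one> x] by simp
  ultimately show ?thesis by (metis bij_def injD)
qed

lemma rho_inv [simp]:
  "w \<in> carrier G \<Longrightarrow> \<rho> (inv w) (\<rho> w x) = x" "w \<in> carrier G \<Longrightarrow> \<rho> w (\<rho> (inv w) x) = x"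
  by (simp_all flip: rho_mult)

lemma rho_B_inv: "w \<in> carrier G \<Longrightarrow> B (\<rho> (inv w) x) y = B x (\<rho> w y)"
  using rho_B[of w "\<rho> (inv w) x" y] by simp

lemma rho_simps:
  assumes "w \<in> carrier G"
  shows "\<rho> w (x + y) = \<rho> w x + \<rho> w y" "\<rho> w (x - y) = \<rho> w x - \<rho> w y" "\<rho> w (- x) = - \<rho> w x"
    "\<rho> w (r *\<^sub>R x) = r *\<^sub>R \<rho> w x" "\<rho> w 0 = 0" "\<rho> w (sum f A) = (\<Sum>a\<in>A. \<rho> w (f a))"
  using rho_linear[OF assms]
  by (simp_all add: linear_add linear_diff linear_neg linear_scale linear_0 linear_sum)

lemma rho_eq_iff: "w \<in> carrier G \<Longrightarrow> \<rho> w x = \<rho> w y \<longleftrightarrow> x = y"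
  by (metis rho_inv(1))

lemma B_simps:
  "B (x + y) z = B x z + B y z" "B x (y + z) = B x y + B x z"
  "B (x - y) z = B x z - B y z" "B x (y - z) = B x y - B x z"
  "B (- x) z = - B x z" "B x (- z) = - B x z"
  "B (r *\<^sub>R x) z = r * B x z" "B x (r *\<^sub>R z) = r * B x z" "B 0 z = 0" "B x 0 = 0"
  using B_bilinear
  by (simp_all add: bilinear_ladd bilinear_radd bilinear_lsub bilinear_rsub bilinear_lneg
      bilinear_rneg bilinear_lmul bilinear_rmul bilinear_lzero bilinear_rzero)

lemma B_sum_right: "B x (\<Sum>a\<in>A. f a) = (\<Sum>a\<in>A. B x (f a))"
  using B_bilinear linear_sum[of "B x" f A] by (simp add: bilinear_def)

lemma rho_S: "s \<in> S \<Longrightarrow> \<rho> s v = v - (2 * B (\<alpha> s) v) *\<^sub>R \<alpha> s"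
  by (simp add: \<rho>_simple reflection_def)

lemma B_alpha [simp]: "s \<in> S \<Longrightarrow> B (\<alpha> s) (\<alpha> s) = 1"
  by (simp add: B_unit)

lemma rho_S_alpha: "s \<in> S \<Longrightarrow> \<rho> s (\<alpha> s) = - \<alpha> s"
  by (simp add: rho_S algebra_simps scaleR_2)

lemma rho_S_twice: "s \<in> S \<Longrightarrow> \<rho> s (\<rho> s v) = v"
  by (simp add: S_square flip: rho_mult)

lemma rho_S_pair:
  assumes "s \<in> S"
  shows "\<rho> s (x *\<^sub>R \<alpha> s + y *\<^sub>R v) = (- x - 2 * y * B (\<alpha> s) v) *\<^sub>R \<alpha> s + y *\<^sub>R v"
proof -
  have "B (\<alpha> s) (x *\<^sub>R \<alpha> s + y *\<^sub>R v) = x + y * B (\<alpha> s) v"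
    using assms by (simp add: B_simps)
  moreover have "- x - 2 * y * B (\<alpha> s) v = x - 2 * (x + y * B (\<alpha> s) v)"
    by (simp add: algebra_simps)
  ultimately show ?thesis using assms by (simp only: rho_S scaleR_diff_left) simp
qed

lemma B_alpha_le_0:
  assumes "s \<in> S" "t \<in> S" "s \<noteq> t"
  shows "B (\<alpha> s) (\<alpha> t) \<le> 0"
proof -
  have "\<alpha> s \<noteq> \<alpha> t" using assms \<alpha>_inj by (auto dest: inj_onD)
  then have *: "B (\<alpha> s) (\<alpha> t) \<in> {..-1} \<union> {- cos (pi / real k) | k. k \<ge> 2}"
    using B_distinct assms by blast
  have "cos (pi / real k) \<ge> 0" if "k \<ge> 2" for k
  proof -
    have "0 \<le> pi / real k" "pi / real k \<le> pi / 2" using that by (auto simp: field_simps)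
    moreover have "- (pi / 2) \<le> 0" by simp
    ultimately show ?thesis by (intro cos_ge_zero) linarith+
  qed
  then show ?thesis using * by fastforce
qed

definition pos :: "'v \<Rightarrow> bool" where
  "pos v \<longleftrightarrow> v \<in> convex_cone hull (\<alpha> ` S)"

abbreviation neg :: "'v \<Rightarrow> bool" where
  "neg v \<equiv> pos (- v)"

lemma pos_0 [simp]: "pos 0" and pos_add: "pos x \<Longrightarrow> pos y \<Longrightarrow> pos (x + y)"
  and pos_scale: "r \<ge> 0 \<Longrightarrow> pos x \<Longrightarrow> pos (r *\<^sub>R x)"
  using convex_cone_convex_cone_hull[of "\<alpha> ` S"] by (auto simp: pos_def convex_cone_iff)

lemma pos_alpha [simp]: "s \<in> S \<Longrightarrow> pos (\<alpha> s)"
  by (simp add: pos_def hull_inc)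

lemma neg_add: "neg x \<Longrightarrow> neg y \<Longrightarrow> neg (x + y)"
  using pos_add[of "-x" "-y"] by simp

lemma neg_scale: "r \<ge> 0 \<Longrightarrow> neg x \<Longrightarrow> neg (r *\<^sub>R x)"
  using pos_scale[of r "-x"] by simp

lemma pos_sum: "(\<And>a. a \<in> A \<Longrightarrow> pos (f a)) \<Longrightarrow> pos (sum f A)"
  by (induction A rule: infinite_finite_induct) (auto intro: pos_add)

lemma pos_combination:
  assumes "pos v"
  obtains c where "\<And>s. s \<in> S \<Longrightarrow> c s \<ge> 0" "v = (\<Sum>s\<in>S. c s *\<^sub>R \<alpha> s)"
proof -
  obtain F c where F: "v = (\<Sum>a\<in>F. c a *\<^sub>R a)" "finite F" "F \<subseteq> \<alpha> ` S" "\<forall>a\<in>F. c a \<ge> 0"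
    using assms unfolding pos_def convex_cone_hull_nonneg_combinations by blast
  have "v = (\<Sum>a\<in>\<alpha> ` S. (if a \<in> F then c a else 0) *\<^sub>R a)"
    unfolding F(1) using F finite_S by (intro sum.mono_neutral_cong_left) auto
  also have "\<dots> = (\<Sum>s\<in>S. (if \<alpha> s \<in> F then c (\<alpha> s) else 0) *\<^sub>R \<alpha> s)"
    using \<alpha>_inj by (simp add: sum.reindex)
  finally show ?thesis using that[of "\<lambda>s. if \<alpha> s \<in> F then c (\<alpha> s) else 0"] F by auto
qed

lemma alpha_positively_independent:
  assumes "\<And>s. s \<in> S \<Longrightarrow> c s \<ge> 0" "(\<Sum>s\<in>S. c s *\<^sub>R \<alpha> s) = 0" "s \<in> S"
  shows "c s = 0"
proof -
  define a where "a \<beta> = c (the_inv_into S \<alpha> \<beta>)" for \<beta>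
  have [simp]: "a (\<alpha> r) = c r" if "r \<in> S" for r
    using that \<alpha>_inj by (simp add: a_def the_inv_into_f_f)
  have "(\<Sum>\<beta>\<in>\<alpha> ` S. a \<beta> *\<^sub>R \<beta>) = 0"
    using assms(2) \<alpha>_inj by (simp add: sum.reindex)
  then have "\<forall>\<beta>\<in>\<alpha> ` S. a \<beta> = 0"
    using assms(1) by (intro \<alpha>_positively_independent) auto
  then show ?thesis using assms(3) by auto
qed

lemma pos_neg_zero:
  assumes "pos v" "neg v" shows "v = 0"
proof -
  obtain c where c: "\<And>s. s \<in> S \<Longrightarrow> c s \<ge> 0" "v = (\<Sum>s\<in>S. c s *\<^sub>R \<alpha> s)"
    using pos_combination assms(1) by blast
  obtain d where d: "\<And>s. s \<in> S \<Longrightarrow> d s \<ge> 0" "- v = (\<Sum>s\<in>S. d s *\<^sub>R \<alpha> s)"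
    using pos_combination assms(2) by blast
  have "(\<Sum>s\<in>S. (c s + d s) *\<^sub>R \<alpha> s) = v + - v"
    by (simp only: scaleR_add_left sum.distrib c(2)[symmetric] d(2)[symmetric])
  then have zero: "(\<Sum>s\<in>S. (c s + d s) *\<^sub>R \<alpha> s) = 0" by simp
  have "c s + d s = 0" if "s \<in> S" for s
    by (rule alpha_positively_independent[OF _ zero that]) (simp add: c(1) d(1))
  then have "c s = 0" if "s \<in> S" for s using c(1) d(1) that by (simp add: add_nonneg_eq_0_iff)
  then show ?thesis by (simp add: c(2))
qed

text \<open>
  A simple root spans an extreme ray of the cone although the simple roots may be linearly
  dependent. A positive multiple of \<open>\<alpha> s\<close> is not a combination of the other simple roots, since these
  have products \<open>\<le> 0\<close> with it; hence all coefficients at other simple roots vanish by positive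
  independence.
\<close>

lemma alpha_extreme:
  assumes s: "s \<in> S" and "pos x" "pos y" "x + y = k *\<^sub>R \<alpha> s"
  obtains a where "a \<ge> 0" "x = a *\<^sub>R \<alpha> s"
proof -
  obtain c where c: "\<And>s. s \<in> S \<Longrightarrow> c s \<ge> 0" "x = (\<Sum>s\<in>S. c s *\<^sub>R \<alpha> s)"
    using pos_combination assms by blast
  obtain d where d: "\<And>s. s \<in> S \<Longrightarrow> d s \<ge> 0" "y = (\<Sum>s\<in>S. d s *\<^sub>R \<alpha> s)"
    using pos_combination assms by blast
  define R where "R = (\<Sum>r\<in>S - {s}. (c r + d r) *\<^sub>R \<alpha> r)"
  have "x + y = (\<Sum>r\<in>S. (c r + d r) *\<^sub>R \<alpha> r)"
    by (simp only: c(2) d(2) scaleR_add_left sum.distrib)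
  also have "\<dots> = (c s + d s) *\<^sub>R \<alpha> s + R"
    unfolding R_def using s finite_S by (simp add: sum.remove)
  finally have R: "R = (k - (c s + d s)) *\<^sub>R \<alpha> s"
    using assms(4) by (simp add: algebra_simps)
  have "B (\<alpha> s) R \<le> 0"
    unfolding R_def B_sum_right
    using s c(1) d(1) B_alpha_le_0
    by (intro sum_nonpos) (auto simp: B_simps intro!: mult_nonneg_nonpos)
  then have k: "k - (c s + d s) \<le> 0" using s by (simp add: R B_simps)
  define e where "e r = (if r = s then c s + d s - k else c r + d r)" for r
  have "(\<Sum>r\<in>S. e r *\<^sub>R \<alpha> r) = e s *\<^sub>R \<alpha> s + (\<Sum>r\<in>S - {s}. e r *\<^sub>R \<alpha> r)"
    using s finite_S by (simp add: sum.remove)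
  also have "(\<Sum>r\<in>S - {s}. e r *\<^sub>R \<alpha> r) = R" by (simp add: R_def e_def)
  finally have "(\<Sum>r\<in>S. e r *\<^sub>R \<alpha> r) = 0" by (simp add: R e_def algebra_simps)
  moreover have "e r \<ge> 0" if "r \<in> S" for r using that k c(1) d(1) by (simp add: e_def)
  ultimately have "e r = 0" if "r \<in> S" for r
    using alpha_positively_independent that by blast
  then have "c r + d r = 0" if "r \<in> S" "r \<noteq> s" for r using that by (metis e_def)
  then have c0: "c r = 0" if "r \<in> S" "r \<noteq> s" for r
    using that c(1) d(1) by (simp add: add_nonneg_eq_0_iff)
  have "(\<Sum>r\<in>S - {s}. c r *\<^sub>R \<alpha> r) = 0" by (rule sum.neutral) (simp add: c0)
  moreover have "x = c s *\<^sub>R \<alpha> s + (\<Sum>r\<in>S - {s}. c r *\<^sub>R \<alpha> r)"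
    unfolding c(2) using s finite_S by (simp add: sum.remove)
  ultimately have "x = c s *\<^sub>R \<alpha> s" by simp
  then show ?thesis using that c(1) s by blast
qed

lemma rho_power: "w \<in> carrier G \<Longrightarrow> \<rho> (w [^] (n::nat)) x = (\<rho> w ^^ n) x"
  by (induction n arbitrary: x) (auto simp: rho_mult funpow_swap1)

text \<open>
  If the form takes the value \<open>-cos (\<pi>/k)\<close> on two simple roots, the product of the two
  reflections is a rotation by \<open>2\<pi>/k\<close>. In their plane, the vector at the angle \<open>\<phi>\<close> from
  \<open>\<alpha> s\<close> is \<open>sin (\<phi> + \<theta>) \<alpha> s + sin \<phi> \<alpha> t\<close> up to the factor \<open>sin \<theta>\<close>, where \<open>\<theta> = \<pi>/k\<close>.
\<close>

lemma ord_dvd_of_cos: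
  assumes s: "s \<in> S" and t: "t \<in> S" and k: "k \<ge> 2" and B: "B (\<alpha> s) (\<alpha> t) = - cos (pi / real k)"
  shows "ord (s \<otimes> t) dvd k"
proof -
  define \<theta> where "\<theta> = pi / real k"
  define p where "p \<phi> = sin (\<phi> + \<theta>) *\<^sub>R \<alpha> s + sin \<phi> *\<^sub>R \<alpha> t" for \<phi>
  have \<theta>: "0 < \<theta>" "\<theta> < pi" using k by (auto simp: \<theta>_def field_simps)
  then have sin: "sin \<theta> > 0" by (rule sin_gt_zero)
  have Bst: "B (\<alpha> s) (\<alpha> t) = - cos \<theta>" "B (\<alpha> t) (\<alpha> s) = - cos \<theta>"
    using B B_sym[of "\<alpha> t"] by (simp_all add: \<theta>_def)
  have rec: "sin (x + 2 * \<theta>) = 2 * cos \<theta> * sin (x + \<theta>) - sin x" for x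
    using sin_add[of "x + \<theta>" \<theta>] sin_diff[of "x + \<theta>" \<theta>] by (simp add: algebra_simps)
  have t_p: "\<rho> t (p \<phi>) = sin (\<phi> + \<theta>) *\<^sub>R \<alpha> s + sin (\<phi> + 2 * \<theta>) *\<^sub>R \<alpha> t" for \<phi>
  proof -
    have "- sin \<phi> - 2 * sin (\<phi> + \<theta>) * B (\<alpha> t) (\<alpha> s) = sin (\<phi> + 2 * \<theta>)"
      unfolding rec[of \<phi>] Bst by simp
    then have "\<rho> t (sin \<phi> *\<^sub>R \<alpha> t + sin (\<phi> + \<theta>) *\<^sub>R \<alpha> s) =
        sin (\<phi> + 2 * \<theta>) *\<^sub>R \<alpha> t + sin (\<phi> + \<theta>) *\<^sub>R \<alpha> s"
      by (simp only: rho_S_pair[OF t])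
    then show ?thesis by (simp only: p_def add.commute)
  qed
  have s_p: "\<rho> s (sin (\<phi> + \<theta>) *\<^sub>R \<alpha> s + sin (\<phi> + 2 * \<theta>) *\<^sub>R \<alpha> t) = p (\<phi> + 2 * \<theta>)" for \<phi>
  proof -
    have "\<phi> + \<theta> + 2 * \<theta> = \<phi> + 2 * \<theta> + \<theta>" "\<phi> + \<theta> + \<theta> = \<phi> + 2 * \<theta>" by simp_all
    then have "- sin (\<phi> + \<theta>) - 2 * sin (\<phi> + 2 * \<theta>) * B (\<alpha> s) (\<alpha> t) = sin (\<phi> + 2 * \<theta> + \<theta>)"
      using rec[of "\<phi> + \<theta>"] unfolding Bst by (simp only:) simp
    then show ?thesis by (simp only: rho_S_pair[OF s] p_def)
  qed
  have step: "\<rho> (s \<otimes> t) (p \<phi>) = p (\<phi> + 2 * \<theta>)" for \<phi>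
    using s t by (simp add: rho_mult t_p s_p)
  have iter: "(\<rho> (s \<otimes> t) ^^ j) (p \<phi>) = p (\<phi> + 2 * real j * \<theta>)" for j \<phi>
    by (induction j) (simp_all add: step algebra_simps)
  have per: "p (\<phi> + 2 * real k * \<theta>) = p \<phi>" for \<phi>
  proof -
    have "2 * real k * \<theta> = 2 * pi" using k by (simp add: \<theta>_def)
    then have "p (\<phi> + 2 * real k * \<theta>) = p (\<phi> + 2 * pi)" by (simp only:)
    also have "\<phi> + 2 * pi + \<theta> = \<phi> + \<theta> + 2 * pi" by simp
    then have "p (\<phi> + 2 * pi) = p \<phi>" by (simp only: p_def sin_periodic)
    finally show ?thesis .
  qed
  define T where "T = \<rho> ((s \<otimes> t) [^] k)"
  have carr: "s \<otimes> t \<in> carrier G" "(s \<otimes> t) [^] k \<in> carrier G" using s t by simp_all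
  have T_p: "T (p \<phi>) = p \<phi>" for \<phi>
    using carr by (simp only: T_def rho_power iter per)
  have p0: "p 0 = sin \<theta> *\<^sub>R \<alpha> s" by (simp add: p_def)
  have p1: "p (pi - \<theta>) = sin \<theta> *\<^sub>R \<alpha> t" by (simp add: p_def sin_diff)
  have "sin \<theta> *\<^sub>R T (\<alpha> s) = sin \<theta> *\<^sub>R \<alpha> s"
    using T_p[of 0] rho_simps(4)[OF carr(2), of "sin \<theta>" "\<alpha> s"] by (simp add: p0 T_def)
  then have Ts: "T (\<alpha> s) = \<alpha> s" using sin by simp
  have "sin \<theta> *\<^sub>R T (\<alpha> t) = sin \<theta> *\<^sub>R \<alpha> t"
    using T_p[of "pi - \<theta>"] rho_simps(4)[OF carr(2), of "sin \<theta>" "\<alpha> t"] by (simp add: p1 T_def)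
  then have Tt: "T (\<alpha> t) = \<alpha> t" using sin by simp
  have "T v = v" for v
  proof -
    \<comment> \<open>The form is positive definite on the plane, so every vector is the sum of one in the plane
      and one that is orthogonal to it, hence fixed.\<close>
    define c where "c = cos \<theta>"
    define D where "D = 1 - c\<^sup>2"
    have "D = (sin \<theta>)\<^sup>2" using sin_squared_eq[of \<theta>] by (simp add: D_def c_def)
    then have D: "D \<noteq> 0" using sin by simp
    define a where "a = (B (\<alpha> s) v + c * B (\<alpha> t) v) / D"
    define b where "b = (B (\<alpha> t) v + c * B (\<alpha> s) v) / D"
    define u where "u = v - a *\<^sub>R \<alpha> s - b *\<^sub>R \<alpha> t"
    have Bst': "B (\<alpha> s) (\<alpha> t) = - c" "B (\<alpha> t) (\<alpha> s) = - c" using Bst by (simp_all add: c_def)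
    have "D * a - c * (D * b) = D * B (\<alpha> s) v" "D * b - c * (D * a) = D * B (\<alpha> t) v"
      using D by (simp_all add: a_def b_def) (simp_all add: D_def algebra_simps power2_eq_square)
    moreover have "D * a - c * (D * b) - D * B (\<alpha> s) v = - (D * (B (\<alpha> s) v - a + c * b))"
      "D * b - c * (D * a) - D * B (\<alpha> t) v = - (D * (B (\<alpha> t) v - b + c * a))"
      by (simp_all add: algebra_simps)
    ultimately have "D * (B (\<alpha> s) v - a + c * b) = 0" "D * (B (\<alpha> t) v - b + c * a) = 0"
      by linarith+
    then have "B (\<alpha> s) v - a + c * b = 0" "B (\<alpha> t) v - b + c * a = 0"
      using D by (simp_all only: mult_eq_0_iff simp_thms)
    then have "B (\<alpha> s) u = 0" "B (\<alpha> t) u = 0"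
      using s t by (simp_all add: u_def B_simps Bst' algebra_simps)
    then have "\<rho> (s \<otimes> t) u = u" using s t by (simp add: rho_mult rho_S)
    then have "(\<rho> (s \<otimes> t) ^^ j) u = u" for j by (induction j) auto
    then have Tu: "T u = u" using carr by (simp add: T_def rho_power)
    have "v = u + a *\<^sub>R \<alpha> s + b *\<^sub>R \<alpha> t" by (simp add: u_def)
    moreover have "T (u + a *\<^sub>R \<alpha> s + b *\<^sub>R \<alpha> t) = u + a *\<^sub>R \<alpha> s + b *\<^sub>R \<alpha> t"
      using carr(2) Tu Ts Tt by (simp add: T_def rho_simps)
    ultimately show ?thesis by simp
  qed
  then have "(s \<otimes> t) [^] k = \<one>" using carr by (intro rho_inj) (auto simp: T_def)
  then show ?thesis using pow_eq_id[OF carr(1)] by simp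
qed

end

section \<open>Labels 2, 3 and infinity: positivity of roots\<close>

locale laced_representation = geometric_representation G S B \<alpha> \<rho>
  for G (structure) and S :: "'a set" and B :: "'v::real_vector \<Rightarrow> 'v \<Rightarrow> real"
    and \<alpha> :: "'a \<Rightarrow> 'v" and \<rho> :: "'a \<Rightarrow> 'v \<Rightarrow> 'v" +
  assumes labels: "s \<in> S \<Longrightarrow> t \<in> S \<Longrightarrow> coxeter_matrix s t \<in> {1, 2, 3, \<infinity>}"
begin

text \<open>
  The relations are tested on the numbers \<open>x = B (\<alpha> s) v\<close> and \<open>B v (s v) = 1 - 2 x\<^sup>2\<close> for \<open>v = t(\<alpha> s)\<close>. Besides the
  expected value of \<open>x\<close> the resulting equations have the solution \<open>x = -1\<close>, which means
  \<open>B (\<alpha> s) (\<alpha> t) = -1\<close> and can be left to the last case.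
\<close>

lemma label_cases:
  assumes "s \<in> S" "t \<in> S" "s \<noteq> t"
  obtains (two) "B (\<alpha> s) (\<alpha> t) = 0" "s \<otimes> t = t \<otimes> s"
    | (three) "B (\<alpha> s) (\<alpha> t) = - 1 / 2" "s \<otimes> t \<otimes> s = t \<otimes> s \<otimes> t"
    | (inf) "B (\<alpha> s) (\<alpha> t) \<le> -1"
proof -
  define c where "c = - B (\<alpha> s) (\<alpha> t)"
  have c: "c \<ge> 0" "B (\<alpha> s) (\<alpha> t) = - c" "B (\<alpha> t) (\<alpha> s) = - c"
    using B_alpha_le_0[of s t] assms B_sym[of "\<alpha> t"] by (auto simp: c_def)
  have st: "s \<otimes> t \<in> carrier G" using assms by simp
  have "s \<otimes> t \<noteq> \<one>"
    using assms by (metis S_closed S_inv inv_equality inv_inv)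
  then have "ord (s \<otimes> t) \<noteq> 1" using st ord_eq_1 by blast
  moreover have "ord (s \<otimes> t) \<in> {0, 1, 2, 3}"
    using labels[OF assms(1,2)]
    by (auto simp: coxeter_matrix_def one_enat_def numeral_eq_enat split: if_splits)
  ultimately consider "ord (s \<otimes> t) = 2" | "ord (s \<otimes> t) = 3" | "ord (s \<otimes> t) = 0" by auto
  moreover define v x where "v = \<rho> t (\<alpha> s)" and "x = B (\<alpha> s) v"
  have x: "x = 1 - 2 * c\<^sup>2"
    using assms by (simp add: x_def v_def rho_S[of t] B_simps c power2_eq_square)
  have "B v v = 1" using assms by (simp add: v_def rho_B)
  then have sv: "B v (\<rho> s v) = 1 - 2 * x\<^sup>2"
    using assms B_sym[of v "\<alpha> s"] by (simp add: rho_S B_simps x_def power2_eq_square)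
  have minus_1: thesis if "x = -1"
  proof -
    have "c\<^sup>2 = 1\<^sup>2" using that x by simp
    then have "c = 1" using c(1) power2_eq_imp_eq[of c 1] by simp
    then show thesis using inf c by simp
  qed
  ultimately show thesis
  proof cases
    case 1
    then have "(s \<otimes> t) [^] (2::nat) = \<one>" using pow_eq_id[OF st, of 2] by simp
    then have "inv (s \<otimes> t) = s \<otimes> t" using st by (simp add: numeral_2_eq_2 inv_equality)
    then have comm: "s \<otimes> t = t \<otimes> s" using assms by (simp add: inv_mult_group S_inv)
    then have "\<rho> s v = \<rho> t (\<rho> s (\<alpha> s))" using assms by (simp add: v_def flip: rho_mult)
    then have "\<rho> s v = - v" using assms by (simp add: v_def rho_S_alpha rho_simps)
    then have "x\<^sup>2 = 1" using sv \<open>B v v = 1\<close> by (simp add: B_simps)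
    then have "x = 1 \<or> x = -1" by (simp add: power2_eq_1_iff)
    then show thesis using minus_1 two[OF _ comm] x c by auto
  next
    case 2
    then have "(s \<otimes> t) [^] (3::nat) = \<one>" using pow_eq_id[OF st, of 3] by simp
    then have "(s \<otimes> t \<otimes> s) \<otimes> (t \<otimes> s \<otimes> t) = \<one>"
      using assms by (simp add: numeral_3_eq_3 m_assoc)
    moreover have "inv (t \<otimes> s \<otimes> t) = t \<otimes> s \<otimes> t"
      using assms by (simp add: inv_mult_group S_inv m_assoc)
    ultimately have braid: "s \<otimes> t \<otimes> s = t \<otimes> s \<otimes> t"
      using assms by (metis S_closed inv_equality m_closed inv_inv)
    have "\<rho> s (\<rho> t (\<rho> s (\<alpha> s))) = \<rho> t (\<rho> s v)"
      using arg_cong[OF braid, of "\<lambda>w. \<rho> w (\<alpha> s)"] assms by (simp add: rho_mult v_def)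
    moreover have "B (\<alpha> s) (\<rho> s (\<rho> t (\<rho> s (\<alpha> s)))) = x"
      using assms rho_B_inv[of s "\<alpha> s"] by (simp add: S_inv rho_S_alpha rho_simps B_simps x_def v_def flip: rho_B_inv)
    moreover have "B (\<alpha> s) (\<rho> t (\<rho> s v)) = 1 - 2 * x\<^sup>2"
      using assms sv rho_B_inv[of t "\<alpha> s" "\<rho> s v"] by (simp add: S_inv v_def)
    ultimately have "(2 * x - 1) * (x + 1) = 0" by (simp add: algebra_simps power2_eq_square)
    then consider "x = -1" | "x = 1/2" by (auto simp: add_eq_0_iff)
    then show thesis
    proof cases
      case 2
      then have "(2 * c)\<^sup>2 = 1\<^sup>2" using x by (simp add: power2_eq_square)
      then have "2 * c = 1" using c(1) power2_eq_imp_eq[of "2 * c" 1] by simp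
      then show thesis using three braid c by simp
    qed (rule minus_1)
  next
    case 3
    have "\<not> (\<exists>k\<ge>2. B (\<alpha> s) (\<alpha> t) = - cos (pi / real k))"
    proof
      assume "\<exists>k\<ge>2. B (\<alpha> s) (\<alpha> t) = - cos (pi / real k)"
      then obtain k where "k \<ge> 2" "B (\<alpha> s) (\<alpha> t) = - cos (pi / real k)" by blast
      then have "ord (s \<otimes> t) dvd k" using ord_dvd_of_cos assms by blast
      then show False using 3 \<open>k \<ge> 2\<close> by simp
    qed
    moreover have "\<alpha> s \<noteq> \<alpha> t" using assms \<alpha>_inj by (auto dest: inj_onD)
    then have "B (\<alpha> s) (\<alpha> t) \<in> {..-1} \<union> {- cos (pi / real k) | k. k \<ge> 2}"
      using B_distinct assms by blast
    ultimately show ?thesis using inf by blast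
  qed
qed

text \<open>
  The sign of \<open>w(\<alpha> s)\<close> records whether \<open>w s\<close> is longer than \<open>w\<close>. Write \<open>w = v t\<close> with \<open>v\<close> shorter
  and \<open>t \<noteq> s\<close>, so that \<open>w(\<alpha> s) = v(\<alpha> s) + 2 c v(\<alpha> t)\<close> with \<open>c = - B (\<alpha> s) (\<alpha> t)\<close>; by induction this
  is positive unless \<open>s\<close> is a right descent of \<open>v\<close>. For \<open>c \<le> 1/2\<close> the braid relation then finishes. For
  \<open>c \<ge> 1\<close> one may have to remove arbitrarily many letters \<open>s\<close> and \<open>t\<close>, and the claim inside the proof
  supplies a statement that is stable under this: combinations \<open>x \<alpha> s + y \<alpha> t\<close> with \<open>x \<ge> y \<ge> 0\<close> stay
  of this form, with the roles of \<open>s\<close> and \<open>t\<close> exchanged.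
\<close>

lemma pos_of_ascent:
  assumes "w \<in> carrier G" "s \<in> S" "len (w \<otimes> s) = Suc (len w)"
  shows "pos (\<rho> w (\<alpha> s))"
  using assms
proof (induction "len w" arbitrary: w s rule: less_induct)
  case (less w s)
  note w = less.prems(1) and s = less.prems(2)
  have IH: "pos (\<rho> v (\<alpha> r))" if "len v < len w" "v \<in> carrier G" "r \<in> S" "len (v \<otimes> r) = Suc (len v)" for v r
    using less.hyps that by blast
  show ?case
  proof (cases "w = \<one>")
    case True
    then show ?thesis using s by simp
  next
    case False
    then obtain t where t: "t \<in> S" "len w = Suc (len (w \<otimes> t))"
      using ex_right_descent w by blast
    have ts: "t \<noteq> s" using t less.prems by auto
    define v where "v = w \<otimes> t"
    have v: "v \<in> carrier G" "v \<otimes> t = w" "len v < len w" "len (v \<otimes> t) = Suc (len v)"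
      using w t by (auto simp: v_def S_cancel_right)
    have vt: "pos (\<rho> v (\<alpha> t))" using IH v t by blast
    define c where "c = - B (\<alpha> s) (\<alpha> t)"
    have c: "c \<ge> 0" "B (\<alpha> s) (\<alpha> t) = - c" "B (\<alpha> t) (\<alpha> s) = - c"
      using B_alpha_le_0[of s t] s t ts B_sym[of "\<alpha> t"] by (auto simp: c_def)
    have "\<rho> w (\<alpha> s) = \<rho> v (\<rho> t (\<alpha> s))" using v t by (simp flip: rho_mult)
    also have "\<dots> = \<rho> v (\<alpha> s + (2 * c) *\<^sub>R \<alpha> t)" using t by (simp add: rho_S c)
    finally have eq: "\<rho> w (\<alpha> s) = \<rho> v (\<alpha> s + (2 * c) *\<^sub>R \<alpha> t)" .
    then have eq': "\<rho> w (\<alpha> s) = \<rho> v (\<alpha> s) + (2 * c) *\<^sub>R \<rho> v (\<alpha> t)" using v by (simp add: rho_simps)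
    show ?thesis
    proof (cases "len (v \<otimes> s) = Suc (len v)")
      case True
      then have "pos (\<rho> v (\<alpha> s))" using IH v s by blast
      then show ?thesis unfolding eq' using vt c by (intro pos_add pos_scale) auto
    next
      case False
      define u where "u = v \<otimes> s"
      have u: "u \<in> carrier G" "u \<otimes> s = v" "len v = Suc (len u)"
        using len_mult_S[of v s] False v s by (auto simp: u_def S_cancel_right)
      from s t(1) ts[symmetric] show ?thesis
      proof (cases rule: label_cases)
        case two
        have "w \<otimes> s = u \<otimes> (s \<otimes> t) \<otimes> s" unfolding v(2)[symmetric] u(2)[symmetric] using u(1) s t by (simp add: m_assoc)
        also have "\<dots> = u \<otimes> t" using two u s t by (simp add: m_assoc S_square)
        finally have "len (w \<otimes> s) \<le> Suc (len u)" using len_mult_S[of u t] u t by auto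
        then show ?thesis using less.prems(3) u v by linarith
      next
        case three
        have "\<rho> s (\<rho> t (\<alpha> s)) = \<alpha> t"
          using s t rho_S_pair[of s 1 1 "\<alpha> t"] three B_sym[of "\<alpha> t"] by (simp add: rho_S[of t])
        then have wu: "\<rho> w (\<alpha> s) = \<rho> u (\<alpha> t)"
          unfolding v(2)[symmetric] u(2)[symmetric] using u(1) s t by (simp add: rho_mult)
        show ?thesis
        proof (cases "len (u \<otimes> t) = Suc (len u)")
          case True
          then show ?thesis using IH[of u t] u v t by (simp add: wu)
        next
          case False
          define z where "z = u \<otimes> t"
          have z: "z \<in> carrier G" "z \<otimes> t = u" "len u = Suc (len z)"
            using len_mult_S[of u t] False u t by (auto simp: z_def S_cancel_right)
          have "w \<otimes> s = z \<otimes> (t \<otimes> s \<otimes> t) \<otimes> s"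
            unfolding v(2)[symmetric] u(2)[symmetric] z(2)[symmetric]
            using z(1) s t by (simp add: m_assoc)
          also have "\<dots> = z \<otimes> (s \<otimes> t \<otimes> s) \<otimes> s" by (simp only: three(2))
          also have "\<dots> = z \<otimes> s \<otimes> t" using z s t by (simp add: m_assoc S_square)
          finally have "len (w \<otimes> s) \<le> Suc (len (z \<otimes> s))" using len_mult_S[of "z \<otimes> s" t] z s t by auto
          then have "len (w \<otimes> s) \<le> Suc (Suc (len z))" using len_mult_S[of z s] z s by auto
          then show ?thesis using less.prems(3) u v z by linarith
        qed
      next
        case inf
        have claim: "pos (\<rho> x (a *\<^sub>R \<alpha> p + b *\<^sub>R \<alpha> q))"
          if "len x < len w" "x \<in> carrier G" "p \<in> {s, t}" "q \<in> {s, t}" "p \<noteq> q"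
            "len (x \<otimes> p) = Suc (len x)" "a \<ge> b" "b \<ge> 0" for x p q a b
          using that
        proof (induction "len x" arbitrary: x p q a b rule: less_induct)
          case (less y)
          have pq: "p \<in> S" "q \<in> S" using less.prems s t by auto
          have Bpq: "B (\<alpha> q) (\<alpha> p) = - c" using less.prems c by auto
          have yp: "pos (\<rho> y (\<alpha> p))" using IH less.prems pq by blast
          show ?case
          proof (cases "len (y \<otimes> q) = Suc (len y)")
            case True
            then have "pos (\<rho> y (\<alpha> q))" using IH less.prems pq by blast
            then show ?thesis using less.prems yp by (auto simp: rho_simps intro!: pos_add pos_scale)
          next
            case False
            define z where "z = y \<otimes> q"
            have z: "z \<in> carrier G" "z \<otimes> q = y" "len y = Suc (len z)" "len (z \<otimes> q) = Suc (len z)"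
              using len_mult_S[of y q] False less.prems pq by (auto simp: z_def S_cancel_right)
            have "b \<le> a" "1 \<le> c" using less.prems inf by (auto simp: c_def)
            then have "a \<le> a * c" using less.prems mult_left_mono[of 1 c a] by simp
            then have "pos (\<rho> z ((- b - 2 * a * - c) *\<^sub>R \<alpha> q + a *\<^sub>R \<alpha> p))"
              using less.prems z by (intro less.hyps) auto
            then have "pos (\<rho> z (\<rho> q (b *\<^sub>R \<alpha> q + a *\<^sub>R \<alpha> p)))"
              unfolding rho_S_pair[OF pq(2)] Bpq .
            then show ?thesis using z pq by (simp add: add.commute flip: rho_mult)
          qed
        qed
        have "pos (\<rho> v ((2 * c) *\<^sub>R \<alpha> t + 1 *\<^sub>R \<alpha> s))"
          using ts v inf by (intro claim) (simp_all add: c_def)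
        then show ?thesis unfolding eq by (simp add: add.commute)
      qed
    qed
  qed
qed

section \<open>Roots, reflections and inversion sets\<close>

abbreviation N :: "'a \<Rightarrow> 'v set" where
  "N \<equiv> inversion_set"

lemma neg_of_descent:
  assumes "w \<in> carrier G" "s \<in> S" "len w = Suc (len (w \<otimes> s))"
  shows "neg (\<rho> w (\<alpha> s))"
proof -
  have "pos (\<rho> (w \<otimes> s) (\<alpha> s))"
    using assms by (intro pos_of_ascent) (auto simp: S_cancel_right)
  then show ?thesis using assms by (simp add: rho_mult rho_S_alpha rho_simps)
qed

lemma alpha_neq_0 [simp]: "s \<in> S \<Longrightarrow> \<alpha> s \<noteq> 0"
  by (metis B_alpha B_simps(9) zero_neq_one)

lemma ascent_iff:
  assumes "w \<in> carrier G" "s \<in> S"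
  shows "pos (\<rho> w (\<alpha> s)) \<longleftrightarrow> len (w \<otimes> s) = Suc (len w)"
proof -
  have "\<rho> w (\<alpha> s) \<noteq> 0" using assms by (metis alpha_neq_0 rho_eq_iff rho_simps(5))
  then show ?thesis
    using assms len_mult_S[of w s] pos_of_ascent[of w s] neg_of_descent[of w s] pos_neg_zero by blast
qed

lemma left_ascent_iff:
  assumes "w \<in> carrier G" "s \<in> S"
  shows "pos (\<rho> (inv w) (\<alpha> s)) \<longleftrightarrow> len (s \<otimes> w) = Suc (len w)"
  using ascent_iff[of "inv w" s] len_inv[of "s \<otimes> w"] assms
  by (simp add: len_inv inv_mult_group S_inv)

lemma rootE:
  assumes "\<beta> \<in> \<Phi>"
  obtains w s where "w \<in> carrier G" "s \<in> S" "\<beta> = \<rho> w (\<alpha> s)"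
  using assms unfolding roots_def by blast

lemma rho_root:
  assumes "w \<in> carrier G" "\<beta> \<in> \<Phi>" shows "\<rho> w \<beta> \<in> \<Phi>"
proof -
  obtain u s where "u \<in> carrier G" "s \<in> S" "\<beta> = \<rho> u (\<alpha> s)" using rootE assms by blast
  then have "\<rho> w \<beta> = \<rho> (w \<otimes> u) (\<alpha> s)" "w \<otimes> u \<in> carrier G" using assms by (auto simp: rho_mult)
  then show ?thesis using \<open>s \<in> S\<close> unfolding roots_def by blast
qed

lemma alpha_root: "s \<in> S \<Longrightarrow> \<alpha> s \<in> \<Phi>"
  unfolding roots_def by (intro UN_I[of \<one>]) (auto simp: image_iff)

lemma minus_root:
  assumes "\<beta> \<in> \<Phi>" shows "- \<beta> \<in> \<Phi>"
proof -
  obtain u s where us: "u \<in> carrier G" "s \<in> S" "\<beta> = \<rho> u (\<alpha> s)" using rootE assms by blast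
  then have "- \<beta> = \<rho> u (\<rho> s (\<alpha> s))" by (simp add: rho_S_alpha rho_simps)
  then show ?thesis using us alpha_root by (simp add: rho_root)
qed

lemma B_root: "\<beta> \<in> \<Phi> \<Longrightarrow> B \<beta> \<beta> = 1"
  by (elim rootE) (simp add: rho_B)

lemma root_neq_0: "\<beta> \<in> \<Phi> \<Longrightarrow> \<beta> \<noteq> 0"
  using B_root[of \<beta>] by (auto simp: B_simps)

lemma pos_or_neg: "\<beta> \<in> \<Phi> \<Longrightarrow> pos \<beta> \<or> neg \<beta>"
  by (elim rootE) (use len_mult_S pos_of_ascent neg_of_descent in blast)

lemma not_pos_iff: "\<beta> \<in> \<Phi> \<Longrightarrow> \<not> pos \<beta> \<longleftrightarrow> neg \<beta>"
  using pos_or_neg[of \<beta>] pos_neg_zero[of \<beta>] B_root[of \<beta>] by (auto simp: B_simps)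

lemma not_neg_iff: "\<beta> \<in> \<Phi> \<Longrightarrow> \<not> neg \<beta> \<longleftrightarrow> pos \<beta>"
  using not_pos_iff[of \<beta>] by blast

lemma not_pos_and_neg: "\<beta> \<in> \<Phi> \<Longrightarrow> pos \<beta> \<Longrightarrow> neg \<beta> \<Longrightarrow> False"
  using not_pos_iff by blast

lemma rho_not_pos_and_neg: "w \<in> carrier G \<Longrightarrow> \<beta> \<in> \<Phi> \<Longrightarrow> pos (\<rho> w \<beta>) \<Longrightarrow> neg (\<rho> w \<beta>) \<Longrightarrow> False"
  using not_pos_and_neg rho_root by blast

lemma not_neg_alpha: "s \<in> S \<Longrightarrow> \<not> neg (\<alpha> s)"
  using not_pos_and_neg alpha_root pos_alpha by blast

lemma pos_roots_iff: "\<beta> \<in> \<Phi>\<^sup>+ \<longleftrightarrow> \<beta> \<in> \<Phi> \<and> pos \<beta>"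
  by (auto simp: pos_roots_def pos_def)

lemma neg_roots_iff: "\<beta> \<in> \<Phi>\<^sup>- \<longleftrightarrow> \<beta> \<in> \<Phi> \<and> neg \<beta>"
proof
  assume "\<beta> \<in> \<Phi> \<and> neg \<beta>"
  then have "- \<beta> \<in> \<Phi>\<^sup>+" by (simp add: pos_roots_iff minus_root)
  then show "\<beta> \<in> \<Phi>\<^sup>-" unfolding neg_roots_def by (metis imageI minus_minus)
qed (auto simp: neg_roots_def pos_roots_iff minus_root)

lemma in_N_iff:
  assumes "w \<in> carrier G"
  shows "\<beta> \<in> N w \<longleftrightarrow> \<beta> \<in> \<Phi> \<and> pos \<beta> \<and> neg (\<rho> (inv w) \<beta>)"
proof -
  have "\<beta> \<in> \<rho> w ` \<Phi>\<^sup>- \<longleftrightarrow> \<rho> (inv w) \<beta> \<in> \<Phi>\<^sup>-"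
    using assms by (metis imageE imageI rho_inv)
  moreover have "\<rho> (inv w) \<beta> \<in> \<Phi> \<longleftrightarrow> \<beta> \<in> \<Phi>"
    using assms rho_root[of "inv w" \<beta>] rho_root[of w "\<rho> (inv w) \<beta>"] by auto
  ultimately show ?thesis by (auto simp: inversion_set_def pos_roots_iff neg_roots_iff)
qed

lemma N_root: "w \<in> carrier G \<Longrightarrow> \<beta> \<in> N w \<Longrightarrow> \<beta> \<in> \<Phi>"
  and N_pos: "w \<in> carrier G \<Longrightarrow> \<beta> \<in> N w \<Longrightarrow> pos \<beta>"
  and N_neg: "w \<in> carrier G \<Longrightarrow> \<beta> \<in> N w \<Longrightarrow> neg (\<rho> (inv w) \<beta>)"
  by (simp_all add: in_N_iff)

lemma N_one [simp]: "N \<one> = {}"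
  by (auto simp: in_N_iff dest: not_pos_and_neg)

lemma alpha_in_N_iff:
  assumes "w \<in> carrier G" "s \<in> S"
  shows "\<alpha> s \<in> N w \<longleftrightarrow> len w = Suc (len (s \<otimes> w))"
proof -
  have "\<rho> (inv w) (\<alpha> s) \<in> \<Phi>" using assms alpha_root by (simp add: rho_root)
  then have "\<not> pos (\<rho> (inv w) (\<alpha> s)) \<longleftrightarrow> neg (\<rho> (inv w) (\<alpha> s))" by (rule not_pos_iff)
  moreover have "\<alpha> s \<in> N w \<longleftrightarrow> neg (\<rho> (inv w) (\<alpha> s))"
    using assms alpha_root by (simp add: in_N_iff)
  moreover have "\<not> (len (s \<otimes> w) = Suc (len w) \<and> len w = Suc (len (s \<otimes> w)))" by linarith
  ultimately show ?thesis using left_ascent_iff[OF assms] len_S_mult[OF assms] by blast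
qed

subsection \<open>Reflections\<close>

lemma refl_elt_eqI:
  assumes "w \<in> carrier G" "\<And>v. \<rho> w v = v - (2 * B \<beta> v) *\<^sub>R \<beta>"
  shows "refl_elt \<beta> = w"
  unfolding refl_elt_def
proof (rule the_equality)
  show "w \<in> carrier G \<and> \<rho> w = reflection B \<beta>" using assms by (auto simp: reflection_def)
  fix u assume "u \<in> carrier G \<and> \<rho> u = reflection B \<beta>"
  then show "u = w" using assms by (intro rho_inj) (auto simp: reflection_def)
qed

lemma refl_alpha: "s \<in> S \<Longrightarrow> refl_elt (\<alpha> s) = s"
  by (intro refl_elt_eqI) (auto simp: rho_S)

lemma refl_conj_aux:
  assumes "w \<in> carrier G" "r \<in> carrier G" "\<And>v. \<rho> r v = v - (2 * B \<beta> v) *\<^sub>R \<beta>"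
  shows "refl_elt (\<rho> w \<beta>) = w \<otimes> r \<otimes> inv w"
proof (rule refl_elt_eqI)
  fix v
  have "\<rho> (w \<otimes> r \<otimes> inv w) v = v - (2 * B \<beta> (\<rho> (inv w) v)) *\<^sub>R \<rho> w \<beta>"
    using assms by (simp add: rho_mult rho_simps)
  also have "B \<beta> (\<rho> (inv w) v) = B (\<rho> w \<beta>) v"
    using rho_B_inv[OF assms(1), of v \<beta>] B_sym by metis
  finally show "\<rho> (w \<otimes> r \<otimes> inv w) v = v - (2 * B (\<rho> w \<beta>) v) *\<^sub>R \<rho> w \<beta>" .
qed (use assms in simp)

lemma refl_closed [simp]: "\<beta> \<in> \<Phi> \<Longrightarrow> refl_elt \<beta> \<in> carrier G"
  by (elim rootE) (simp add: refl_conj_aux[OF _ S_closed rho_S])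

lemma rho_refl:
  assumes "\<beta> \<in> \<Phi>" shows "\<rho> (refl_elt \<beta>) v = v - (2 * B \<beta> v) *\<^sub>R \<beta>"
proof -
  obtain w s where ws: "w \<in> carrier G" "s \<in> S" "\<beta> = \<rho> w (\<alpha> s)" using rootE assms by blast
  have "refl_elt \<beta> = w \<otimes> s \<otimes> inv w" using ws by (simp add: refl_conj_aux rho_S)
  then have "\<rho> (refl_elt \<beta>) v = v - (2 * B (\<alpha> s) (\<rho> (inv w) v)) *\<^sub>R \<beta>"
    using ws by (simp add: rho_mult rho_simps rho_S)
  moreover have "B (\<alpha> s) (\<rho> (inv w) v) = B \<beta> v"
    using rho_B_inv[OF ws(1), of v "\<alpha> s"] B_sym ws(3) by metis
  ultimately show ?thesis by simp
qed

lemma refl_rho: "w \<in> carrier G \<Longrightarrow> \<beta> \<in> \<Phi> \<Longrightarrow> refl_elt (\<rho> w \<beta>) = w \<otimes> refl_elt \<beta> \<otimes> inv w"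
  by (intro refl_conj_aux) (auto simp: rho_refl)

lemma refl_square: "\<beta> \<in> \<Phi> \<Longrightarrow> refl_elt \<beta> \<otimes> refl_elt \<beta> = \<one>"
  by (intro rho_inj) (auto simp: rho_mult rho_refl B_simps B_root algebra_simps)

lemma refl_inv: "\<beta> \<in> \<Phi> \<Longrightarrow> inv (refl_elt \<beta>) = refl_elt \<beta>"
  by (simp add: inv_equality refl_square)

lemma refl_cancel: "\<beta> \<in> \<Phi> \<Longrightarrow> w \<in> carrier G \<Longrightarrow> refl_elt \<beta> \<otimes> (refl_elt \<beta> \<otimes> w) = w"
  by (simp add: refl_square flip: m_assoc)

lemma rho_refl_self: "\<beta> \<in> \<Phi> \<Longrightarrow> \<rho> (refl_elt \<beta>) \<beta> = - \<beta>"
  by (simp add: rho_refl B_root scaleR_2)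

lemma rho_refl_twice: "\<beta> \<in> \<Phi> \<Longrightarrow> \<rho> (refl_elt \<beta>) (\<rho> (refl_elt \<beta>) v) = v"
  by (simp add: refl_square flip: rho_mult)

lemma refl_S_conj: "s \<in> S \<Longrightarrow> \<beta> \<in> \<Phi> \<Longrightarrow> refl_elt (\<rho> s \<beta>) = s \<otimes> refl_elt \<beta> \<otimes> s"
  by (simp add: refl_rho S_inv)

text \<open>
  The only multiples of a root that are roots are itself and its negative.
\<close>

lemma pos_roots_not_parallel:
  assumes "\<beta> \<in> \<Phi>" "\<gamma> \<in> \<Phi>" "pos \<beta>" "pos \<gamma>" "\<gamma> = k *\<^sub>R \<beta>"
  shows "\<beta> = \<gamma>"
proof -
  have "k * k = 1" using assms B_root[of \<beta>] B_root[of \<gamma>] by (simp add: B_simps)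
  then have "k = 1 \<or> k = -1" using square_eq_1_iff by blast
  moreover have "k \<noteq> -1" using assms not_neg_iff[of \<beta>] by auto
  ultimately show ?thesis using assms by simp
qed

text \<open>
  The sum of \<open>\<beta>\<close> and \<open>- s(\<beta>)\<close> is a multiple of \<open>\<alpha> s\<close>, which spans an extreme ray.
\<close>

lemma S_permutes_pos:
  assumes "s \<in> S" "\<beta> \<in> \<Phi>" "pos \<beta>" "\<beta> \<noteq> \<alpha> s"
  shows "pos (\<rho> s \<beta>)"
proof (rule ccontr)
  assume "\<not> pos (\<rho> s \<beta>)"
  then have "neg (\<rho> s \<beta>)" using assms rho_root not_pos_iff by auto
  moreover have "\<beta> + - \<rho> s \<beta> = (2 * B (\<alpha> s) \<beta>) *\<^sub>R \<alpha> s" using assms by (simp add: rho_S)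
  ultimately obtain a where "\<beta> = a *\<^sub>R \<alpha> s" using alpha_extreme assms by blast
  then show False
    using pos_roots_not_parallel[of "\<alpha> s" \<beta> a] assms alpha_root by auto
qed

subsection \<open>Inversion sets\<close>

lemma N_mult:
  assumes "s \<in> S" "w \<in> carrier G" "len (s \<otimes> w) = Suc (len w)"
  shows "\<alpha> s \<notin> N w" "N (s \<otimes> w) = insert (\<alpha> s) (\<rho> s ` N w)"
proof -
  show notin: "\<alpha> s \<notin> N w" using assms by (simp add: alpha_in_N_iff)
  have sw: "s \<otimes> w \<in> carrier G" "inv (s \<otimes> w) = inv w \<otimes> s"
    using assms by (simp_all add: inv_mult_group S_inv)
  show "N (s \<otimes> w) = insert (\<alpha> s) (\<rho> s ` N w)"
  proof (intro equalityI subsetI)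
    fix \<beta> assume \<beta>: "\<beta> \<in> N (s \<otimes> w)"
    show "\<beta> \<in> insert (\<alpha> s) (\<rho> s ` N w)"
    proof (cases "\<beta> = \<alpha> s")
      case False
      then have "\<rho> s \<beta> \<in> N w"
        using \<beta> assms sw S_permutes_pos[of s \<beta>] by (auto simp: in_N_iff rho_mult rho_root)
      then show ?thesis using rho_S_twice[OF assms(1), of \<beta>] by (metis imageI insertI2)
    qed simp
  next
    fix \<beta> assume "\<beta> \<in> insert (\<alpha> s) (\<rho> s ` N w)"
    then consider "\<beta> = \<alpha> s" | \<gamma> where "\<gamma> \<in> N w" "\<beta> = \<rho> s \<gamma>" by blast
    then show "\<beta> \<in> N (s \<otimes> w)"
    proof cases
      case 1
      then show ?thesis using assms sw by (simp add: alpha_in_N_iff S_cancel)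
    next
      case 2
      then have "\<gamma> \<noteq> \<alpha> s" using notin by auto
      then show ?thesis
        using 2 assms sw S_permutes_pos[of s \<gamma>]
        by (auto simp: in_N_iff rho_mult rho_root rho_S_twice)
    qed
  qed
qed

lemma N_S: "s \<in> S \<Longrightarrow> N s = {\<alpha> s}"
  using N_mult(2)[of s \<one>] left_ascent_iff[of \<one> s] by simp

lemma finite_N: "w \<in> carrier G \<Longrightarrow> finite (N w)"
  by (induction rule: len_induct) (simp_all add: N_mult)

lemma N_closed:
  assumes "w \<in> carrier G" "x \<in> \<Phi>" "x = a *\<^sub>R \<beta> + b *\<^sub>R \<gamma>" "\<beta> \<in> N w" "\<gamma> \<in> N w" "a \<ge> 0" "b \<ge> 0"
  shows "x \<in> N w"
proof -
  have "pos x" unfolding assms(3) using assms N_pos by (intro pos_add pos_scale) auto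
  moreover have "neg (\<rho> (inv w) x)"
    unfolding assms(3) using assms N_neg by (simp only: rho_simps inv_closed) (intro neg_add neg_scale; simp)
  ultimately show ?thesis using assms by (simp add: in_N_iff)
qed

text \<open>
  Strong exchange: a root that is an inversion of \<open>w\<close> becomes, along a reduced word of \<open>w\<close>, the simple
  root of some letter, and its reflection deletes this letter.
\<close>

lemma len_refl_less:
  assumes "w \<in> carrier G" "\<beta> \<in> N w"
  shows "len (refl_elt \<beta> \<otimes> w) < len w"
  using assms
proof (induction arbitrary: \<beta> rule: len_induct)
  case one
  then show ?case by simp
next
  case (mult s w \<beta>)
  consider "\<beta> = \<alpha> s" | \<gamma> where "\<gamma> \<in> N w" "\<beta> = \<rho> s \<gamma>"
    using mult.prems N_mult[of s w] mult.hyps by blast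
  then show ?case
  proof cases
    case 1
    then show ?thesis using mult.hyps by (simp add: refl_alpha S_cancel)
  next
    case 2
    then have \<gamma>: "\<gamma> \<in> \<Phi>" using N_root mult.hyps by blast
    have "refl_elt \<beta> \<otimes> (s \<otimes> w) = s \<otimes> (refl_elt \<gamma> \<otimes> w)"
      using 2 \<gamma> mult.hyps by (simp add: refl_S_conj m_assoc S_cancel)
    then have "len (refl_elt \<beta> \<otimes> (s \<otimes> w)) \<le> Suc (len (refl_elt \<gamma> \<otimes> w))"
      using len_S_mult[of "refl_elt \<gamma> \<otimes> w" s] mult.hyps \<gamma> by auto
    then show ?thesis using mult.IH[OF 2(1)] mult.hyps by linarith
  qed
qed

lemma len_refl_greater:
  assumes "w \<in> carrier G" "\<beta> \<in> \<Phi>" "pos \<beta>" "\<beta> \<notin> N w"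
  shows "len w < len (refl_elt \<beta> \<otimes> w)"
proof -
  have "\<not> neg (\<rho> (inv w) \<beta>)" using assms by (simp add: in_N_iff)
  then have "pos (\<rho> (inv w) \<beta>)" using assms rho_root pos_or_neg inv_closed by blast
  then have "\<beta> \<in> N (refl_elt \<beta> \<otimes> w)"
    using assms by (simp add: in_N_iff inv_mult_group refl_inv rho_mult rho_refl_self rho_simps)
  then show ?thesis
    using len_refl_less[of "refl_elt \<beta> \<otimes> w" \<beta>] assms by (simp add: refl_cancel)
qed

lemma self_in_N_refl: "\<beta> \<in> \<Phi> \<Longrightarrow> pos \<beta> \<Longrightarrow> \<beta> \<in> N (refl_elt \<beta>)"
  by (simp add: in_N_iff refl_inv rho_refl_self)

lemma in_N_refl_iff:
  "\<beta> \<in> \<Phi> \<Longrightarrow> \<gamma> \<in> N (refl_elt \<beta>) \<longleftrightarrow> \<gamma> \<in> \<Phi> \<and> pos \<gamma> \<and> neg (\<rho> (refl_elt \<beta>) \<gamma>)"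
  by (simp add: in_N_iff refl_inv)

text \<open>
  Together with its converse below, this identifies the weak order with the inclusion order of
  inversion sets.
\<close>

lemma N_mono:
  assumes "u \<in> carrier G" "w \<in> carrier G" "is_prefix u w"
  shows "N u \<subseteq> N w"
proof -
  obtain v where v: "v \<in> carrier G" "w = u \<otimes> v" "len w = len u + len v"
    using assms by (auto simp: is_prefix_def)
  have "N u \<subseteq> N (u \<otimes> v)" if "len (u \<otimes> v) = len u + len v"
    using assms(1) that
  proof (induction rule: len_induct)
    case one
    then show ?case by simp
  next
    case (mult s u)
    have eq: "s \<otimes> u \<otimes> v = s \<otimes> (u \<otimes> v)" using mult.hyps v by (simp add: m_assoc)
    have "len (s \<otimes> (u \<otimes> v)) \<le> Suc (len (u \<otimes> v))" "len (u \<otimes> v) \<le> len u + len v"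
      using len_S_mult[of "u \<otimes> v" s] len_mult_le[of u v] mult.hyps v by auto
    then have *: "len (u \<otimes> v) = len u + len v" "len (s \<otimes> (u \<otimes> v)) = Suc (len (u \<otimes> v))"
      using mult.prems mult.hyps unfolding eq by linarith+
    then have "N u \<subseteq> N (u \<otimes> v)" using mult.IH by blast
    then show ?case unfolding eq using mult.hyps v * by (simp add: N_mult(2)) blast
  qed
  then show ?thesis using v by simp
qed

lemma eq_minus_alpha: "s \<in> S \<Longrightarrow> \<alpha> s = \<rho> s x \<Longrightarrow> x = - \<alpha> s"
  by (metis rho_S_alpha rho_S_twice)

lemma N_subset_of_mult:
  assumes "s \<in> S" "u \<in> carrier G" "\<rho> s ` N u \<subseteq> insert (\<alpha> s) (\<rho> s ` N v)"
  shows "N u \<subseteq> N v"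
proof
  fix \<beta> assume \<beta>: "\<beta> \<in> N u"
  have "\<rho> s \<beta> \<noteq> \<alpha> s"
  proof
    assume "\<rho> s \<beta> = \<alpha> s"
    then have "\<beta> = - \<alpha> s" using eq_minus_alpha assms(1) by metis
    then show False using N_pos[OF assms(2) \<beta>] not_neg_alpha assms(1) by simp
  qed
  then obtain \<gamma> where "\<gamma> \<in> N v" "\<rho> s \<beta> = \<rho> s \<gamma>" using assms(3) \<beta> by blast
  then show "\<beta> \<in> N v" using rho_eq_iff assms(1) by simp
qed

lemma prefix_of_N_subset:
  assumes "u \<in> carrier G" "w \<in> carrier G" "N u \<subseteq> N w"
  shows "is_prefix u w"
proof -
  have "len w = len u + len (inv u \<otimes> w)"
    using assms
  proof (induction arbitrary: w rule: len_induct)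
    case one
    then show ?case by simp
  next
    case (mult s u w)
    have Nu: "N (s \<otimes> u) = insert (\<alpha> s) (\<rho> s ` N u)" "\<alpha> s \<notin> N u" using N_mult mult.hyps by auto
    define v where "v = s \<otimes> w"
    have "\<alpha> s \<in> N w" using mult.prems Nu by blast
    then have v: "v \<in> carrier G" "w = s \<otimes> v" "len w = Suc (len v)" "len (s \<otimes> v) = Suc (len v)"
      using mult.hyps mult.prems by (auto simp: v_def alpha_in_N_iff S_cancel)
    have Nw: "N w = insert (\<alpha> s) (\<rho> s ` N v)" using v N_mult(2)[of s v] mult.hyps by auto
    have "N u \<subseteq> N v"
      using N_subset_of_mult[of s u v] mult.hyps(1,2) mult.prems(2) Nu(1) Nw by blast
    then have "len v = len u + len (inv u \<otimes> v)" using mult.IH v by blast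
    moreover have "inv (s \<otimes> u) \<otimes> w = inv u \<otimes> v"
      using mult.hyps v by (simp add: inv_mult_group S_inv m_assoc S_cancel)
    ultimately show ?case using v mult.hyps by simp
  qed
  then show ?thesis
    using assms unfolding is_prefix_def by (intro conjI bexI[of _ "inv u \<otimes> w"]) (auto simp flip: m_assoc)
qed

lemma N_inj:
  assumes "u \<in> carrier G" "w \<in> carrier G" "N u = N w"
  shows "u = w"
proof -
  obtain v where v: "v \<in> carrier G" "w = u \<otimes> v" "len w = len u + len v"
    using prefix_of_N_subset[of u w] assms by (auto simp: is_prefix_def)
  obtain x where "x \<in> carrier G" "u = w \<otimes> x" "len u = len w + len x"
    using prefix_of_N_subset[of w u] assms by (auto simp: is_prefix_def)
  then have "v = \<one>" using v len_eq_0[of v] by simp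
  then show ?thesis using v assms by simp
qed

section \<open>Dominance and depth\<close>

text \<open>
  Dominance is extended from positive roots to all roots: \<open>\<beta>\<close> is dominated by \<open>\<gamma>\<close> if every element
  that makes \<open>\<gamma>\<close> negative makes \<open>\<beta>\<close> negative. In this form the group preserves it.
\<close>

definition dom :: "'v \<Rightarrow> 'v \<Rightarrow> bool" where
  "dom \<beta> \<gamma> \<longleftrightarrow> (\<forall>w\<in>carrier G. neg (\<rho> w \<gamma>) \<longrightarrow> neg (\<rho> w \<beta>))"

lemma dominated_iff_dom:
  assumes "\<beta> \<in> \<Phi>" "\<gamma> \<in> \<Phi>" "pos \<beta>" "pos \<gamma>"
  shows "\<beta> \<preceq> \<gamma> \<longleftrightarrow> dom \<beta> \<gamma>"
proof
  assume *: "\<beta> \<preceq> \<gamma>"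
  show "dom \<beta> \<gamma>"
    unfolding dom_def
  proof (intro ballI impI)
    fix w assume "w \<in> carrier G" "neg (\<rho> w \<gamma>)"
    then have "\<gamma> \<in> N (inv w)" using assms by (simp add: in_N_iff)
    then have "\<beta> \<in> N (inv w)" using * \<open>w \<in> carrier G\<close> unfolding dominated_def by blast
    then show "neg (\<rho> w \<beta>)" using \<open>w \<in> carrier G\<close> by (simp add: in_N_iff)
  qed
next
  assume "dom \<beta> \<gamma>"
  then show "\<beta> \<preceq> \<gamma>" using assms by (auto simp: dominated_def dom_def in_N_iff)
qed

lemma dom_trans: "dom \<beta> \<gamma> \<Longrightarrow> dom \<gamma> \<delta> \<Longrightarrow> dom \<beta> \<delta>"
  by (auto simp: dom_def)

lemma dom_rho:
  assumes "u \<in> carrier G" "dom \<beta> \<gamma>" shows "dom (\<rho> u \<beta>) (\<rho> u \<gamma>)"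
  unfolding dom_def
proof (intro ballI impI)
  fix w assume w: "w \<in> carrier G" "neg (\<rho> w (\<rho> u \<gamma>))"
  then have "neg (\<rho> (w \<otimes> u) \<gamma>)" using assms by (simp add: rho_mult)
  then have "neg (\<rho> (w \<otimes> u) \<beta>)" using assms w unfolding dom_def by blast
  then show "neg (\<rho> w (\<rho> u \<beta>))" using assms w by (simp add: rho_mult)
qed

lemma dom_pos:
  assumes "\<beta> \<in> \<Phi>" "\<gamma> \<in> \<Phi>" "dom \<beta> \<gamma>" "pos \<beta>" shows "pos \<gamma>"
proof (rule ccontr)
  assume "\<not> pos \<gamma>"
  then have "neg \<gamma>" using not_pos_iff[OF assms(2)] by blast
  then have "neg \<beta>" using assms(3) unfolding dom_def by (metis one_closed rho_one)
  then show False using assms not_pos_and_neg by blast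
qed

lemma dom_antisym:
  assumes "\<beta> \<in> \<Phi>" "\<gamma> \<in> \<Phi>" "dom \<beta> \<gamma>" "dom \<gamma> \<beta>" shows "\<beta> = \<gamma>"
proof -
  obtain w s where ws: "w \<in> carrier G" "s \<in> S" "\<gamma> = \<rho> w (\<alpha> s)" using rootE assms(2) by blast
  define \<delta> where "\<delta> = \<rho> (inv w) \<beta>"
  have \<delta>: "\<delta> \<in> \<Phi>" "\<beta> = \<rho> w \<delta>" using ws assms by (auto simp: \<delta>_def rho_root)
  have dom: "dom \<delta> (\<alpha> s)" "dom (\<alpha> s) \<delta>"
    using dom_rho[of "inv w" \<beta> \<gamma>] dom_rho[of "inv w" \<gamma> \<beta>] assms ws by (auto simp: \<delta>_def)
  have "pos \<delta>" using dom_pos[of "\<alpha> s" \<delta>] dom \<delta> ws alpha_root by auto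
  have "neg (\<rho> s (\<alpha> s))" using ws by (simp add: rho_S_alpha)
  then have "neg (\<rho> s \<delta>)" using dom(1) ws unfolding dom_def by auto
  then have "\<not> pos (\<rho> s \<delta>)" using not_pos_and_neg rho_root \<delta> ws by (meson S_closed)
  then have "\<delta> = \<alpha> s" using S_permutes_pos ws \<delta> \<open>pos \<delta>\<close> by blast
  then show ?thesis using \<delta> ws by simp
qed

definition D :: "'v \<Rightarrow> 'v set" where
  "D \<gamma> = {\<beta>\<in>\<Phi>. pos \<beta> \<and> dom \<beta> \<gamma> \<and> \<beta> \<noteq> \<gamma>}"

definition dp :: "'v \<Rightarrow> nat" where
  "dp \<gamma> = card (D \<gamma>)"

lemma finite_D:
  assumes "\<gamma> \<in> \<Phi>" shows "finite (D \<gamma>)"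
proof (cases "pos \<gamma>")
  case True
  have "D \<gamma> \<subseteq> N (refl_elt \<gamma>)"
  proof
    fix \<beta> assume \<beta>: "\<beta> \<in> D \<gamma>"
    have "neg (\<rho> (refl_elt \<gamma>) \<gamma>)" using True assms by (simp add: rho_refl_self)
    then have "neg (\<rho> (refl_elt \<gamma>) \<beta>)" using \<beta> assms unfolding D_def dom_def by auto
    then show "\<beta> \<in> N (refl_elt \<gamma>)" using \<beta> assms by (simp add: D_def in_N_refl_iff)
  qed
  then show ?thesis using finite_N assms finite_subset by (metis refl_closed)
next
  case False
  then have "D \<gamma> = {}" using dom_pos assms by (auto simp: D_def)
  then show ?thesis by simp
qed

lemma small_roots_iff: "\<gamma> \<in> small_roots n \<longleftrightarrow> \<gamma> \<in> \<Phi> \<and> pos \<gamma> \<and> dp \<gamma> \<le> n"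
proof (cases "\<gamma> \<in> \<Phi> \<and> pos \<gamma>")
  case True
  then have "{\<beta>\<in>\<Phi>\<^sup>+. \<beta> \<preceq> \<gamma> \<and> \<beta> \<noteq> \<gamma>} = D \<gamma>"
    using dominated_iff_dom by (auto simp: D_def pos_roots_iff)
  then have "inf_depth \<gamma> = enat (dp \<gamma>)"
    using True finite_D by (simp add: inf_depth_def dp_def)
  then show ?thesis using True by (simp add: small_roots_def pos_roots_iff)
qed (auto simp: small_roots_def pos_roots_iff)

lemma dp_less:
  assumes "\<beta> \<in> \<Phi>" "\<gamma> \<in> \<Phi>" "pos \<beta>" "dom \<beta> \<gamma>" "\<beta> \<noteq> \<gamma>"
  shows "dp \<beta> < dp \<gamma>"
proof -
  have "\<beta> \<in> D \<gamma> - D \<beta>" using assms by (auto simp: D_def)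
  moreover have "D \<beta> \<subseteq> D \<gamma>"
    using assms dom_trans dom_antisym by (auto simp: D_def)
  ultimately show ?thesis
    unfolding dp_def using assms finite_D by (intro psubset_card_mono) auto
qed

lemma dp_le: "\<beta> \<in> \<Phi> \<Longrightarrow> \<gamma> \<in> \<Phi> \<Longrightarrow> pos \<beta> \<Longrightarrow> dom \<beta> \<gamma> \<Longrightarrow> dp \<beta> \<le> dp \<gamma>"
  using dp_less[of \<beta> \<gamma>] by (cases "\<beta> = \<gamma>") auto

text \<open>
  If \<open>B \<beta> \<gamma> \<le> -1\<close>, the mirror image of \<open>\<gamma>\<close> in \<open>\<beta>\<close> lies in the cone of \<open>\<beta>\<close> and \<open>\<gamma>\<close> and again has a
  product \<open>\<le> -1\<close> with \<open>\<gamma>\<close>. Replacing \<open>\<beta>\<close> by it over and over yields infinitely many roots in this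
  cone, whereas inversion sets are finite and closed under cones.
\<close>

lemma B_inversions_gt:
  assumes w: "w \<in> carrier G" and \<beta>: "\<beta> \<in> N w" and \<gamma>: "\<gamma> \<in> N w"
  shows "B \<beta> \<gamma> > -1"
proof (rule ccontr)
  assume "\<not> B \<beta> \<gamma> > -1"
  then have B: "B \<beta> \<gamma> \<le> -1" by simp
  have roots: "\<beta> \<in> \<Phi>" "\<gamma> \<in> \<Phi>" "pos \<beta>" "pos \<gamma>" using N_root N_pos assms by auto
  define v where "v p = fst p *\<^sub>R \<beta> + snd p *\<^sub>R \<gamma>" for p :: "real \<times> real"
  define P where "P p \<longleftrightarrow> v p \<in> N w \<and> B (v p) \<gamma> \<le> -1 \<and> 0 \<le> fst p \<and> 0 \<le> snd p" for p
  have "\<exists>f. \<forall>n. P (f n) \<and> snd (f n) < snd (f (Suc n))"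
  proof (rule dependent_nat_choice)
    show "\<exists>p. P p" using B \<beta> by (intro exI[of _ "(1, 0)"]) (simp add: P_def v_def)
  next
    fix p :: "real \<times> real" assume p: "P p"
    define c where "c = - B (v p) \<gamma>"
    have c: "c \<ge> 1" using p by (simp add: P_def c_def)
    define q where "q = (2 * c * fst p, 1 + 2 * c * snd p)"
    have vq: "v q = (2 * c) *\<^sub>R v p + 1 *\<^sub>R \<gamma>" by (simp add: v_def q_def algebra_simps)
    have vp: "v p \<in> \<Phi>" using p N_root w by (auto simp: P_def)
    have "v q = \<rho> (refl_elt (v p)) \<gamma>" using vp by (simp add: rho_refl vq c_def)
    then have "v q \<in> \<Phi>" using roots vp by (simp add: rho_root)
    then have "v q \<in> N w" using N_closed[OF w _ vq] p \<gamma> c by (simp add: P_def)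
    moreover have "1 \<le> c * c" using c mult_mono[of 1 c 1 c] by simp
    then have "B (v q) \<gamma> \<le> -1" unfolding vq using B_root[OF roots(2)] by (simp add: B_simps c_def)
    ultimately have "P q" using p c by (simp add: P_def q_def)
    moreover have "snd p < snd q" using p c mult_mono[of 1 "2 * c" "snd p" "snd p"] by (simp add: P_def q_def)
    ultimately show "\<exists>q. P q \<and> snd p < snd q" by blast
  qed
  then obtain f where f: "\<And>n. P (f n)" "\<And>n. snd (f n) < snd (f (Suc n))" by blast
  have mono: "strict_mono (\<lambda>n. snd (f n))" using f(2) by (simp add: strict_mono_Suc_iff)
  have "inj (\<lambda>n. v (f n))"
  proof (rule injI, rule ccontr)
    fix m n assume eq: "v (f m) = v (f n)" and "m \<noteq> n"
    define k where "k = snd (f n) - snd (f m)"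
    have "k \<noteq> 0" using strict_mono_eq[OF mono, of n m] \<open>m \<noteq> n\<close> by (simp add: k_def)
    have "k *\<^sub>R \<gamma> = (fst (f m) - fst (f n)) *\<^sub>R \<beta>"
      using eq by (simp add: v_def k_def algebra_simps)
    then have "(1 / k) *\<^sub>R (k *\<^sub>R \<gamma>) = (1 / k) *\<^sub>R ((fst (f m) - fst (f n)) *\<^sub>R \<beta>)" by (simp only:)
    then have "\<gamma> = ((fst (f m) - fst (f n)) / k) *\<^sub>R \<beta>" using \<open>k \<noteq> 0\<close> by simp
    then have "\<beta> = \<gamma>" using pos_roots_not_parallel roots by blast
    then show False using B B_root roots by simp
  qed
  moreover have "range (\<lambda>n. v (f n)) \<subseteq> N w" using f(1) by (auto simp: P_def)
  ultimately show False using finite_N[OF w] by (meson finite_subset range_inj_infinite)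
qed

lemma not_separated:
  assumes "\<beta> \<in> \<Phi>" "\<gamma> \<in> \<Phi>" "B \<beta> \<gamma> \<le> -1" "u \<in> carrier G" "w \<in> carrier G"
    and "pos (\<rho> u \<beta>)" "pos (\<rho> u \<gamma>)" "neg (\<rho> w \<beta>)" "neg (\<rho> w \<gamma>)"
  shows False
proof -
  have "\<rho> u \<beta> \<in> N (u \<otimes> inv w)" "\<rho> u \<gamma> \<in> N (u \<otimes> inv w)"
    using assms by (auto simp: in_N_iff rho_root inv_mult_group rho_mult)
  then have "B (\<rho> u \<beta>) (\<rho> u \<gamma>) > -1" using B_inversions_gt assms by (metis inv_closed m_closed)
  then show False using assms by (simp add: rho_B)
qed

lemma dom_or_dom:
  assumes "\<beta> \<in> \<Phi>" "\<gamma> \<in> \<Phi>" "B \<beta> \<gamma> \<ge> 1"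
  shows "dom \<beta> \<gamma> \<or> dom \<gamma> \<beta>"
proof (rule ccontr)
  assume "\<not> ?thesis"
  then obtain u w where "u \<in> carrier G" "neg (\<rho> u \<gamma>)" "\<not> neg (\<rho> u \<beta>)"
    and "w \<in> carrier G" "neg (\<rho> w \<beta>)" "\<not> neg (\<rho> w \<gamma>)" by (auto simp: dom_def)
  moreover from this have "pos (\<rho> u \<beta>)" "pos (\<rho> w \<gamma>)"
    using assms rho_root pos_or_neg by blast+
  ultimately show False
    using not_separated[of \<beta> "- \<gamma>" u w] assms by (simp add: minus_root B_simps rho_simps)
qed

lemma dom_of_B_ge_1:
  assumes "\<beta> \<in> \<Phi>" "\<gamma> \<in> \<Phi>" "B \<beta> \<gamma> \<ge> 1" "pos \<beta>" "pos (\<rho> (refl_elt \<beta>) \<gamma>)"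
  shows "dom \<beta> \<gamma>"
proof (rule ccontr)
  assume "\<not> dom \<beta> \<gamma>"
  then have "dom \<gamma> \<beta>" using dom_or_dom assms by blast
  moreover have "neg (\<rho> (refl_elt \<beta>) \<beta>)" using assms by (simp add: rho_refl_self)
  ultimately have "neg (\<rho> (refl_elt \<beta>) \<gamma>)" using assms unfolding dom_def by auto
  then show False using assms not_pos_and_neg rho_root refl_closed by meson
qed

text \<open>
  The inequality that carries everything about depth. Let \<open>x\<close> be a positive root that is dominated
  by \<open>\<delta>\<close>. By invariance its mirror image is dominated by the mirror image \<open>\<gamma>\<close> of \<open>\<delta>\<close>, so it is
  enough to see that \<open>\<gamma>\<close> dominates \<open>x\<close> itself whenever the mirror image of \<open>x\<close> might be negative,
  that is if \<open>B \<epsilon> x \<ge> 0\<close>. Sending \<open>x\<close> to itself if \<open>\<gamma>\<close> dominates it and to its mirror image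
  otherwise is then injective.
\<close>

lemma dp_le_dp_refl:
  assumes \<delta>: "\<delta> \<in> \<Phi>" "pos \<delta>" and \<epsilon>: "\<epsilon> \<in> \<Phi>" "pos \<epsilon>" and B: "B \<epsilon> \<delta> \<le> 0"
  shows "dp \<delta> \<le> dp (\<rho> (refl_elt \<epsilon>) \<delta>)"
proof -
  define r where "r = refl_elt \<epsilon>"
  have r: "r \<in> carrier G" using \<epsilon> by (simp add: r_def)
  have rho_r: "\<rho> r x = x - (2 * B \<epsilon> x) *\<^sub>R \<epsilon>" for x using \<epsilon> by (simp add: r_def rho_refl)
  have rr: "\<rho> r (\<rho> r x) = x" for x using \<epsilon> by (simp add: r_def rho_refl_twice)
  define \<gamma> where "\<gamma> = \<rho> r \<delta>"
  have \<gamma>: "\<gamma> \<in> \<Phi>" using \<delta> r by (simp add: \<gamma>_def rho_root)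
  have stay: "dom x \<gamma>" if x: "x \<in> \<Phi>" "dom x \<delta>" and Bx: "B \<epsilon> x \<ge> 0" for x
    unfolding dom_def
  proof (intro ballI impI, rule ccontr)
    fix w assume w: "w \<in> carrier G" and neg: "neg (\<rho> w \<gamma>)" and "\<not> neg (\<rho> w x)"
    then have wx: "pos (\<rho> w x)" using x rho_root pos_or_neg by blast
    have "\<not> neg (\<rho> w \<delta>)" using x w \<open>\<not> neg (\<rho> w x)\<close> by (auto simp: dom_def)
    then have w\<delta>: "pos (\<rho> w \<delta>)" using \<delta> w rho_root pos_or_neg by blast
    have w\<gamma>: "\<rho> w \<gamma> = \<rho> w \<delta> + (- (2 * B \<epsilon> \<delta>)) *\<^sub>R \<rho> w \<epsilon>"
      using w by (simp add: \<gamma>_def rho_r rho_simps)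
    have "neg (\<rho> w \<epsilon>)"
    proof (rule ccontr)
      assume "\<not> neg (\<rho> w \<epsilon>)"
      then have "pos (\<rho> w \<epsilon>)" using \<epsilon> w rho_root pos_or_neg by blast
      then have "pos (\<rho> w \<gamma>)" unfolding w\<gamma> using w\<delta> B by (intro pos_add pos_scale) auto
      then show False using neg not_pos_and_neg rho_root \<gamma> w by blast
    qed
    then have "pos (\<rho> w x + (2 * B \<epsilon> x) *\<^sub>R - \<rho> w \<epsilon>)"
      using wx Bx by (intro pos_add pos_scale) auto
    then have "pos (\<rho> w (\<rho> r x))" using w by (simp add: rho_r rho_simps)
    moreover have "neg (\<rho> (w \<otimes> r) \<delta>)" using neg w r by (simp add: rho_mult \<gamma>_def)
    then have "neg (\<rho> (w \<otimes> r) x)" using x w r unfolding dom_def by blast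
    then have "neg (\<rho> w (\<rho> r x))" using w r by (simp add: rho_mult)
    ultimately show False using not_pos_and_neg rho_root x w r by blast
  qed
  have "dom (\<rho> r \<gamma>) (\<rho> r \<delta>) \<Longrightarrow> \<gamma> = \<delta>" if "dom \<gamma> \<delta>"
    using that dom_antisym[of \<gamma> \<delta>] \<gamma> \<delta> by (simp add: \<gamma>_def rr)
  then have no_dom: "\<gamma> = \<delta>" if "dom \<gamma> \<delta>"
    using that dom_rho[OF r, of \<gamma> \<delta>] by blast
  define f where "f x = (if dom x \<gamma> then x else \<rho> r x)" for x
  have "f x \<in> D \<gamma>" if "x \<in> D \<delta>" for x
  proof -
    have x: "x \<in> \<Phi>" "pos x" "dom x \<delta>" "x \<noteq> \<delta>" using that by (auto simp: D_def)
    show ?thesis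
    proof (cases "dom x \<gamma>")
      case True
      moreover have "x \<noteq> \<gamma>" using x no_dom by auto
      ultimately show ?thesis using x by (simp add: f_def D_def)
    next
      case False
      then have "B \<epsilon> x < 0" using stay x by force
      then have "pos (x + (- (2 * B \<epsilon> x)) *\<^sub>R \<epsilon>)" using x \<epsilon> by (intro pos_add pos_scale) auto
      then have "pos (\<rho> r x)" by (simp add: rho_r)
      moreover have "dom (\<rho> r x) \<gamma>" using dom_rho[OF r x(3)] by (simp add: \<gamma>_def)
      moreover have "\<rho> r x \<noteq> \<gamma>" using x r by (simp add: \<gamma>_def rho_eq_iff)
      ultimately show ?thesis using False x r by (simp add: f_def D_def rho_root)
    qed
  qed
  moreover have "inj_on f (D \<delta>)"
  proof (rule inj_onI)
    fix x y assume xy: "x \<in> D \<delta>" "y \<in> D \<delta>" "f x = f y"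
    have *: "dom z \<gamma>" if "z' \<in> D \<delta>" "z' = \<rho> r z" for z z'
      using that dom_rho[OF r, of z' \<delta>] by (auto simp: D_def \<gamma>_def rr)
    consider "dom x \<gamma> \<longleftrightarrow> dom y \<gamma>" | "dom x \<gamma>" "\<not> dom y \<gamma>" | "\<not> dom x \<gamma>" "dom y \<gamma>" by blast
    then show "x = y"
    proof cases
      case 1
      then show ?thesis using xy(3) rho_eq_iff[OF r] unfolding f_def by metis
    next
      case 2
      then have "x = \<rho> r y" using xy(3) by (simp only: f_def if_True if_False)
      then show ?thesis using *[of x y] xy 2 by blast
    next
      case 3
      then have "y = \<rho> r x" using xy(3) by (simp only: f_def if_True if_False)
      then show ?thesis using *[of y x] xy 3 by blast
    qed
  qed
  ultimately show ?thesis
    unfolding dp_def r_def[symmetric] \<gamma>_def[symmetric]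
    using finite_D[OF \<gamma>] by (intro card_inj_on_le[of f]) auto
qed

lemma card_rho_D: "s \<in> S \<Longrightarrow> card (\<rho> s ` D \<beta>) = dp \<beta>"
  unfolding dp_def by (intro card_image inj_onI) (simp add: rho_eq_iff)

lemma dp_le_dp_S:
  assumes "\<beta> \<in> \<Phi>" "s \<in> S" "\<not> dom (\<alpha> s) \<beta>"
  shows "dp \<beta> \<le> dp (\<rho> s \<beta>)" "\<alpha> s \<notin> \<rho> s ` D \<beta>" "\<rho> s ` D \<beta> \<subseteq> D (\<rho> s \<beta>)"
proof -
  show "\<rho> s ` D \<beta> \<subseteq> D (\<rho> s \<beta>)"
  proof
    fix y assume "y \<in> \<rho> s ` D \<beta>"
    then obtain x where x: "y = \<rho> s x" "x \<in> \<Phi>" "pos x" "dom x \<beta>" "x \<noteq> \<beta>" by (auto simp: D_def)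
    then have "x \<noteq> \<alpha> s" using assms by auto
    then have "pos y" using x assms S_permutes_pos by auto
    then show "y \<in> D (\<rho> s \<beta>)" using x assms dom_rho by (auto simp: D_def rho_root rho_eq_iff)
  qed
  then have "card (\<rho> s ` D \<beta>) \<le> dp (\<rho> s \<beta>)"
    unfolding dp_def using assms by (intro card_mono finite_D rho_root) auto
  then show "dp \<beta> \<le> dp (\<rho> s \<beta>)" using assms(2) by (simp add: card_rho_D)
  show "\<alpha> s \<notin> \<rho> s ` D \<beta>"
  proof
    assume "\<alpha> s \<in> \<rho> s ` D \<beta>"
    then obtain x where x: "\<alpha> s = \<rho> s x" "x \<in> \<Phi>" "pos x" by (auto simp: D_def)
    then have "x = - \<alpha> s" using eq_minus_alpha assms by blast
    then have "neg (\<alpha> s)" using x(3) by simp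
    then show False using not_neg_alpha assms by blast
  qed
qed

text \<open>
  Here \<open>\<alpha> s\<close> itself is new among the dominated roots.
\<close>

lemma dp_less_dp_S:
  assumes \<beta>: "\<beta> \<in> \<Phi>" "pos \<beta>" and s: "s \<in> S" and B: "B (\<alpha> s) \<beta> \<le> -1"
  shows "dp \<beta> < dp (\<rho> s \<beta>)"
proof -
  have "\<not> dom (\<alpha> s) \<beta>"
  proof
    assume "dom (\<alpha> s) \<beta>"
    moreover have "neg (\<rho> (refl_elt \<beta>) \<beta>)" using \<beta> by (simp add: rho_refl_self)
    ultimately have "neg (\<rho> (refl_elt \<beta>) (\<alpha> s))" using \<beta> by (simp add: dom_def)
    then show False
      using not_separated[of "\<alpha> s" \<beta> \<one> "refl_elt \<beta>"] assms alpha_root by (simp add: rho_refl_self)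
  qed
  note sub = dp_le_dp_S[OF \<beta>(1) s this]
  have sb: "\<rho> s \<beta> \<in> \<Phi>" using \<beta> s by (simp add: rho_root)
  have "B (\<alpha> s) (\<rho> s \<beta>) = - B (\<alpha> s) \<beta>" using s by (simp add: rho_S B_simps)
  then have "dom (\<alpha> s) (\<rho> s \<beta>)"
    using B \<beta> s sb alpha_root by (intro dom_of_B_ge_1) (auto simp: refl_alpha rho_S_twice)
  moreover have "\<alpha> s \<noteq> \<rho> s \<beta>"
  proof
    assume "\<alpha> s = \<rho> s \<beta>"
    then have "\<beta> = - \<alpha> s" using eq_minus_alpha s by blast
    then have "neg (\<alpha> s)" using \<beta>(2) by simp
    then show False using not_neg_alpha s by blast
  qed
  ultimately have "\<alpha> s \<in> D (\<rho> s \<beta>)" using s alpha_root by (simp add: D_def)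
  then have "\<rho> s ` D \<beta> \<subset> D (\<rho> s \<beta>)" using sub by blast
  then have "card (\<rho> s ` D \<beta>) < dp (\<rho> s \<beta>)"
    unfolding dp_def using sb by (intro psubset_card_mono finite_D)
  then show ?thesis using s by (simp add: card_rho_D)
qed

section \<open>Values of the form on roots\<close>

text \<open>
  The length of the reflection in a positive root measures how far the root is from being
  simple.
\<close>

lemma len_refl_descent:
  assumes t: "t \<in> S" and \<gamma>: "\<gamma> \<in> \<Phi>" "pos \<gamma>" "\<gamma> \<noteq> \<alpha> t" and B: "B (\<alpha> t) \<gamma> > 0"
  shows "len (refl_elt (\<rho> t \<gamma>)) < len (refl_elt \<gamma>)"
proof -
  define r where "r = refl_elt \<gamma>"
  have r: "r \<in> carrier G" "inv r = r" using \<gamma> by (auto simp: r_def refl_inv)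
  define b where "b = 2 * B (\<alpha> t) \<gamma>"
  have b: "b > 0" using B by (simp add: b_def)
  have rt: "\<rho> r (\<alpha> t) = \<alpha> t - b *\<^sub>R \<gamma>"
    using \<gamma> B_sym[of \<gamma>] by (simp add: r_def rho_refl b_def)
  have "\<not> pos (\<rho> r (\<alpha> t))"
  proof
    assume pos: "pos (\<rho> r (\<alpha> t))"
    have "b *\<^sub>R \<gamma> + \<rho> r (\<alpha> t) = 1 *\<^sub>R \<alpha> t" by (simp add: rt)
    then obtain a where a: "b *\<^sub>R \<gamma> = a *\<^sub>R \<alpha> t"
      using alpha_extreme[OF t, of "b *\<^sub>R \<gamma>" "\<rho> r (\<alpha> t)" 1] pos pos_scale[of b \<gamma>] \<gamma> b by auto
    have "\<gamma> = (1 / b) *\<^sub>R (b *\<^sub>R \<gamma>)" using b by simp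
    then have "\<gamma> = (a / b) *\<^sub>R \<alpha> t" using a by simp
    then have "\<alpha> t = \<gamma>" using pos_roots_not_parallel t \<gamma> alpha_root pos_alpha by blast
    then show False using \<gamma>(3) by simp
  qed
  then have "len (r \<otimes> t) < len r" using ascent_iff len_mult_S r t by (metis lessI)
  moreover have "len (t \<otimes> r) = len (r \<otimes> t)"
    using len_inv[of "r \<otimes> t"] r t by (simp add: inv_mult_group S_inv)
  moreover have "len (t \<otimes> r \<otimes> t) < len (t \<otimes> r)"
  proof -
    have "pos (\<rho> t \<gamma>)" using S_permutes_pos t \<gamma> by blast
    then have "pos (\<alpha> t + b *\<^sub>R \<rho> t \<gamma>)" using t b by (intro pos_add pos_scale) auto
    moreover have "\<rho> (t \<otimes> r) (\<alpha> t) = - (\<alpha> t + b *\<^sub>R \<rho> t \<gamma>)"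
      using t r by (simp add: rho_mult rt rho_simps rho_S_alpha)
    ultimately have "neg (\<rho> (t \<otimes> r) (\<alpha> t))" by (simp add: add.commute)
    then have "\<not> pos (\<rho> (t \<otimes> r) (\<alpha> t))"
      using not_pos_and_neg[of "\<rho> (t \<otimes> r) (\<alpha> t)"] rho_root[of "t \<otimes> r" "\<alpha> t"] alpha_root t r by auto
    then show ?thesis using ascent_iff len_mult_S r t by (metis lessI m_closed S_closed)
  qed
  ultimately show ?thesis using t \<gamma> by (simp add: refl_S_conj r_def)
qed

lemma ex_descent:
  assumes "\<gamma> \<in> \<Phi>" "pos \<gamma>"
  obtains t where "t \<in> S" "B (\<alpha> t) \<gamma> > 0"
proof -
  have "\<exists>t\<in>S. B (\<alpha> t) \<gamma> > 0"
  proof (rule ccontr)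
    assume "\<not> (\<exists>t\<in>S. B (\<alpha> t) \<gamma> > 0)"
    then have B: "B \<gamma> (\<alpha> t) \<le> 0" if "t \<in> S" for t using that B_sym by (metis not_le)
    obtain c where c: "\<And>s. s \<in> S \<Longrightarrow> c s \<ge> 0" "\<gamma> = (\<Sum>s\<in>S. c s *\<^sub>R \<alpha> s)"
      using pos_combination assms by blast
    have "B \<gamma> (\<Sum>s\<in>S. c s *\<^sub>R \<alpha> s) \<le> 0"
      unfolding B_sum_right using c(1) B by (intro sum_nonpos) (simp add: B_simps mult_nonneg_nonpos)
    then show False using B_root[OF assms(1)] c(2) by simp
  qed
  then show ?thesis using that by blast
qed

text \<open>
  Reflecting alternately in \<open>s\<close> and \<open>t\<close> would preserve the hypotheses and make the root simpler
  and simpler.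
\<close>

lemma no_infinite_descent:
  assumes "s \<in> S" "t \<in> S" "s \<noteq> t" "B (\<alpha> s) (\<alpha> t) \<le> -1" "\<gamma> \<in> \<Phi>" "pos \<gamma>"
    and "B (\<alpha> s) \<gamma> \<le> 0" "B (\<alpha> t) \<gamma> > - B (\<alpha> s) \<gamma>"
  shows False
  using assms
proof (induction "len (refl_elt \<gamma>)" arbitrary: s t \<gamma> rule: less_induct)
  case (less \<gamma> s t)
  define c x y where "c = - B (\<alpha> s) (\<alpha> t)" and "x = - B (\<alpha> s) \<gamma>" and "y = B (\<alpha> t) \<gamma>"
  have c: "c \<ge> 1" "B (\<alpha> s) (\<alpha> t) = - c" "B (\<alpha> t) (\<alpha> s) = - c" and xy: "x \<ge> 0" "y > x"
    using less.prems B_sym[of "\<alpha> t"] by (auto simp: c_def x_def y_def)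
  have "\<gamma> \<noteq> \<alpha> t" using xy c less.prems by (auto simp: x_def y_def)
  then have "pos (\<rho> t \<gamma>)" "len (refl_elt (\<rho> t \<gamma>)) < len (refl_elt \<gamma>)"
    using S_permutes_pos len_refl_descent less.prems by auto
  moreover have "B (\<alpha> t) (\<rho> t \<gamma>) = - y" "B (\<alpha> s) (\<rho> t \<gamma>) = 2 * c * y - x"
    using less.prems c by (simp_all add: rho_S B_simps x_def y_def)
  moreover have "2 * c * y - x > y"
    using xy mult_right_mono[of 1 c y] c(1) by linarith
  ultimately show False
    using less.hyps[of "\<rho> t \<gamma>" t s] less.prems xy c by (simp add: rho_root)
qed

text \<open>
  Reflecting in \<open>s\<close>, or if that does not help in a further simple root \<open>t\<close>, makes \<open>\<gamma>\<close> simpler. For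
  the label \<open>\<infinity>\<close> the previous lemma bounds the values of the form that occur on the way, so that
  the induction hypothesis applies to them.
\<close>

lemma B_alpha_root_values:
  assumes "s \<in> S" "\<gamma> \<in> \<Phi>" "pos \<gamma>" "\<bar>B (\<alpha> s) \<gamma>\<bar> < 1"
  shows "B (\<alpha> s) \<gamma> \<in> {0, 1/2, -1/2}"
  using assms
proof (induction "len (refl_elt \<gamma>)" arbitrary: s \<gamma> rule: less_induct)
  case (less \<gamma> s)
  note s = less.prems(1) and \<gamma> = less.prems(2,3)
  have IH: "B (\<alpha> r) \<delta> \<in> {0, 1/2, -1/2}"
    if "len (refl_elt \<delta>) < len (refl_elt \<gamma>)" "r \<in> S" "\<delta> \<in> \<Phi>" "pos \<delta>" "\<bar>B (\<alpha> r) \<delta>\<bar> < 1" for r \<delta>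
    using less.hyps that by blast
  define x where "x = - B (\<alpha> s) \<gamma>"
  have x: "-1 < x" "x < 1" "B (\<alpha> s) \<gamma> = - x" using less.prems by (auto simp: x_def)
  consider "x = 0" | "x < 0" | "x > 0" by linarith
  then show ?case
  proof cases
    case 1
    then show ?thesis using x by simp
  next
    case 2
    have "\<gamma> \<noteq> \<alpha> s" using x s by auto
    moreover have "B (\<alpha> s) (\<rho> s \<gamma>) = x" using s x by (simp add: rho_S B_simps)
    ultimately have "x \<in> {0, 1/2, -1/2}"
      using IH[of "\<rho> s \<gamma>" s] len_refl_descent[of s \<gamma>] S_permutes_pos[of s \<gamma>] s \<gamma> x 2
      by (auto simp: rho_root)
    then show ?thesis using x by auto
  next
    case 3
    obtain t where t: "t \<in> S" "B (\<alpha> t) \<gamma> > 0" using ex_descent \<gamma> by blast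
    have ts: "s \<noteq> t" using t x 3 by auto
    define y where "y = B (\<alpha> t) \<gamma>"
    define c where "c = - B (\<alpha> s) (\<alpha> t)"
    have y: "y > 0" using t by (simp add: y_def)
    have c: "B (\<alpha> s) (\<alpha> t) = - c" "B (\<alpha> t) (\<alpha> s) = - c" using B_sym[of "\<alpha> t"] by (auto simp: c_def)
    show ?thesis
    proof (cases "\<gamma> = \<alpha> t")
      case True
      from s t(1) ts show ?thesis
      proof (cases rule: label_cases)
        case inf
        then show ?thesis using x True by simp
      qed (use True in simp_all)
    next
      case False
      define \<delta> where "\<delta> = \<rho> t \<gamma>"
      have \<delta>: "\<delta> \<in> \<Phi>" "pos \<delta>" and len: "len (refl_elt \<delta>) < len (refl_elt \<gamma>)"
        using False t \<gamma> S_permutes_pos len_refl_descent by (auto simp: \<delta>_def rho_root)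
      have B\<delta>: "B (\<alpha> t) \<delta> = - y" "B (\<alpha> s) \<delta> = 2 * c * y - x"
        using t x c by (simp_all add: \<delta>_def rho_S B_simps y_def)
      have y_val: "y = 1/2" if "y < 1" using IH[of \<delta> t] that t \<delta> len B\<delta> y by auto
      \<comment> \<open>If \<open>s\<close> still makes \<open>\<delta>\<close> simpler, one more reflection is available.\<close>
      have further: "2 * c * (2 * c * y - x) - y \<in> {0, 1/2, -1/2}"
        if "2 * c * y - x > 0" "2 * c * y - x \<noteq> 1 \<or> y \<noteq> c" "\<bar>2 * c * (2 * c * y - x) - y\<bar> < 1"
      proof -
        have "\<delta> \<noteq> \<alpha> s" using that s B\<delta> c by auto
        then have "len (refl_elt (\<rho> s \<delta>)) < len (refl_elt \<delta>)" "pos (\<rho> s \<delta>)" "\<rho> s \<delta> \<in> \<Phi>"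
          using that(1) s \<delta> B\<delta> S_permutes_pos len_refl_descent by (auto simp: rho_root)
        moreover have "B (\<alpha> t) (\<rho> s \<delta>) = 2 * c * (2 * c * y - x) - y"
          using s B\<delta> c by (simp add: rho_S B_simps)
        ultimately show ?thesis using IH[of "\<rho> s \<delta>" t] t len that by simp
      qed
      from s t(1) ts show ?thesis
      proof (cases rule: label_cases)
        case two
        then have "B (\<alpha> s) \<delta> = - x" using B\<delta> c by simp
        then show ?thesis using IH[of \<delta> s] s \<delta> len x by simp
      next
        case three
        then have c': "c = 1/2" by (simp add: c_def)
        show ?thesis
        proof (cases "y \<le> x")
          case True
          then have "y = 1/2" using y_val x by simp
          moreover have "y - x \<in> {0, 1/2, -1/2}" using IH[of \<delta> s] s \<delta> len B\<delta> c' x y True by simp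
          ultimately show ?thesis using x by auto
        next
          case False
          then have "- x \<in> {0, 1/2, -1/2}" using further x 3 unfolding c' by simp
          then show ?thesis using x by simp
        qed
      next
        case inf
        then have c1: "c \<ge> 1" by (simp add: c_def)
        have "y \<le> x"
          using no_infinite_descent[of s t \<gamma>] s t ts inf \<gamma> x 3 by (force simp: y_def)
        then have y': "y = 1/2" using y_val x by simp
        then have z: "2 * c * y - x = c - x" "c - x > 0" using c1 x by auto
        have "c - x \<le> y"
          using no_infinite_descent[of t s \<delta>] s t ts c c1 \<delta> B\<delta> y z by force
        then have "c - x \<in> {0, 1/2, -1/2}" using IH[of \<delta> s] s \<delta> len B\<delta> z y' by simp
        then have "c = x + 1/2" using z by auto
        then have "x \<in> {0, 1/2, -1/2}" using further y' x 3 by (simp add: algebra_simps)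
        then show ?thesis using x by auto
      qed
    qed
  qed
qed

lemma B_root_values:
  assumes "\<beta> \<in> \<Phi>" "\<gamma> \<in> \<Phi>" "\<bar>B \<beta> \<gamma>\<bar> < 1"
  shows "B \<beta> \<gamma> \<in> {0, 1/2, -1/2}"
proof -
  obtain w s where ws: "w \<in> carrier G" "s \<in> S" "\<beta> = \<rho> w (\<alpha> s)" using rootE assms(1) by blast
  define \<delta> where "\<delta> = \<rho> (inv w) \<gamma>"
  have \<delta>: "\<delta> \<in> \<Phi>" using ws assms by (simp add: \<delta>_def rho_root)
  have "B \<beta> \<gamma> = B (\<alpha> s) \<delta>" using ws rho_B_inv[of w \<gamma> "\<alpha> s"] B_sym by (metis \<delta>_def)
  moreover have "B (\<alpha> s) \<delta> \<in> {0, 1/2, -1/2}"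
  proof (cases "pos \<delta>")
    case True
    then show ?thesis using B_alpha_root_values[of s \<delta>] ws \<delta> assms calculation by simp
  next
    case False
    then have "pos (- \<delta>)" using \<delta> pos_or_neg by blast
    then have "B (\<alpha> s) (- \<delta>) \<in> {0, 1/2, -1/2}"
      using B_alpha_root_values[of s "- \<delta>"] ws \<delta> assms calculation by (simp add: minus_root B_simps)
    then show ?thesis by (auto simp: B_simps)
  qed
  ultimately show ?thesis by simp
qed

lemma B_root_pos_cases:
  "\<beta> \<in> \<Phi> \<Longrightarrow> \<gamma> \<in> \<Phi> \<Longrightarrow> B \<beta> \<gamma> > 0 \<Longrightarrow> B \<beta> \<gamma> = 1/2 \<or> B \<beta> \<gamma> \<ge> 1"
  using B_root_values[of \<beta> \<gamma>] by auto

lemma B_root_neg_cases: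
  "\<beta> \<in> \<Phi> \<Longrightarrow> \<gamma> \<in> \<Phi> \<Longrightarrow> B \<beta> \<gamma> < 0 \<Longrightarrow> B \<beta> \<gamma> = -1/2 \<or> B \<beta> \<gamma> \<le> -1"
  using B_root_values[of \<beta> \<gamma>] by auto

section \<open>Bipodality\<close>

lemma dp_le_of_B_pos:
  assumes "\<delta> \<in> \<Phi>" "\<gamma> \<in> \<Phi>" "pos \<delta>" "pos \<gamma>" "B \<delta> \<gamma> > 0" "pos (\<rho> (refl_elt \<delta>) \<gamma>)"
  shows "dp \<delta> \<le> dp \<gamma>"
  using B_root_pos_cases[OF assms(1,2,5)]
proof
  assume "B \<delta> \<gamma> \<ge> 1"
  then show ?thesis using dom_of_B_ge_1 dp_le assms by blast
next
  assume B: "B \<delta> \<gamma> = 1/2"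
  \<comment> \<open>Then \<open>\<delta>\<close> and \<open>\<gamma> - \<delta>\<close> are the simple roots of a subsystem of type A2 with highest root \<open>\<gamma>\<close>.\<close>
  define \<epsilon> where "\<epsilon> = \<rho> (refl_elt \<delta>) \<gamma>"
  have \<epsilon>: "\<epsilon> = \<gamma> - \<delta>" "\<epsilon> \<in> \<Phi>" "pos \<epsilon>"
  proof -
    have "2 * B \<delta> \<gamma> = 1" using B by simp
    then show "\<epsilon> = \<gamma> - \<delta>" using assms(1) by (simp only: \<epsilon>_def rho_refl scaleR_one)
  qed (use assms in \<open>simp_all add: \<epsilon>_def rho_root\<close>)
  have "B \<epsilon> \<delta> = -1/2" using B B_root assms B_sym[of \<gamma>] by (simp add: \<epsilon>(1) B_simps)
  moreover from this have "\<rho> (refl_elt \<epsilon>) \<delta> = \<gamma>" using \<epsilon>(2) by (simp add: rho_refl) (simp add: \<epsilon>(1))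
  ultimately show ?thesis using dp_le_dp_refl[of \<delta> \<epsilon>] assms \<epsilon> by simp
qed

lemma pos_roots_independent:
  assumes "\<beta> \<in> \<Phi>" "\<gamma> \<in> \<Phi>" "pos \<beta>" "pos \<gamma>" "\<beta> \<noteq> \<gamma>" "a *\<^sub>R \<beta> + b *\<^sub>R \<gamma> = 0"
  shows "a = 0" "b = 0"
proof -
  have *: "b' = 0" if "\<beta>' \<in> \<Phi>" "\<gamma>' \<in> \<Phi>" "pos \<beta>'" "pos \<gamma>'" "\<beta>' \<noteq> \<gamma>'" "a' *\<^sub>R \<beta>' + b' *\<^sub>R \<gamma>' = 0"
    for \<beta>' \<gamma>' a' b'
  proof (rule ccontr)
    assume "b' \<noteq> 0"
    have "b' *\<^sub>R \<gamma>' = (- a') *\<^sub>R \<beta>'"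
      using that(6) by (simp add: eq_neg_iff_add_eq_0 add.commute)
    then have "(1 / b') *\<^sub>R (b' *\<^sub>R \<gamma>') = (1 / b') *\<^sub>R ((- a') *\<^sub>R \<beta>')" by (simp only:)
    then have "\<gamma>' = (- a' / b') *\<^sub>R \<beta>'" using \<open>b' \<noteq> 0\<close> by simp
    then show False using pos_roots_not_parallel that by blast
  qed
  show "b = 0" using *[of \<beta> \<gamma> a b] assms by simp
  show "a = 0" using *[of \<gamma> \<beta> b a] assms by (simp add: add.commute)
qed

lemma plane_combination:
  assumes "subspace P" "dim P = 2" "\<beta> \<in> P \<inter> \<Phi>" "\<gamma> \<in> P \<inter> \<Phi>" "pos \<beta>" "pos \<gamma>" "\<beta> \<noteq> \<gamma>" "x \<in> P"
  obtains a b where "x = a *\<^sub>R \<beta> + b *\<^sub>R \<gamma>"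
proof -
  obtain E where E: "E \<subseteq> P" "independent E" "P \<subseteq> span E" "card E = dim P"
    using basis_exists by blast
  have finE: "finite E" using E(4) assms(2) by (metis card.infinite zero_neq_numeral)
  have ind: "independent {\<beta>, \<gamma>}"
  proof -
    have "\<beta> \<notin> span {\<gamma>}"
    proof
      assume "\<beta> \<in> span {\<gamma>}"
      then obtain k where "\<beta> = k *\<^sub>R \<gamma>" by (auto simp: span_singleton)
      then show False using pos_roots_not_parallel[of \<gamma> \<beta> k] assms by auto
    qed
    moreover have "\<gamma> \<noteq> 0" using B_root[of \<gamma>] assms by (auto simp: B_simps)
    ultimately show ?thesis by (simp add: independent_insert)
  qed
  have "x \<in> span {\<beta>, \<gamma>}"
  proof (rule ccontr)
    assume x: "x \<notin> span {\<beta>, \<gamma>}"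
    then have "independent {x, \<beta>, \<gamma>}" using ind by (rule independent_insertI)
    then have "card {x, \<beta>, \<gamma>} \<le> card E"
      using independent_span_bound[OF finE, of "{x, \<beta>, \<gamma>}"] E assms by auto
    moreover have "x \<noteq> \<beta>" "x \<noteq> \<gamma>" using x by (auto simp: span_base)
    ultimately show False using E assms by simp
  qed
  then obtain a where "x - a *\<^sub>R \<beta> \<in> span {\<gamma>}" by (auto simp: span_breakdown_eq[of x \<beta>])
  then obtain b where "x - a *\<^sub>R \<beta> = b *\<^sub>R \<gamma>" by (auto simp: span_singleton)
  then show ?thesis using that[of a b] by (simp add: algebra_simps)
qed

text \<open>
  The roots of a plane are ordered by the angle from the simple root \<open>\<delta>\<close>. If \<open>B \<delta> \<gamma> > 0\<close>,
  lemma \<open>dp_le_of_B_pos\<close> applies. Otherwise take the inversion \<open>q\<close> of the reflection in \<open>\<gamma>\<close> that is farthest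
  from \<open>\<delta>\<close>; it lies beyond \<open>\<gamma>\<close>. Reflecting \<open>\<gamma>\<close> in \<open>q\<close> does not increase the depth and leads to \<open>\<delta>\<close> or
  to a root that has a positive product with \<open>\<delta>\<close>.
\<close>

lemma dp_le_in_plane:
  assumes P: "subspace P" "dim P = 2"
    and \<delta>: "\<delta> \<in> \<Phi>" "pos \<delta>" "N (refl_elt \<delta>) \<inter> P = {\<delta>}"
    and \<gamma>: "\<gamma> \<in> \<Phi>" "pos \<gamma>" "\<gamma> \<in> P"
    and \<kappa>: "\<kappa> \<in> N (refl_elt \<gamma>)" "\<kappa> \<in> P" "\<kappa> \<noteq> \<gamma>"
  shows "dp \<delta> \<le> dp \<gamma>"
proof -
  have \<delta>P: "\<delta> \<in> P" using \<delta> by blast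
  have "\<gamma> \<noteq> \<delta>" using \<kappa> \<delta> by auto
  have \<delta>_pos: "pos (\<rho> (refl_elt \<delta>) x)" if "x \<in> \<Phi>" "pos x" "x \<in> P" "x \<noteq> \<delta>" for x
  proof (rule ccontr)
    assume "\<not> pos (\<rho> (refl_elt \<delta>) x)"
    then have "neg (\<rho> (refl_elt \<delta>) x)" using pos_or_neg rho_root that \<delta> refl_closed by blast
    then have "x \<in> N (refl_elt \<delta>)" using that in_N_refl_iff[OF \<delta>(1)] by blast
    then show False using \<delta>(3) that by blast
  qed
  show ?thesis
  proof (cases "B \<delta> \<gamma> > 0")
    case True
    then show ?thesis using dp_le_of_B_pos \<delta> \<gamma> \<delta>_pos \<open>\<gamma> \<noteq> \<delta>\<close> by blast
  next
    case False
    define c where "c = - B \<delta> \<gamma>"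
    have c: "c \<ge> 0" "B \<gamma> \<delta> = - c" using False B_sym by (auto simp: c_def)
    define r where "r = refl_elt \<gamma>"
    have r: "r \<in> carrier G" using \<gamma> by (simp add: r_def)
    have rho_r: "\<rho> r x = x - (2 * B \<gamma> x) *\<^sub>R \<gamma>" for x using \<gamma> by (simp add: r_def rho_refl)
    have in_N_r: "x \<in> N r \<longleftrightarrow> x \<in> \<Phi> \<and> pos x \<and> neg (\<rho> r x)" for x
      using \<gamma> by (simp add: r_def in_N_refl_iff)
    have r\<delta>: "pos (\<rho> r \<delta>)"
    proof -
      have "pos (\<delta> + (2 * c) *\<^sub>R \<gamma>)" using \<delta> \<gamma> c by (intro pos_add pos_scale) auto
      then show ?thesis by (simp add: rho_r c)
    qed
    define v where "v p = snd p *\<^sub>R \<gamma> - fst p *\<^sub>R \<delta>" for p :: "real \<times> real"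
    have v_inj: "p = p'" if "v p = v p'" for p p'
    proof -
      have "(fst p' - fst p) *\<^sub>R \<delta> + (snd p - snd p') *\<^sub>R \<gamma> = 0"
        using that by (simp add: v_def algebra_simps)
      then have "fst p' - fst p = 0" "snd p - snd p' = 0"
        using pos_roots_independent[OF \<delta>(1) \<gamma>(1) \<delta>(2) \<gamma>(2) \<open>\<gamma> \<noteq> \<delta>\<close>[symmetric]] by blast+
      then show ?thesis by (simp add: prod_eq_iff)
    qed
    define F where "F = {p. fst p > 0 \<and> v p \<in> N r}"
    have snd_pos: "snd p > 0" if "fst p > 0" "pos (v p)" "v p \<in> \<Phi>" for p
    proof (rule ccontr)
      assume "\<not> snd p > 0"
      then have "pos (fst p *\<^sub>R \<delta> + (- snd p) *\<^sub>R \<gamma>)"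
        using that \<delta> \<gamma> by (intro pos_add pos_scale) auto
      then have "neg (v p)" by (simp add: v_def)
      then show False using that not_pos_and_neg by blast
    qed
    have "finite F"
    proof (rule inj_on_finite)
      show "inj_on v F" using v_inj by (auto intro: inj_onI)
      show "v ` F \<subseteq> N r" by (auto simp: F_def)
      show "finite (N r)" using finite_N r by blast
    qed
    moreover have "F \<noteq> {}"
    proof -
      obtain a b where ab: "\<kappa> = a *\<^sub>R \<delta> + b *\<^sub>R \<gamma>"
        using plane_combination[of P \<delta> \<gamma> \<kappa>] P \<delta> \<delta>P \<gamma> \<kappa> \<open>\<gamma> \<noteq> \<delta>\<close> by auto
      have \<kappa>': "\<kappa> \<in> \<Phi>" "pos \<kappa>" "neg (\<rho> r \<kappa>)" using \<kappa> in_N_r by (auto simp: r_def)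
      have "a \<noteq> 0" using pos_roots_not_parallel[of \<gamma> \<kappa> b] ab \<kappa>' \<gamma> \<kappa>(3) by auto
      show ?thesis
      proof (cases "a < 0")
        case True
        then have "(- a, b) \<in> F" using ab \<kappa> by (simp add: F_def v_def r_def add.commute)
        then show ?thesis by blast
      next
        case False
        have "- \<rho> r \<kappa> = v (a, 2 * B \<gamma> \<kappa> - b)" by (simp add: rho_r ab v_def algebra_simps)
        moreover have "- \<rho> r \<kappa> \<in> N r"
          using \<kappa>' r rho_refl_twice[OF \<gamma>(1), of \<kappa>, folded r_def]
          by (simp add: in_N_r minus_root rho_root rho_simps)
        ultimately have "(a, 2 * B \<gamma> \<kappa> - b) \<in> F" using False \<open>a \<noteq> 0\<close> by (simp add: F_def)
        then show ?thesis by blast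
      qed
    qed
    ultimately have "Max ((\<lambda>p. fst p / snd p) ` F) \<in> (\<lambda>p. fst p / snd p) ` F" by simp
    then obtain p where p: "p \<in> F" and max: "\<And>p'. p' \<in> F \<Longrightarrow> fst p' / snd p' \<le> fst p / snd p"
      using \<open>finite F\<close> by (metis (no_types, lifting) Max_ge finite_imageI imageE image_eqI)
    define x y q where "x = fst p" and "y = snd p" and "q = v p"
    have q: "q \<in> \<Phi>" "pos q" "neg (\<rho> r q)" and x: "x > 0" using p in_N_r by (auto simp: q_def F_def x_def)
    have y: "y > 0" using snd_pos[of p] x q by (simp add: x_def y_def q_def)
    have q_eq: "q = y *\<^sub>R \<gamma> - x *\<^sub>R \<delta>" by (simp add: q_def v_def x_def y_def)
    have qP: "q \<in> P" unfolding q_eq using P \<gamma> \<delta>P by (intro subspace_diff subspace_scale) auto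
    have q\<delta>: "q \<noteq> \<delta>"
    proof
      assume "q = \<delta>"
      then have "(- x - 1) *\<^sub>R \<delta> + y *\<^sub>R \<gamma> = 0" using q_eq by (simp add: algebra_simps)
      then show False using pos_roots_independent[of \<delta> \<gamma> "- x - 1" y] y \<delta> \<gamma> \<open>\<gamma> \<noteq> \<delta>\<close> by simp
    qed
    define b where "b = B q \<gamma>"
    have b: "b > 0"
    proof (rule ccontr)
      assume "\<not> b > 0"
      then have "pos (q + (- 2 * b) *\<^sub>R \<gamma>)" using q \<gamma> by (intro pos_add pos_scale) auto
      then have "pos (\<rho> r q)" by (simp add: rho_r b_def B_sym[of q \<gamma>])
      then show False using q r not_pos_and_neg rho_root by blast
    qed
    define \<theta> where "\<theta> = \<rho> (refl_elt q) \<gamma>"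
    define A where "A = 2 * b - 1 / y"
    have \<theta>: "\<theta> \<in> \<Phi>" using q \<gamma> by (simp add: \<theta>_def rho_root)
    have \<theta>_eq': "\<theta> = \<gamma> - (2 * b) *\<^sub>R q" using q by (simp add: \<theta>_def rho_refl b_def)
    have "\<gamma> = (1 / y) *\<^sub>R (y *\<^sub>R \<gamma>)" using y by simp
    also have "y *\<^sub>R \<gamma> = q + x *\<^sub>R \<delta>" by (simp add: q_eq)
    finally have "\<gamma> = (1 / y) *\<^sub>R q + (x / y) *\<^sub>R \<delta>" by (simp add: scaleR_add_right)
    then have \<theta>_eq: "\<theta> = (x / y) *\<^sub>R \<delta> + (- A) *\<^sub>R q"
      unfolding \<theta>_eq' A_def by (simp add: algebra_simps)
    have \<theta>_pos: "pos \<theta>"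
    proof (rule ccontr)
      assume "\<not> pos \<theta>"
      then have neg: "neg \<theta>" using \<theta> pos_or_neg by blast
      have A: "A > 0"
      proof (rule ccontr)
        assume "\<not> A > 0"
        then have "pos \<theta>" unfolding \<theta>_eq using x y q \<delta> by (intro pos_add pos_scale) auto
        then show False using \<open>\<not> pos \<theta>\<close> by simp
      qed
      have "pos ((x / y) *\<^sub>R \<rho> r \<delta> + A *\<^sub>R - \<rho> r q)"
        using x y A q r\<delta> by (intro pos_add pos_scale) auto
      then have "neg (\<rho> r (- \<theta>))" using r by (simp add: \<theta>_eq rho_simps)
      then have "- \<theta> \<in> N r" using neg \<theta> minus_root by (simp add: in_N_r)
      moreover have "- \<theta> = v (A * x + x / y, A * y)"
        unfolding \<theta>_eq q_eq v_def by (simp add: algebra_simps)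
      ultimately have "(A * x + x / y, A * y) \<in> F" using x y A by (simp add: F_def add_pos_pos)
      then have "(A * x + x / y) / (A * y) \<le> x / y" using max by (fastforce simp: x_def y_def)
      moreover have "(A * x + x / y) / (A * y) = x / y + x / (A * y * y)"
        using A x y by (simp add: field_simps)
      moreover have "x / (A * y * y) > 0" using A x y by simp
      ultimately show False by linarith
    qed
    have "dp \<delta> \<le> dp \<theta>"
    proof (cases "\<theta> = \<delta>")
      case False
      have \<theta>P: "\<theta> \<in> P"
        unfolding \<theta>_eq using P qP \<delta>P by (intro subspace_add subspace_scale)
      have pos1: "pos (\<rho> (refl_elt \<delta>) \<theta>)" using \<delta>_pos \<theta> \<theta>_pos \<theta>P False by blast
      have posq: "pos (\<rho> (refl_elt \<delta>) q)" using \<delta>_pos q qP q\<delta> by blast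
      have A: "A < 0"
      proof (rule ccontr)
        assume "\<not> A < 0"
        then have "pos (\<rho> (refl_elt \<delta>) \<theta> + A *\<^sub>R \<rho> (refl_elt \<delta>) q)"
          using pos1 posq by (intro pos_add pos_scale) auto
        then have "pos (\<rho> (refl_elt \<delta>) (\<theta> + A *\<^sub>R q))" using \<delta> by (simp add: rho_simps)
        also have "\<theta> + A *\<^sub>R q = (x / y) *\<^sub>R \<delta>" by (simp add: \<theta>_eq)
        finally have "pos ((x / y) *\<^sub>R - \<delta>)" using \<delta> by (simp add: rho_simps rho_refl_self)
        moreover have "y / x \<ge> 0" using x y by simp
        ultimately have "pos ((y / x) *\<^sub>R ((x / y) *\<^sub>R - \<delta>))" by (rule pos_scale[rotated])
        moreover have "(y / x) *\<^sub>R ((x / y) *\<^sub>R - \<delta>) = - \<delta>" using x y by simp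
        ultimately have "neg \<delta>" by (simp only:)
        then show False using \<delta> not_pos_and_neg by blast
      qed
      have "B q \<theta> = - b" using q B_root[of q] by (simp add: \<theta>_eq' B_simps b_def)
      moreover have "B \<theta> ((x / y) *\<^sub>R \<delta> + (- A) *\<^sub>R q) = 1"
        using B_root[OF \<theta>] by (simp only: \<theta>_eq[symmetric])
      ultimately have "(x / y) * B \<delta> \<theta> + A * b = 1"
        by (simp add: B_simps B_sym[of \<theta>])
      moreover have "A * b < 0" using A b by (simp add: mult_neg_pos)
      ultimately have "(x / y) * B \<delta> \<theta> > 0" by linarith
      then have "B \<delta> \<theta> > 0" using x y by (simp add: zero_less_mult_iff zero_less_divide_iff)
      then show ?thesis using dp_le_of_B_pos \<delta> \<theta> \<theta>_pos pos1 by blast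
    qed simp
    also have "dp \<theta> \<le> dp (\<rho> (refl_elt q) \<theta>)"
      using \<theta> \<theta>_pos q b B_root[of q]
      by (intro dp_le_dp_refl) (auto simp: \<theta>_eq' B_simps b_def)
    also have "\<rho> (refl_elt q) \<theta> = \<gamma>" using q by (simp add: \<theta>_def rho_refl_twice)
    finally show ?thesis .
  qed
qed

lemma subgroup_roots_plane:
  assumes P: "subspace P"
  shows "subgroup_roots (generate G (refl_elt ` (P \<inter> \<Phi>))) = P \<inter> \<Phi>"
proof (intro equalityI subsetI)
  fix \<beta> assume \<beta>: "\<beta> \<in> subgroup_roots (generate G (refl_elt ` (P \<inter> \<Phi>)))"
  have *: "w \<in> carrier G \<and> (\<forall>v. \<rho> w v - v \<in> P)" if "w \<in> generate G (refl_elt ` (P \<inter> \<Phi>))" for w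
    using that
  proof (induction rule: generate.induct)
    case one
    then show ?case using P by (simp add: subspace_0)
  next
    case (incl h)
    then obtain \<gamma> where "\<gamma> \<in> P" "\<gamma> \<in> \<Phi>" "h = refl_elt \<gamma>" by blast
    then show ?case using P by (simp add: rho_refl subspace_scale subspace_neg)
  next
    case (inv h)
    then obtain \<gamma> where "\<gamma> \<in> P" "\<gamma> \<in> \<Phi>" "h = refl_elt \<gamma>" by blast
    then show ?case using P by (simp add: rho_refl refl_inv subspace_scale subspace_neg)
  next
    case (eng h1 h2)
    have "\<rho> h1 (\<rho> h2 v) - v \<in> P" for v
      using subspace_add[OF P, of "\<rho> h1 (\<rho> h2 v) - \<rho> h2 v" "\<rho> h2 v - v"] eng.IH by simp
    then show ?case using eng.IH by (simp add: rho_mult)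
  qed
  have "\<beta> \<in> \<Phi>" "refl_elt \<beta> \<in> generate G (refl_elt ` (P \<inter> \<Phi>))"
    using \<beta> by (auto simp: subgroup_roots_def)
  then have "- \<beta> - \<beta> \<in> P" using *[of "refl_elt \<beta>"] rho_refl_self[of \<beta>] by metis
  then have "(- 1 / 2) *\<^sub>R (- \<beta> - \<beta>) \<in> P" using P by (intro subspace_scale)
  also have "(- 1 / 2) *\<^sub>R (- \<beta> - \<beta>) = \<beta>"
    by (simp add: algebra_simps flip: scaleR_add_left)
  finally show "\<beta> \<in> P \<inter> \<Phi>" using \<open>\<beta> \<in> \<Phi>\<close> by simp
qed (auto simp: subgroup_roots_def intro: generate.incl)

theorem bipodal_small_roots: "bipodal (small_roots n)"
  unfolding bipodal_def
proof (intro conjI allI impI)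
  show "small_roots n \<subseteq> \<Phi>\<^sup>+" by (auto simp: small_roots_def)
next
  fix W' assume "maximal_dihedral W'"
  then obtain P where P: "subspace P" "dim P = 2" and W': "W' = generate G (refl_elt ` (P \<inter> \<Phi>))"
    by (auto simp: maximal_dihedral_def)
  have roots: "subgroup_roots W' = P \<inter> \<Phi>" using subgroup_roots_plane P W' by simp
  assume "small_roots n \<inter> (subgroup_roots W' \<inter> \<Phi>\<^sup>+ - canonical_simple_system W') \<noteq> {}"
  then obtain \<gamma> where \<gamma>: "\<gamma> \<in> small_roots n" "\<gamma> \<in> P" and nonsimple: "\<gamma> \<notin> canonical_simple_system W'"
    by (auto simp: roots)
  have \<gamma>': "\<gamma> \<in> \<Phi>" "pos \<gamma>" "dp \<gamma> \<le> n" using \<gamma> by (auto simp: small_roots_iff)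
  have "N (refl_elt \<gamma>) \<inter> (P \<inter> \<Phi>) \<noteq> {\<gamma>}"
    using nonsimple \<gamma>' by (auto simp: canonical_simple_system_def pos_roots_iff roots)
  then obtain \<kappa> where "\<kappa> \<in> N (refl_elt \<gamma>)" "\<kappa> \<in> P" "\<kappa> \<noteq> \<gamma>"
    using self_in_N_refl[of \<gamma>] \<gamma> \<gamma>' by blast
  note le = dp_le_in_plane[OF P _ _ _ \<gamma>'(1,2) \<gamma>(2) this]
  show "canonical_simple_system W' \<subseteq> small_roots n"
  proof
    fix \<delta> assume "\<delta> \<in> canonical_simple_system W'"
    then have \<delta>: "\<delta> \<in> \<Phi>" "pos \<delta>" "N (refl_elt \<delta>) \<inter> (P \<inter> \<Phi>) = {\<delta>}"
      by (auto simp: canonical_simple_system_def pos_roots_iff roots)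
    moreover have "N (refl_elt \<delta>) \<inter> (P \<inter> \<Phi>) = N (refl_elt \<delta>) \<inter> P"
      using N_root \<delta>(1) refl_closed by blast
    ultimately have "dp \<delta> \<le> dp \<gamma>" using le by metis
    then show "\<delta> \<in> small_roots n" using \<delta> \<gamma>' by (simp add: small_roots_iff)
  qed
qed

section \<open>Finiteness of the set of small roots\<close>

lemma dp_le_dp_S_of_B_le_0:
  assumes "\<gamma> \<in> \<Phi>" "pos \<gamma>" "t \<in> S" "B (\<alpha> t) \<gamma> \<le> 0"
  shows "dp \<gamma> \<le> dp (\<rho> t \<gamma>)"
  using dp_le_dp_refl[of \<gamma> "\<alpha> t"] assms alpha_root by (simp add: refl_alpha)

text \<open>
  The covering relation of the root poset, on small roots.
\<close>

definition up :: "nat \<Rightarrow> ('v \<times> 'v) set" where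
  "up n = {(\<gamma>, \<rho> t \<gamma>) |\<gamma> t. \<gamma> \<in> small_roots n \<and> \<rho> t \<gamma> \<in> small_roots n \<and> t \<in> S \<and> B (\<alpha> t) \<gamma> < 0}"

text \<open>
  Going down from a small root in the root poset does not leave the set of small roots, as depth does
  not increase.
\<close>

lemma small_root_reachable:
  assumes "\<gamma> \<in> small_roots n"
  shows "\<exists>s\<in>S. (\<alpha> s, \<gamma>) \<in> (up n)\<^sup>*"
  using assms
proof (induction "len (refl_elt \<gamma>)" arbitrary: \<gamma> rule: less_induct)
  case (less \<gamma>)
  have \<gamma>: "\<gamma> \<in> \<Phi>" "pos \<gamma>" "dp \<gamma> \<le> n" using less.prems by (auto simp: small_roots_iff)
  obtain t where t: "t \<in> S" "B (\<alpha> t) \<gamma> > 0" using ex_descent \<gamma> by blast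
  show ?case
  proof (cases "\<gamma> = \<alpha> t")
    case False
    define \<delta> where "\<delta> = \<rho> t \<gamma>"
    have \<delta>: "\<delta> \<in> \<Phi>" "pos \<delta>" "len (refl_elt \<delta>) < len (refl_elt \<gamma>)"
      using False t \<gamma> S_permutes_pos len_refl_descent by (auto simp: \<delta>_def rho_root)
    have eq: "\<gamma> = \<rho> t \<delta>" using t by (simp add: \<delta>_def rho_S_twice)
    have B: "B (\<alpha> t) \<delta> < 0" using t by (simp add: \<delta>_def rho_S B_simps)
    then have "dp \<delta> \<le> dp \<gamma>" using dp_le_dp_S_of_B_le_0[of \<delta> t] \<delta> t eq by simp
    then have "\<delta> \<in> small_roots n" using \<delta> \<gamma> by (simp add: small_roots_iff)
    moreover from this have "(\<delta>, \<gamma>) \<in> up n" using less.prems t B eq unfolding up_def by blast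
    ultimately show ?thesis using less.hyps[of \<delta>] \<delta> by (meson rtrancl.rtrancl_into_rtrancl)
  qed (use t in blast)
qed

text \<open>
  In an infinite ascending chain of small roots, the depth is eventually constant, so from then on
  every step adds a simple root \<open>\<alpha> t\<close> with \<open>B (\<alpha> t) \<gamma> = -1/2\<close>. For the \<open>t\<close> that are used infinitely often the
  values \<open>B (\<alpha> t) \<gamma>\<close> finally stay in \<open>{0, 1/2, -1/2}\<close>, since a value \<open>\<le> -1\<close> would never increase again.
  Hence they all agree for two members of the chain. Their difference \<open>v\<close> is then in the radical of the
  form on the span of the \<open>\<alpha> t\<close>, the product of the two members is \<open>1\<close>, and one of them dominates the
  other, although their depths are equal.
\<close>

lemma no_infinite_chain:
  assumes chain: "\<And>k. (g k, g (Suc k)) \<in> up n"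
  shows False
proof -
  have g: "g k \<in> \<Phi>" "pos (g k)" "dp (g k) \<le> n" for k
    using chain[of k] by (auto simp: up_def small_roots_iff)
  have "\<exists>t\<in>S. B (\<alpha> t) (g k) < 0 \<and> g (Suc k) = \<rho> t (g k)" for k
    using chain[of k] by (auto simp: up_def)
  then obtain \<tau> where \<tau>: "\<And>k. \<tau> k \<in> S" "\<And>k. B (\<alpha> (\<tau> k)) (g k) < 0" "\<And>k. g (Suc k) = \<rho> (\<tau> k) (g k)"
    by metis
  have "dp (g k) \<le> dp (g (Suc k))" for k
    using dp_le_dp_S_of_B_le_0[of "g k" "\<tau> k"] g \<tau> by (simp add: less_imp_le)
  then have mono: "dp (g k) \<le> dp (g l)" if "k \<le> l" for k l
    using that by (rule lift_Suc_mono_le)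
  obtain K where "\<And>k. dp (g k) \<le> dp (g K)"
    using ex_has_greatest_nat[of "\<lambda>_. True" 0 "\<lambda>k. dp (g k)" "Suc n"] g(3)
    by (metis le_imp_less_Suc)
  then have const: "dp (g k) = dp (g K)" if "k \<ge> K" for k using mono[OF that] by (simp add: le_antisym)
  have step: "B (\<alpha> (\<tau> k)) (g k) = -1/2" if "k \<ge> K" for k
  proof -
    have "\<not> B (\<alpha> (\<tau> k)) (g k) \<le> -1"
      using dp_less_dp_S[of "g k" "\<tau> k"] g \<tau> const[of k] const[of "Suc k"] that by force
    then show ?thesis using B_root_neg_cases \<tau> g alpha_root by blast
  qed
  have g_Suc: "g (Suc k) = g k + \<alpha> (\<tau> k)" if "k \<ge> K" for k
    using step[OF that] \<tau> by (simp add: rho_S)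
  define f where "f t k = B (\<alpha> t) (g k)" for t k
  have f_Suc: "f t (Suc k) = f t k + B (\<alpha> t) (\<alpha> (\<tau> k))" if "k \<ge> K" for t k
    using g_Suc[OF that] by (simp add: f_def B_simps)
  have f_dec: "f t (Suc k) \<le> f t k" if "k \<ge> K" "t \<in> S" "\<tau> k \<noteq> t" for t k
    using f_Suc[OF that(1)] B_alpha_le_0[of t "\<tau> k"] that \<tau> by simp
  have f_use: "f t k = -1/2" "f t (Suc k) = 1/2" if "k \<ge> K" "\<tau> k = t" for t k
    using step[OF that(1)] f_Suc[OF that(1), of t] that \<tau>(1)[of k] by (auto simp: f_def)
  define T where "T = {t\<in>S. \<not> (\<forall>\<^sub>F k in sequentially. \<tau> k \<noteq> t)}"
  have T_often: "\<exists>k\<ge>m. \<tau> k = t" if "t \<in> T" for t m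
    using that unfolding T_def eventually_sequentially by blast
  have vals: "\<forall>\<^sub>F k in sequentially. f t k \<in> {0, 1/2, -1/2}" if t: "t \<in> T" for t
  proof -
    have tS: "t \<in> S" using t by (simp add: T_def)
    obtain k0 where k0: "k0 \<ge> K" "\<tau> k0 = t" using T_often t by blast
    have upper: "f t k \<le> 1/2" if "k \<ge> Suc k0" for k
      using that
    proof (induction k rule: dec_induct)
      case base
      then show ?case using f_use k0 by simp
    next
      case (step k)
      then show ?case
        using f_dec[of k t] f_use[of k t] k0 tS by (cases "\<tau> k = t") auto
    qed
    have lower: "f t k > -1" if "k \<ge> K" for k
    proof (rule ccontr)
      assume low: "\<not> f t k > -1"
      have "f t j \<le> -1" if "j \<ge> k" for j
        using that
      proof (induction j rule: dec_induct)
        case base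
        then show ?case using low by simp
      next
        case (step j)
        then show ?case
          using f_dec[of j t] f_use[of j t] \<open>k \<ge> K\<close> tS by (cases "\<tau> j = t") auto
      qed
      moreover obtain j where "j \<ge> k" "\<tau> j = t" using T_often t by blast
      ultimately show False using f_use[of j t] \<open>k \<ge> K\<close> by force
    qed
    have "f t k \<in> {0, 1/2, -1/2}" if "k \<ge> Suc k0" for k
      using B_root_values[of "\<alpha> t" "g k"] upper[OF that] lower[of k] that k0 tS g alpha_root
      by (simp add: f_def)
    then show ?thesis unfolding eventually_sequentially by blast
  qed
  have "\<forall>\<^sub>F k in sequentially. if t \<in> T then f t k \<in> {0, 1/2, -1/2} else \<tau> k \<noteq> t" if "t \<in> S" for t
    using vals that by (cases "t \<in> T") (auto simp: T_def)
  then have "\<forall>\<^sub>F k in sequentially. \<forall>t\<in>S. if t \<in> T then f t k \<in> {0, 1/2, -1/2} else \<tau> k \<noteq> t"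
    using finite_S by (intro eventually_ball_finite) auto
  then obtain M' where M': "\<And>k t. k \<ge> M' \<Longrightarrow> t \<in> S \<Longrightarrow> if t \<in> T then f t k \<in> {0, 1/2, -1/2} else \<tau> k \<noteq> t"
    unfolding eventually_sequentially by blast
  define M where "M = max K M'"
  have M: "\<tau> k \<in> T" "t \<in> T \<Longrightarrow> f t k \<in> {0, 1/2, -1/2}" "k \<ge> K" if "k \<ge> M" for k t
  proof -
    show "\<tau> k \<in> T" using M'[of k "\<tau> k"] \<tau>(1)[of k] that by (auto simp: M_def split: if_splits)
    show "f t k \<in> {0, 1/2, -1/2}" if "t \<in> T"
      using M'[of k t] that \<open>k \<ge> M\<close> by (auto simp: M_def T_def)
    show "k \<ge> K" using that by (simp add: M_def)
  qed
  define h where "h k = restrict (\<lambda>t. f t (M + k)) T" for k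
  have "h k \<in> T \<rightarrow>\<^sub>E {0, 1/2, -1/2}" for k
    unfolding h_def restrict_PiE_iff using M(2)[of "M + k"] by simp
  then have "range h \<subseteq> T \<rightarrow>\<^sub>E {0, 1/2, -1/2}" by blast
  moreover have "finite (T \<rightarrow>\<^sub>E {0, 1/2, -1/2 :: real})"
    using finite_S by (intro finite_PiE) (auto simp: T_def)
  ultimately have "\<not> inj h" by (meson finite_subset range_inj_infinite)
  then obtain k' l' where "h k' = h l'" "k' < l'" by (metis injI nat_neq_iff)
  define k l where "k = M + k'" and "l = M + l'"
  have kl: "k < l" "k \<ge> M" using \<open>k' < l'\<close> by (auto simp: k_def l_def)
  have same: "f t k = f t l" if "t \<in> T" for t
    using fun_cong[OF \<open>h k' = h l'\<close>, of t] that by (simp add: h_def k_def l_def)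
  have sum: "g j = g k + (\<Sum>i=k..<j. \<alpha> (\<tau> i))" if "j \<ge> k" for j
    using that
  proof (induction j rule: dec_induct)
    case (step j)
    then show ?case using g_Suc[of j] M(3)[of j] kl by (simp add: add.assoc)
  qed simp
  define v where "v = g l - g k"
  have v: "v = (\<Sum>i=k..<l. \<alpha> (\<tau> i))" using sum[of l] kl by (simp add: v_def)
  have "B v (\<alpha> (\<tau> i)) = 0" if "i \<ge> k" for i
    using same[of "\<tau> i"] M(1)[of i] that kl B_sym[of v "\<alpha> (\<tau> i)"]
    by (simp add: v_def f_def B_simps)
  then have "B v (\<Sum>i=k..<l. \<alpha> (\<tau> i)) = 0"
    unfolding B_sum_right by (intro sum.neutral) auto
  then have vv: "B v v = 0" by (simp flip: v)
  have "B (g k + v) (g k + v) = 1" using B_root[OF g(1)[of l]] by (simp add: v_def)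
  then have "B (g k) v = 0" using vv B_root[OF g(1)[of k]] B_sym[of v "g k"] by (simp add: B_simps)
  then have "B (g k) (g l) \<ge> 1" using B_root[OF g(1)[of k]] by (simp add: v_def B_simps)
  then have "dom (g k) (g l) \<or> dom (g l) (g k)" using dom_or_dom g by blast
  moreover have "g k \<noteq> g l"
  proof
    assume "g k = g l"
    then have "\<alpha> (\<tau> k) + (\<Sum>i=Suc k..<l. \<alpha> (\<tau> i)) = 0"
      using v kl by (simp add: v_def sum.atLeast_Suc_lessThan)
    then have "- \<alpha> (\<tau> k) = (\<Sum>i=Suc k..<l. \<alpha> (\<tau> i))" by (simp add: neg_eq_iff_add_eq_0)
    then have "neg (\<alpha> (\<tau> k))" using \<tau> by (simp add: pos_sum)
    then show False using not_neg_alpha \<tau>(1) by blast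
  qed
  ultimately have "dp (g k) \<noteq> dp (g l)" using dp_less[of "g k" "g l"] dp_less[of "g l" "g k"] g by auto
  then show False using const M(3) kl by (metis less_imp_le le_trans)
qed

theorem finite_small_roots: "finite (small_roots n)"
proof (rule ccontr)
  assume inf: "infinite (small_roots n)"
  define desc where "desc \<gamma> = {\<gamma>'. (\<gamma>, \<gamma>') \<in> (up n)\<^sup>*}" for \<gamma>
  have "small_roots n \<subseteq> (\<Union>s\<in>S. desc (\<alpha> s))"
    using small_root_reachable by (auto simp: desc_def)
  then have "infinite (\<Union>s\<in>S. desc (\<alpha> s))" using inf finite_subset by blast
  then obtain s where s: "infinite (desc (\<alpha> s))" using finite_S by blast
  have next_inf: "\<exists>\<gamma>'. infinite (desc \<gamma>') \<and> (\<gamma>, \<gamma>') \<in> up n" if "infinite (desc \<gamma>)" for \<gamma>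
  proof (rule ccontr)
    assume no: "\<not> (\<exists>\<gamma>'. infinite (desc \<gamma>') \<and> (\<gamma>, \<gamma>') \<in> up n)"
    define Nx where "Nx = {\<gamma>'. (\<gamma>, \<gamma>') \<in> up n}"
    have "Nx \<subseteq> (\<lambda>t. \<rho> t \<gamma>) ` S" by (auto simp: Nx_def up_def)
    then have "finite Nx" using finite_S finite_subset by blast
    then have "finite (\<Union>\<gamma>'\<in>Nx. desc \<gamma>')" using no by (auto simp: Nx_def)
    moreover have "desc \<gamma> \<subseteq> insert \<gamma> (\<Union>\<gamma>'\<in>Nx. desc \<gamma>')"
      by (auto simp: desc_def Nx_def elim: converse_rtranclE)
    ultimately show False using that finite_subset by blast
  qed
  have "\<exists>g. \<forall>k. infinite (desc (g k)) \<and> (g k, g (Suc k)) \<in> up n"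
    using dependent_nat_choice[of "\<lambda>_ \<gamma>. infinite (desc \<gamma>)" "\<lambda>_ \<gamma> \<gamma>'. (\<gamma>, \<gamma>') \<in> up n"] s next_inf
    by blast
  then show False using no_infinite_chain by blast
qed

lemma finite_low_elements: "finite (low_elements n)"
proof (rule inj_on_finite)
  show "inj_on N (low_elements n)" using N_inj by (auto simp: low_elements_def intro: inj_onI)
  show "N ` low_elements n \<subseteq> root_cone ` Pow (small_roots n)" by (auto simp: low_elements_def)
  show "finite (root_cone ` Pow (small_roots n))" using finite_small_roots by simp
qed

section \<open>Joins\<close>

lemma root_cone_mono: "A \<subseteq> C \<Longrightarrow> root_cone A \<subseteq> root_cone C"
  unfolding root_cone_def using hull_mono[of A C convex_cone] by blast

lemma subset_root_cone: "A \<subseteq> \<Phi> \<Longrightarrow> A \<subseteq> root_cone A"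
  unfolding root_cone_def using hull_subset[of A convex_cone] by blast

lemma root_cone_subset: "A \<subseteq> convex_cone hull C \<Longrightarrow> root_cone A \<subseteq> root_cone C"
  unfolding root_cone_def
  using hull_minimal[of A "convex_cone hull C" convex_cone] convex_cone_convex_cone_hull[of C] by blast

lemma root_cone_subset_N:
  assumes "w \<in> carrier G" "A \<subseteq> N w"
  shows "root_cone A \<subseteq> N w"
proof -
  define C where "C = {x. pos x \<and> neg (\<rho> (inv w) x)}"
  have "convex_cone C"
    unfolding convex_cone_iff C_def
    using assms(1) pos_add neg_add pos_scale neg_scale by (simp add: rho_simps del: minus_add_distrib)
  moreover have "A \<subseteq> C" using assms by (auto simp: C_def in_N_iff)
  ultimately have "convex_cone hull A \<subseteq> C" by (simp add: hull_minimal)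
  then show ?thesis using assms(1) by (auto simp: root_cone_def C_def in_N_iff)
qed

lemma hull_rho_image:
  assumes "w \<in> carrier G" "x \<in> convex_cone hull A"
  shows "\<rho> w x \<in> convex_cone hull (\<rho> w ` A)"
  using convex_cone_hull_linear_image[OF rho_linear[OF assms(1)], of A] assms(2) by blast

lemma N_mult_subset_cone:
  assumes s: "s \<in> S" and u: "u \<in> carrier G" "len (s \<otimes> u) = Suc (len u)"
    and NA: "N u \<subseteq> convex_cone hull A" and A: "\<alpha> s \<in> C" "\<rho> s ` A \<subseteq> convex_cone hull C"
  shows "N (s \<otimes> u) \<subseteq> convex_cone hull C"
proof -
  have "\<rho> s ` N u \<subseteq> convex_cone hull (\<rho> s ` A)"
    using NA hull_rho_image[of s _ A] s by (intro image_subsetI) auto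
  also have "\<dots> \<subseteq> convex_cone hull C"
    using A(2) by (simp add: hull_minimal convex_cone_convex_cone_hull)
  finally show ?thesis using N_mult(2)[OF s u] A(1) by (auto intro: hull_inc)
qed

text \<open>
  Inversions of one element have products \<open>> -1\<close>, so an upper bound of \<open>s\<close> and \<open>t\<close> exists only if
  they generate a finite group. The longest element of this group, here \<open>s t\<close> or \<open>s t s\<close>, is their join.
\<close>

lemma rank_two_join:
  assumes st: "s \<in> S" "t \<in> S" "s \<noteq> t" and g: "g \<in> carrier G" "\<alpha> s \<in> N g" "\<alpha> t \<in> N g"
  obtains d where "d \<in> carrier G" "\<alpha> s \<in> N d" "\<alpha> t \<in> N d" "N d \<subseteq> convex_cone hull {\<alpha> s, \<alpha> t}"
  using st
proof (cases rule: label_cases)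
  case two
  have t_s: "\<rho> t (\<alpha> s) = \<alpha> s" "\<rho> s (\<alpha> t) = \<alpha> t"
    using two st B_sym[of "\<alpha> t" "\<alpha> s"] by (simp_all add: rho_S)
  have "pos (\<rho> (inv t) (\<alpha> s))" using t_s st by (simp add: S_inv)
  then have "len (s \<otimes> t) = Suc (len t)" using left_ascent_iff st by simp
  then have st': "N (s \<otimes> t) = insert (\<alpha> s) (\<rho> s ` N t)" using N_mult st by simp
  then have "N (s \<otimes> t) = {\<alpha> s, \<alpha> t}" using t_s st N_S by simp
  then show ?thesis using that[of "s \<otimes> t"] st hull_subset[of "{\<alpha> s, \<alpha> t}" convex_cone] by simp
next
  case three
  have t_s: "\<rho> t (\<alpha> s) = \<alpha> s + \<alpha> t" "\<rho> s (\<alpha> t) = \<alpha> s + \<alpha> t"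
    using three st B_sym[of "\<alpha> t" "\<alpha> s"] by (simp_all add: rho_S)
  have s_st: "\<rho> s (\<alpha> s + \<alpha> t) = \<alpha> t" using st t_s by (simp add: rho_simps rho_S_alpha)
  have "pos (\<rho> (inv s) (\<alpha> t))" using t_s st pos_add by (simp add: S_inv)
  then have "len (t \<otimes> s) = Suc (len s)" using left_ascent_iff st by simp
  then have Nts: "N (t \<otimes> s) = {\<alpha> t, \<alpha> s + \<alpha> t}" using N_mult(2)[of t s] st N_S t_s by simp
  have "pos (\<rho> (inv (t \<otimes> s)) (\<alpha> s))"
    using st t_s s_st by (simp add: inv_mult_group S_inv rho_mult)
  then have "len (s \<otimes> (t \<otimes> s)) = Suc (len (t \<otimes> s))" using left_ascent_iff st by simp
  then have "N (s \<otimes> (t \<otimes> s)) = {\<alpha> s, \<alpha> s + \<alpha> t, \<alpha> t}"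
    using N_mult(2)[of s "t \<otimes> s"] st Nts t_s s_st by simp
  moreover have "\<alpha> s + \<alpha> t \<in> convex_cone hull {\<alpha> s, \<alpha> t}"
    using convex_cone_convex_cone_hull[of "{\<alpha> s, \<alpha> t}"] by (auto simp: convex_cone_iff intro: hull_inc)
  ultimately show ?thesis using that[of "s \<otimes> (t \<otimes> s)"] st by (simp add: hull_inc)
next
  case inf
  then show ?thesis using B_inversions_gt[OF g] by simp
qed

text \<open>
  Induction on the length of the upper bound \<open>g\<close>. A letter with which both elements begin is removed. If \<open>x\<close> begins with \<open>s\<close> and \<open>y\<close> with \<open>t\<close>, each is first joined with
  the longest element of the subgroup of \<open>s\<close> and \<open>t\<close>, which begins with either letter.
\<close>

lemma ex_join:
  assumes "g \<in> carrier G" "x \<in> carrier G" "y \<in> carrier G" "N x \<subseteq> N g" "N y \<subseteq> N g"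
  shows "\<exists>w\<in>carrier G. N w = root_cone (N x \<union> N y)"
  using assms
proof (induction "len g" arbitrary: g x y rule: less_induct)
  case (less g x y)
  note g = less.prems(1)
  have roots: "N u \<subseteq> \<Phi>" if "u \<in> carrier G" for u using N_root that by blast
  have idem: "root_cone (N u) = N u" if "u \<in> carrier G" for u
    using root_cone_subset_N[of u "N u"] subset_root_cone[OF roots[OF that]] that by blast
  have same: "\<exists>w\<in>carrier G. N w = root_cone (N u \<union> N v)"
    if uv: "u \<in> carrier G" "v \<in> carrier G" "N u \<subseteq> N g" "N v \<subseteq> N g"
      and s: "s \<in> S" "\<alpha> s \<in> N u" "\<alpha> s \<in> N v" for u v s
  proof -
    have split: "s \<otimes> z \<in> carrier G \<and> s \<otimes> (s \<otimes> z) = z \<and> len z = Suc (len (s \<otimes> z)) \<and>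
        N z = insert (\<alpha> s) (\<rho> s ` N (s \<otimes> z)) \<and> \<alpha> s \<notin> N (s \<otimes> z)"
      if "z \<in> carrier G" "\<alpha> s \<in> N z" for z
      using that s(1) N_mult[of s "s \<otimes> z"] by (simp add: alpha_in_N_iff S_cancel)
    define u' v' g' where "u' = s \<otimes> u" and "v' = s \<otimes> v" and "g' = s \<otimes> g"
    have u': "u' \<in> carrier G" "N u = insert (\<alpha> s) (\<rho> s ` N u')" "\<alpha> s \<notin> N u'"
      and v': "v' \<in> carrier G" "N v = insert (\<alpha> s) (\<rho> s ` N v')" "\<alpha> s \<notin> N v'"
      and g': "g' \<in> carrier G" "len g = Suc (len g')" "N g = insert (\<alpha> s) (\<rho> s ` N g')"
      using split[of u] split[of v] split[of g] uv s g unfolding u'_def v'_def g'_def by blast+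
    have "N u' \<subseteq> N g'"
      by (rule N_subset_of_mult[OF s(1) u'(1)]) (use uv(3)[unfolded u'(2) g'(3)] in simp)
    moreover have "N v' \<subseteq> N g'"
      by (rule N_subset_of_mult[OF s(1) v'(1)]) (use uv(4)[unfolded v'(2) g'(3)] in simp)
    ultimately have sub': "N u' \<subseteq> N g'" "N v' \<subseteq> N g'" by blast+
    obtain w' where w': "w' \<in> carrier G" "N w' = root_cone (N u' \<union> N v')"
      using less.hyps[of g' u' v'] g' u' v' sub' by auto
    have "N w' \<subseteq> N g'" using root_cone_subset_N[OF g'(1)] sub' w' by simp
    moreover have "\<alpha> s \<notin> N g'" using split[OF g] s uv unfolding g'_def by blast
    ultimately have asc: "len (s \<otimes> w') = Suc (len w')"
      using alpha_in_N_iff[OF w'(1) s(1)] len_S_mult[OF w'(1) s(1)] by blast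
    define w where "w = s \<otimes> w'"
    have w: "w \<in> carrier G" using w' s by (simp add: w_def)
    have Nw: "N w = insert (\<alpha> s) (\<rho> s ` N w')" using N_mult(2)[OF s(1) w'(1) asc] by (simp add: w_def)
    have "N w \<subseteq> convex_cone hull (N u \<union> N v)"
      unfolding w_def
    proof (rule N_mult_subset_cone[OF s(1) w'(1) asc])
      show "N w' \<subseteq> convex_cone hull (N u' \<union> N v')" using w' by (auto simp: root_cone_def)
      show "\<alpha> s \<in> N u \<union> N v" using s by simp
      show "\<rho> s ` (N u' \<union> N v') \<subseteq> convex_cone hull (N u \<union> N v)"
        using u' v' by (auto intro!: hull_inc)
    qed
    then have "N w \<subseteq> root_cone (N u \<union> N v)" using roots[OF w] by (auto simp: root_cone_def)
    moreover have "N u' \<union> N v' \<subseteq> N w'"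
      unfolding w'(2) using subset_root_cone roots u' v' by (metis Un_least)
    then have "N u \<union> N v \<subseteq> N w" unfolding u'(2) v'(2) Nw by blast
    then have "root_cone (N u \<union> N v) \<subseteq> N w" using root_cone_subset_N[OF w] by blast
    ultimately show ?thesis using w by blast
  qed
  show ?case
  proof (cases "x = \<one> \<or> y = \<one>")
    case True
    then show ?thesis using idem[of x] idem[of y] less.prems by auto
  next
    case False
    obtain s where s: "s \<in> S" "\<alpha> s \<in> N x"
      using ex_left_descent[of x] False less.prems alpha_in_N_iff by metis
    obtain t where t: "t \<in> S" "\<alpha> t \<in> N y"
      using ex_left_descent[of y] False less.prems alpha_in_N_iff by metis
    show ?thesis
    proof (cases "s = t")
      case True
      then show ?thesis using same s t less.prems by blast
    next
      case False
      obtain d where d: "d \<in> carrier G" "\<alpha> s \<in> N d" "\<alpha> t \<in> N d" "N d \<subseteq> convex_cone hull {\<alpha> s, \<alpha> t}"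
        using rank_two_join[OF s(1) t(1) False g] s t less.prems by blast
      have "N d \<subseteq> root_cone {\<alpha> s, \<alpha> t}" using d roots by (auto simp: root_cone_def)
      moreover have "{\<alpha> s, \<alpha> t} \<subseteq> N g" using s t less.prems by blast
      ultimately have dg: "N d \<subseteq> N g" using root_cone_subset_N[OF g] by blast
      obtain x' where x': "x' \<in> carrier G" "N x' = root_cone (N x \<union> N d)"
        using same[of x d s] less.prems d dg s by blast
      obtain y' where y': "y' \<in> carrier G" "N y' = root_cone (N y \<union> N d)"
        using same[of y d t] less.prems d dg t by blast
      have le: "N x \<union> N d \<subseteq> N x'" "N y \<union> N d \<subseteq> N y'"
        unfolding x'(2) y'(2) using subset_root_cone roots less.prems d by (metis Un_least)+
      have "N x' \<subseteq> N g" "N y' \<subseteq> N g"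
        unfolding x'(2) y'(2) using root_cone_subset_N[OF g] less.prems dg by simp_all
      then obtain w where w: "w \<in> carrier G" "N w = root_cone (N x' \<union> N y')"
        using same[of x' y' s] x' y' le d s by blast
      have "{\<alpha> s, \<alpha> t} \<subseteq> N x \<union> N y" using s t by blast
      then have "N d \<subseteq> convex_cone hull (N x \<union> N y)" using d(4) hull_mono by blast
      moreover have "N x \<union> N y \<subseteq> convex_cone hull (N x \<union> N y)" by (rule hull_subset)
      ultimately have "N x' \<subseteq> root_cone (N x \<union> N y)" "N y' \<subseteq> root_cone (N x \<union> N y)"
        unfolding x'(2) y'(2) by (auto intro!: root_cone_subset)
      then have "root_cone (N x' \<union> N y') \<subseteq> root_cone (N x \<union> N y)"
        by (intro root_cone_subset) (auto simp: root_cone_def)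
      moreover have "root_cone (N x \<union> N y) \<subseteq> root_cone (N x' \<union> N y')"
        using le by (intro root_cone_mono) blast
      ultimately show ?thesis using w by blast
    qed
  qed
qed

lemma ex_finite_join:
  assumes g: "g \<in> carrier G" and X: "finite X" "X \<subseteq> carrier G" "\<And>x. x \<in> X \<Longrightarrow> N x \<subseteq> N g"
  shows "\<exists>w\<in>carrier G. N w = root_cone (\<Union>x\<in>X. N x)"
  using X
proof (induction X rule: finite_induct)
  case empty
  have "root_cone {} = {}"
    using root_cone_subset_N[of \<one> "{}"] by simp
  then show ?case by (intro bexI[of _ \<one>]) auto
next
  case (insert x X)
  define U where "U = (\<Union>x\<in>X. N x)"
  obtain u where u: "u \<in> carrier G" "N u = root_cone U"
    using insert by (auto simp: U_def)
  have U: "U \<subseteq> \<Phi>" "U \<subseteq> N g" using insert.prems N_root by (auto simp: U_def)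
  have "N u \<subseteq> N g" unfolding u(2) using root_cone_subset_N[OF g] U by blast
  then obtain w where w: "w \<in> carrier G" "N w = root_cone (N x \<union> N u)"
    using ex_join[OF g, of x u] insert.prems u by auto
  have "root_cone (N x \<union> N u) = root_cone (N x \<union> U)"
  proof
    have "N u \<subseteq> convex_cone hull (N x \<union> U)"
      unfolding u(2) root_cone_def using hull_mono[of U "N x \<union> U" convex_cone] by blast
    moreover have "N x \<subseteq> convex_cone hull (N x \<union> U)" using hull_subset[of "N x \<union> U"] by blast
    ultimately show "root_cone (N x \<union> N u) \<subseteq> root_cone (N x \<union> U)" by (intro root_cone_subset) blast
    show "root_cone (N x \<union> U) \<subseteq> root_cone (N x \<union> N u)"
      unfolding u(2) using subset_root_cone[OF U(1)] by (intro root_cone_mono) blast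
  qed
  then show ?case using w by (auto simp: U_def)
qed

text \<open>
  The small roots that span the inversion sets of the members of \<open>X\<close> span that of the join.
\<close>

lemma join_low:
  assumes X: "X \<subseteq> low_elements n" and bounded: "bounded_above X"
  shows "\<Squnion>\<^bsub>weak_order\<^esub> X \<in> low_elements n"
proof -
  have [simp]: "carrier weak_order = carrier G" "le weak_order = is_prefix"
    by (simp_all add: weak_order_def)
  have XG: "X \<subseteq> carrier G" using X by (auto simp: low_elements_def)
  obtain g where g: "g \<in> carrier G" "\<And>x. x \<in> X \<Longrightarrow> is_prefix x g"
    using bounded by (auto simp: bounded_above_def)
  have Ng: "N x \<subseteq> N g" if "x \<in> X" for x using N_mono g XG that by blast
  have "finite X" using X finite_low_elements finite_subset by blast
  then obtain w where w: "w \<in> carrier G" "N w = root_cone (\<Union>x\<in>X. N x)"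
    using ex_finite_join[OF g(1) _ XG Ng] by blast
  have upper: "N x \<subseteq> N w" if "x \<in> X" for x
  proof -
    have "(\<Union>x\<in>X. N x) \<subseteq> \<Phi>" using N_root XG by blast
    then show ?thesis using subset_root_cone that w by blast
  qed
  have lub: "N w \<subseteq> N u" if "u \<in> carrier G" "\<And>x. x \<in> X \<Longrightarrow> is_prefix x u" for u
    unfolding w(2) using that N_mono XG by (intro root_cone_subset_N) blast+
  have "Upper weak_order X = {u\<in>carrier G. \<forall>x\<in>X. is_prefix x u}"
    using XG by (auto simp: Upper_def)
  then have least_iff: "least weak_order u (Upper weak_order X) \<longleftrightarrow>
      u \<in> carrier G \<and> (\<forall>x\<in>X. is_prefix x u) \<and>
      (\<forall>v\<in>carrier G. (\<forall>x\<in>X. is_prefix x v) \<longrightarrow> is_prefix u v)" for u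
    by (auto simp: least_def)
  have "least weak_order w (Upper weak_order X)"
    unfolding least_iff
  proof (intro conjI ballI impI)
    show "is_prefix x w" if "x \<in> X" for x using prefix_of_N_subset upper w that XG by blast
    show "is_prefix w v" if "v \<in> carrier G" "\<forall>x\<in>X. is_prefix x v" for v
      using prefix_of_N_subset lub w that by blast
  qed (rule w(1))
  moreover have "u = w" if "least weak_order u (Upper weak_order X)" for u
  proof -
    have u: "u \<in> carrier G" "is_prefix u w" "is_prefix w u"
      using that calculation unfolding least_iff by blast+
    then have "N u = N w" using N_mono w(1) by blast
    then show ?thesis using N_inj u w by blast
  qed
  ultimately have sup: "\<Squnion>\<^bsub>weak_order\<^esub> X = w"
    unfolding sup_def by (rule some_equality)
  have "\<forall>x\<in>X. \<exists>A. A \<subseteq> small_roots n \<and> N x = root_cone A" using X by (auto simp: low_elements_def)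
  then obtain A where A: "\<And>x. x \<in> X \<Longrightarrow> A x \<subseteq> small_roots n" "\<And>x. x \<in> X \<Longrightarrow> N x = root_cone (A x)"
    by metis
  have "N w = root_cone (\<Union>x\<in>X. A x)"
  proof
    show "N w \<subseteq> root_cone (\<Union>x\<in>X. A x)"
      unfolding w(2)
    proof (intro root_cone_subset UN_least)
      fix x assume x: "x \<in> X"
      have "convex_cone hull A x \<subseteq> convex_cone hull (\<Union>x\<in>X. A x)" using x by (intro hull_mono) blast
      then show "N x \<subseteq> convex_cone hull (\<Union>x\<in>X. A x)" using A(2)[OF x] by (auto simp: root_cone_def)
    qed
    have "A x \<subseteq> N x" if "x \<in> X" for x
      unfolding A(2)[OF that] using A(1)[OF that] by (intro subset_root_cone) (auto simp: small_roots_iff)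
    then show "root_cone (\<Union>x\<in>X. A x) \<subseteq> N w" using upper by (intro root_cone_subset_N[OF w(1)]) blast
  qed
  moreover have "(\<Union>x\<in>X. A x) \<subseteq> small_roots n" using A(1) by blast
  ultimately show ?thesis using w(1) by (auto simp: sup low_elements_def)
qed

section \<open>Extreme inversions and suffixes\<close>

text \<open>
  The inversions that span the extreme rays of the cone of \<open>N w\<close>, described by lengths: their
  reflections take \<open>w\<close> to an element that it covers in the Bruhat order.
\<close>

definition N1 :: "'a \<Rightarrow> 'v set" where
  "N1 w = {\<beta> \<in> N w. len w = Suc (len (refl_elt \<beta> \<otimes> w))}"

lemma inversion_decomposition:
  assumes "w \<in> carrier G" "\<beta> \<in> N w"
  shows "\<exists>x r y. x \<in> carrier G \<and> r \<in> S \<and> y \<in> carrier G \<and> w = x \<otimes> (r \<otimes> y) \<and>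
    \<beta> = \<rho> x (\<alpha> r) \<and> len w = len x + Suc (len y)"
  using assms
proof (induction arbitrary: \<beta> rule: len_induct)
  case one
  then show ?case by simp
next
  case (mult s w \<beta>)
  consider "\<beta> = \<alpha> s" | \<gamma> where "\<gamma> \<in> N w" "\<beta> = \<rho> s \<gamma>"
    using mult.prems N_mult[of s w] mult.hyps by blast
  then show ?case
  proof cases
    case 1
    then show ?thesis using mult.hyps by (intro exI[of _ \<one>] exI[of _ s] exI[of _ w]) simp
  next
    case 2
    then obtain x r y where xry: "x \<in> carrier G" "r \<in> S" "y \<in> carrier G" "w = x \<otimes> (r \<otimes> y)"
      "\<gamma> = \<rho> x (\<alpha> r)" "len w = len x + Suc (len y)"
      using mult.IH by blast
    have eq: "s \<otimes> w = s \<otimes> x \<otimes> (r \<otimes> y)" using xry mult.hyps by (simp add: m_assoc)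
    have "len (s \<otimes> w) \<le> len (s \<otimes> x) + len (r \<otimes> y)" "len (r \<otimes> y) \<le> Suc (len y)"
      "len (s \<otimes> x) \<le> Suc (len x)"
      using len_mult_le[of "s \<otimes> x" "r \<otimes> y"] len_S_mult[of y r] len_S_mult[of x s] xry mult.hyps
      unfolding eq by auto
    then have "len (s \<otimes> w) = len (s \<otimes> x) + Suc (len y)" using mult.hyps xry by linarith
    moreover have "\<beta> = \<rho> (s \<otimes> x) (\<alpha> r)" using 2 xry mult.hyps by (simp add: rho_mult)
    ultimately show ?thesis using xry mult.hyps eq by (metis S_closed m_closed)
  qed
qed

lemma refl_mult_deletes:
  assumes "x \<in> carrier G" "r \<in> S" "y \<in> carrier G"
  shows "refl_elt (\<rho> x (\<alpha> r)) \<otimes> (x \<otimes> (r \<otimes> y)) = x \<otimes> y"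
proof -
  have "inv x \<otimes> (x \<otimes> z) = z" if "z \<in> carrier G" for z
    using assms(1) that by (simp flip: m_assoc)
  then show ?thesis
    using assms alpha_root by (simp add: refl_rho refl_alpha m_assoc S_cancel)
qed

lemma reduced_iff_N_subset:
  assumes "x \<in> carrier G" "y \<in> carrier G"
  shows "len (x \<otimes> y) = len x + len y \<longleftrightarrow> N x \<subseteq> N (x \<otimes> y)"
proof
  assume "len (x \<otimes> y) = len x + len y"
  then show "N x \<subseteq> N (x \<otimes> y)" using assms by (intro N_mono) (auto simp: is_prefix_def)
next
  assume "N x \<subseteq> N (x \<otimes> y)"
  then obtain v where "v \<in> carrier G" "x \<otimes> y = x \<otimes> v" "len (x \<otimes> y) = len x + len v"
    using prefix_of_N_subset[of x "x \<otimes> y"] assms by (auto simp: is_prefix_def)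
  then show "len (x \<otimes> y) = len x + len y" using assms by simp
qed

lemma rho_in_N:
  assumes "x \<in> carrier G" "v \<in> carrier G" "N x \<subseteq> N v" and \<eta>: "\<eta> \<in> \<Phi>" "pos \<eta>"
    and neg: "neg (\<rho> (inv v) (\<rho> x \<eta>))"
  shows "\<rho> x \<eta> \<in> N v"
proof -
  have root: "\<rho> x \<eta> \<in> \<Phi>" using assms by (simp add: rho_root)
  have "pos (\<rho> x \<eta>)"
  proof (rule ccontr)
    assume "\<not> pos (\<rho> x \<eta>)"
    then have "neg (\<rho> x \<eta>)" using root pos_or_neg by blast
    then have "- \<rho> x \<eta> \<in> N x" using \<eta> root assms(1) by (simp add: in_N_iff minus_root rho_simps)
    then have "neg (\<rho> (inv v) (- \<rho> x \<eta>))" using assms(2,3) N_neg by blast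
    then have "pos (\<rho> (inv v) (\<rho> x \<eta>))" using assms(2) by (simp add: rho_simps)
    then show False using neg rho_not_pos_and_neg[of "inv v"] root assms(2) by simp
  qed
  then show ?thesis using root neg assms(2) by (simp add: in_N_iff)
qed

text \<open>
  Write \<open>w = x r y\<close> with \<open>\<beta> = x(\<alpha> r)\<close>, so that the reflection in \<open>\<beta>\<close> takes \<open>w\<close> to \<open>x y\<close>. If this product
  is not reduced, some hyperplane separates twice: a root \<open>\<kappa> = - x(\<gamma>)\<close> is inverted by \<open>x\<close>
  but not by \<open>x y\<close>. Then \<open>\<kappa>\<close> and \<open>x r(\<gamma>)\<close> are inversions of \<open>w\<close> with \<open>\<beta>\<close> between them.
\<close>

lemma inversion_between:
  assumes w: "w \<in> carrier G" and \<beta>: "\<beta> \<in> N w" and not: "\<beta> \<notin> N1 w"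
  obtains \<kappa> \<kappa>' c where "\<kappa> \<in> N w" "\<kappa>' \<in> N w" "\<kappa> \<noteq> \<beta>" "\<kappa>' \<noteq> \<beta>" "c *\<^sub>R \<beta> = \<kappa> + \<kappa>'"
proof -
  obtain x r y where x: "x \<in> carrier G" and r: "r \<in> S" and y: "y \<in> carrier G"
    and w_eq: "w = x \<otimes> (r \<otimes> y)" and \<beta>_eq: "\<beta> = \<rho> x (\<alpha> r)" and len_w: "len w = len x + Suc (len y)"
    using inversion_decomposition[OF w \<beta>] by blast
  have roots: "\<beta> \<in> \<Phi>" "pos \<beta>" using N_root N_pos w \<beta> by auto
  have "refl_elt \<beta> \<otimes> w = x \<otimes> y" unfolding w_eq \<beta>_eq using refl_mult_deletes x r y by blast
  then have "len (x \<otimes> y) \<noteq> len x + len y" using not \<beta> len_w by (auto simp: N1_def)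
  then obtain \<kappa> where \<kappa>: "\<kappa> \<in> N x" "\<kappa> \<notin> N (x \<otimes> y)" using reduced_iff_N_subset x y by blast
  have \<kappa>': "\<kappa> \<in> \<Phi>" "pos \<kappa>" "neg (\<rho> (inv x) \<kappa>)" using \<kappa>(1) x by (auto simp: in_N_iff)
  define \<gamma> where "\<gamma> = - \<rho> (inv x) \<kappa>"
  have \<gamma>: "\<gamma> \<in> \<Phi>" "pos \<gamma>" "\<rho> x \<gamma> = - \<kappa>"
    using \<kappa>' x by (auto simp: \<gamma>_def minus_root rho_root rho_simps)
  have "\<not> neg (\<rho> (inv y) (\<rho> (inv x) \<kappa>))"
    using \<kappa>(2) \<kappa>' x y by (simp add: in_N_iff inv_mult_group rho_mult)
  moreover have "\<rho> (inv y) (\<rho> (inv x) \<kappa>) \<in> \<Phi>" using \<kappa>' x y by (simp add: rho_root)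
  ultimately have "pos (\<rho> (inv y) (\<rho> (inv x) \<kappa>))" using pos_or_neg by blast
  then have y\<gamma>: "neg (\<rho> (inv y) \<gamma>)" using y by (simp add: \<gamma>_def rho_simps)
  have "len (r \<otimes> y) = Suc (len y)"
  proof -
    have "len w \<le> len x + len (r \<otimes> y)" unfolding w_eq using x r y by (intro len_mult_le) auto
    then show ?thesis using len_S_mult[OF y r] len_w by arith
  qed
  then have "\<alpha> r \<notin> N y" using alpha_in_N_iff r y by simp
  then have "\<gamma> \<noteq> \<alpha> r" using y\<gamma> \<gamma> y by (auto simp: in_N_iff)
  then have r\<gamma>: "pos (\<rho> r \<gamma>)" using S_permutes_pos r \<gamma> by blast
  have "N x \<subseteq> N w"
    using x r y len_w w_eq reduced_iff_N_subset[of x "r \<otimes> y"] \<open>len (r \<otimes> y) = Suc (len y)\<close> by simp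
  then have \<kappa>w: "\<kappa> \<in> N w" using \<kappa> by blast
  define \<mu> where "\<mu> = \<rho> x (\<rho> r \<gamma>)"
  define c where "c = - 2 * B (\<alpha> r) \<gamma>"
  have "\<mu> = - \<kappa> + c *\<^sub>R \<beta>" using x r \<gamma> by (simp add: \<mu>_def rho_S rho_simps \<beta>_eq c_def)
  then have c: "c *\<^sub>R \<beta> = \<kappa> + \<mu>" by simp
  have w_inv: "\<rho> (inv w) (\<rho> x z) = \<rho> (inv y) (\<rho> r z)" for z
    using x r y by (simp add: w_eq inv_mult_group S_inv rho_mult)
  have neg2: "neg (\<rho> (inv w) \<mu>)" using y\<gamma> r by (simp add: \<mu>_def w_inv rho_S_twice)
  have \<mu>w: "\<mu> \<in> N w"
    using rho_in_N[OF x w \<open>N x \<subseteq> N w\<close> _ r\<gamma>] neg2 r \<gamma> unfolding \<mu>_def by (simp add: rho_root)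
  have "\<kappa> \<noteq> \<beta>"
  proof
    assume "\<kappa> = \<beta>"
    then have "neg (\<alpha> r)" using \<kappa>'(3) x by (simp add: \<beta>_eq)
    then show False using not_neg_alpha r by blast
  qed
  moreover have "\<mu> \<noteq> \<beta>"
  proof
    assume "\<mu> = \<beta>"
    then have "\<kappa> = (c - 1) *\<^sub>R \<beta>" using c by (simp add: algebra_simps)
    then have "\<beta> = \<kappa>" by (rule pos_roots_not_parallel[OF roots(1) \<kappa>'(1) roots(2) \<kappa>'(2)])
    then show False using \<open>\<kappa> \<noteq> \<beta>\<close> by simp
  qed
  ultimately show ?thesis using that \<kappa>w \<mu>w c by blast
qed

lemma convex_cone_hull_insertE:
  fixes x \<beta> :: 'v
  assumes "x \<in> convex_cone hull (insert \<beta> A)"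
  obtains k z where "k \<ge> 0" "z \<in> convex_cone hull A" "x = k *\<^sub>R \<beta> + z"
proof -
  have "x \<in> convex_cone hull ({\<beta>} \<union> A)" using assms by simp
  then obtain u z where u: "u \<in> convex_cone hull {\<beta>}" and z: "z \<in> convex_cone hull A" "x = u + z"
    unfolding convex_cone_hull_Un by blast
  obtain F c where F: "u = (\<Sum>a\<in>F. c a *\<^sub>R a)" "F \<subseteq> {\<beta>}" "\<forall>a\<in>F. c a \<ge> 0"
    using u unfolding convex_cone_hull_nonneg_combinations by blast
  then consider "F = {}" | "F = {\<beta>}" by blast
  then show ?thesis by cases (use that[of 0 z] that[of "c \<beta>" z] z F in auto)
qed

text \<open>
  A smallest generating set of the cone consists of members of \<open>N1 w\<close>, because every other inversion
  lies between two inversions.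
\<close>

lemma N_subset_hull_N1:
  assumes w: "w \<in> carrier G"
  shows "N w \<subseteq> convex_cone hull (N1 w)"
proof -
  define Q where "Q A \<longleftrightarrow> A \<subseteq> N w \<and> N w \<subseteq> convex_cone hull A" for A
  have "Q (N w)" by (simp add: Q_def hull_subset)
  then obtain A where A: "Q A" and least: "\<And>C. Q C \<Longrightarrow> card A \<le> card C"
    using ex_has_least_nat[of Q "N w" card] by blast
  have finA: "finite A" using A finite_N w finite_subset by (auto simp: Q_def)
  have "A \<subseteq> N1 w"
  proof (rule subsetI, rule ccontr)
    fix \<beta> assume \<beta>A: "\<beta> \<in> A" and "\<beta> \<notin> N1 w"
    then have \<beta>: "\<beta> \<in> N w" using A by (auto simp: Q_def)
    obtain \<kappa> \<kappa>' c where \<kappa>: "\<kappa> \<in> N w" "\<kappa>' \<in> N w" "\<kappa> \<noteq> \<beta>" and c: "c *\<^sub>R \<beta> = \<kappa> + \<kappa>'"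
      using inversion_between[OF w \<beta> \<open>\<beta> \<notin> N1 w\<close>] by blast
    define A' where "A' = A - {\<beta>}"
    have AA': "A = insert \<beta> A'" using \<beta>A by (auto simp: A'_def)
    note cc = convex_cone_convex_cone_hull[of A', THEN convex_cone_iff[THEN iffD1]]
    have pos_hull: "pos z" if "z \<in> convex_cone hull A'" for z
    proof -
      have "convex_cone {z. pos z}" by (auto simp: convex_cone_iff pos_add pos_scale)
      moreover have "A' \<subseteq> {z. pos z}" using A N_pos w by (auto simp: Q_def A'_def)
      ultimately have "convex_cone hull A' \<subseteq> {z. pos z}" by (simp add: hull_minimal)
      then show ?thesis using that by blast
    qed
    obtain k z where kz: "k \<ge> 0" "z \<in> convex_cone hull A'" "\<kappa> = k *\<^sub>R \<beta> + z"
      using convex_cone_hull_insertE[of \<kappa> \<beta> A'] A \<kappa> AA' unfolding Q_def by blast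
    obtain k' z' where kz': "k' \<ge> 0" "z' \<in> convex_cone hull A'" "\<kappa>' = k' *\<^sub>R \<beta> + z'"
      using convex_cone_hull_insertE[of \<kappa>' \<beta> A'] A \<kappa> AA' unfolding Q_def by blast
    define d where "d = c - k - k'"
    have d: "d *\<^sub>R \<beta> = z + z'" using c by (simp add: kz(3) kz'(3) d_def algebra_simps)
    have "d > 0"
    proof (rule ccontr)
      assume "\<not> d > 0"
      then have "pos (z' + (- d) *\<^sub>R \<beta>)"
        using pos_hull kz' N_pos[OF w \<beta>] by (intro pos_add pos_scale) auto
      moreover have "z' + (- d) *\<^sub>R \<beta> = - z" using d by simp
      ultimately have "z = 0" using pos_neg_zero pos_hull kz by metis
      then have "\<kappa> = k *\<^sub>R \<beta>" using kz by simp
      then show False using pos_roots_not_parallel N_root N_pos w \<beta> \<kappa> by metis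
    qed
    have "z + z' \<in> convex_cone hull A'" using cc kz kz' by blast
    then have "(1 / d) *\<^sub>R (z + z') \<in> convex_cone hull A'" using cc \<open>d > 0\<close> by simp
    moreover have "(1 / d) *\<^sub>R (z + z') = \<beta>" using \<open>d > 0\<close> by (simp flip: d)
    ultimately have "A \<subseteq> convex_cone hull A'" unfolding AA' by (simp add: hull_subset)
    then have "convex_cone hull A \<subseteq> convex_cone hull A'"
      by (simp add: hull_minimal convex_cone_convex_cone_hull)
    then have "Q A'" using A by (auto simp: Q_def A'_def)
    then have "card A \<le> card A'" by (rule least)
    then show False using card_Diff1_less[OF finA \<beta>A] by (simp add: A'_def)
  qed
  then have "convex_cone hull A \<subseteq> convex_cone hull (N1 w)" by (rule hull_mono)
  then show ?thesis using A by (auto simp: Q_def)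
qed

text \<open>
  Conversely let \<open>v\<close> be the element, shorter by one, that the reflection in \<open>\<beta>\<close> makes of \<open>w\<close>. Every inversion of
  \<open>w\<close> other than \<open>\<beta>\<close> becomes an inversion of \<open>v\<close> when a suitable multiple of \<open>\<beta>\<close> is added. Now a
  multiple of \<open>\<beta>\<close> is no nonzero combination of inversions of \<open>v\<close>, because \<open>\<beta>\<close> is not inverted
  by \<open>v\<close>.
\<close>

lemma N1_extreme:
  assumes w: "w \<in> carrier G" and \<beta>: "\<beta> \<in> N1 w"
  shows "\<beta> \<notin> convex_cone hull (N w - {\<beta>})"
proof
  assume hull: "\<beta> \<in> convex_cone hull (N w - {\<beta>})"
  have \<beta>w: "\<beta> \<in> N w" "len w = Suc (len (refl_elt \<beta> \<otimes> w))" using \<beta> by (auto simp: N1_def)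
  then have roots: "\<beta> \<in> \<Phi>" "pos \<beta>" using N_root N_pos w by auto
  obtain x r y where x: "x \<in> carrier G" and r: "r \<in> S" and y: "y \<in> carrier G"
    and w_eq: "w = x \<otimes> (r \<otimes> y)" and \<beta>_eq: "\<beta> = \<rho> x (\<alpha> r)" and len_w: "len w = len x + Suc (len y)"
    using inversion_decomposition[OF w \<beta>w(1)] by blast
  have xy: "refl_elt \<beta> \<otimes> w = x \<otimes> y" unfolding w_eq \<beta>_eq using refl_mult_deletes x r y by blast
  define v where "v = x \<otimes> y"
  have v: "v \<in> carrier G" using x y by (simp add: v_def)
  have reduced: "len v = len x + len y" using \<beta>w(2) len_w by (simp add: xy v_def)
  then have Nx: "N x \<subseteq> N v" using reduced_iff_N_subset x y by (simp add: v_def)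
  have v_inv: "\<rho> (inv v) z = \<rho> (inv y) (\<rho> (inv x) z)" for z
    using x y by (simp add: v_def inv_mult_group rho_mult)
  have shift: "\<exists>t. \<kappa> + t *\<^sub>R \<beta> \<in> N v" if \<kappa>: "\<kappa> \<in> N w" "\<kappa> \<noteq> \<beta>" for \<kappa>
  proof (cases "\<kappa> \<in> N x")
    case True
    then show ?thesis using Nx by (intro exI[of _ 0]) auto
  next
    case False
    have \<kappa>': "\<kappa> \<in> \<Phi>" "pos \<kappa>" "neg (\<rho> (inv w) \<kappa>)" using \<kappa> w by (auto simp: in_N_iff)
    define \<eta> where "\<eta> = \<rho> (inv x) \<kappa>"
    have \<eta>: "\<eta> \<in> \<Phi>" "\<rho> x \<eta> = \<kappa>" using \<kappa>' x by (auto simp: \<eta>_def rho_root)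
    have "\<not> neg \<eta>" using False \<kappa>' x by (simp add: in_N_iff \<eta>_def)
    then have "pos \<eta>" using \<eta> pos_or_neg by blast
    moreover have "\<eta> \<noteq> \<alpha> r" using \<kappa>(2) \<eta>(2) \<beta>_eq by auto
    ultimately have pos: "pos (\<rho> r \<eta>)" using S_permutes_pos r \<eta> by blast
    define \<zeta> where "\<zeta> = \<rho> x (\<rho> r \<eta>)"
    have neg: "neg (\<rho> (inv v) \<zeta>)"
      using \<kappa>'(3) x r y by (simp add: v_inv \<zeta>_def \<eta>_def w_eq inv_mult_group S_inv rho_mult)
    have "\<zeta> \<in> N v"
      using rho_in_N[OF x v Nx _ pos] neg r \<eta> unfolding \<zeta>_def by (simp add: rho_root)
    moreover have "\<zeta> = \<kappa> + (- 2 * B (\<alpha> r) \<eta>) *\<^sub>R \<beta>"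
      using x r \<eta> by (simp add: \<zeta>_def rho_S rho_simps \<beta>_eq)
    ultimately show ?thesis by metis
  qed
  obtain F c where F: "\<beta> = (\<Sum>\<kappa>\<in>F. c \<kappa> *\<^sub>R \<kappa>)" "finite F" "F \<subseteq> N w - {\<beta>}" "\<And>\<kappa>. \<kappa> \<in> F \<Longrightarrow> c \<kappa> \<ge> 0"
    using hull unfolding convex_cone_hull_nonneg_combinations by blast
  have "\<forall>\<kappa>\<in>F. \<exists>t. \<kappa> + t *\<^sub>R \<beta> \<in> N v" using shift F(3) by blast
  then obtain t where t: "\<And>\<kappa>. \<kappa> \<in> F \<Longrightarrow> \<kappa> + t \<kappa> *\<^sub>R \<beta> \<in> N v" by metis
  define e where "e \<kappa> = c \<kappa> *\<^sub>R (\<kappa> + t \<kappa> *\<^sub>R \<beta>)" for \<kappa>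
  have e: "pos (e \<kappa>)" "neg (\<rho> (inv v) (e \<kappa>))" if "\<kappa> \<in> F" for \<kappa>
    unfolding e_def rho_simps(4)[OF inv_closed[OF v]]
    by (rule pos_scale[OF F(4)[OF that] N_pos[OF v t[OF that]]],
        rule neg_scale[OF F(4)[OF that] N_neg[OF v t[OF that]]])
  define T where "T = 1 + (\<Sum>\<kappa>\<in>F. c \<kappa> * t \<kappa>)"
  have sum_e: "T *\<^sub>R \<beta> = (\<Sum>\<kappa>\<in>F. e \<kappa>)"
    by (simp add: T_def e_def scaleR_add_right scaleR_add_left sum.distrib scaleR_sum_left flip: F(1))
  have pos: "pos (T *\<^sub>R \<beta>)" unfolding sum_e by (rule pos_sum) (rule e(1))
  have "pos (\<Sum>\<kappa>\<in>F. - \<rho> (inv v) (e \<kappa>))" by (rule pos_sum) (rule e(2))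
  then have neg: "neg (\<rho> (inv v) (T *\<^sub>R \<beta>))" unfolding sum_e using v by (simp add: rho_simps sum_negf)
  have "\<beta> \<notin> N v"
    using len_refl_less[OF v, of \<beta>] \<beta>w(2) xy refl_cancel[OF roots(1) w] by (auto simp: v_def)
  then have "\<not> neg (\<rho> (inv v) \<beta>)" using roots v by (simp add: in_N_iff)
  then have v\<beta>: "pos (\<rho> (inv v) \<beta>)" using pos_or_neg rho_root roots v inv_closed by blast
  have zero: "T *\<^sub>R \<beta> = 0"
  proof (cases "T > 0")
    case True
    then have "pos (\<rho> (inv v) (T *\<^sub>R \<beta>))" using v\<beta> v pos_scale by (simp add: rho_simps)
    then have "\<rho> (inv v) (T *\<^sub>R \<beta>) = 0" using neg pos_neg_zero by blast
    then show ?thesis using v by (metis inv_closed rho_eq_iff rho_simps(5))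
  next
    case False
    then have "pos ((- T) *\<^sub>R \<beta>)" using roots by (intro pos_scale) auto
    then show ?thesis using pos pos_neg_zero by (simp only: scaleR_minus_left)
  qed
  have "c \<kappa> = 0" if \<kappa>: "\<kappa> \<in> F" for \<kappa>
  proof -
    have "e \<kappa> + sum e (F - {\<kappa>}) = 0" using sum.remove[OF F(2) \<kappa>, of e] sum_e zero by simp
    then have "- e \<kappa> = sum e (F - {\<kappa>})" by (rule minus_unique)
    then have "neg (e \<kappa>)" using e(1) pos_sum[of "F - {\<kappa>}" e] by simp
    then have "e \<kappa> = 0" using e(1)[OF \<kappa>] pos_neg_zero by blast
    then show ?thesis using root_neq_0[OF N_root[OF v t[OF \<kappa>]]] by (simp add: e_def)
  qed
  then have "\<beta> = 0" using F(1) by simp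
  then show False using root_neq_0 roots(1) by blast
qed

lemma low_elements_iff: "w \<in> low_elements n \<longleftrightarrow> w \<in> carrier G \<and> N1 w \<subseteq> small_roots n"
proof
  assume "w \<in> low_elements n"
  then obtain A where w: "w \<in> carrier G" and A: "A \<subseteq> small_roots n" "N w = root_cone A"
    by (auto simp: low_elements_def)
  have "A \<subseteq> N w" unfolding A(2) using A(1) by (intro subset_root_cone) (auto simp: small_roots_iff)
  have "\<beta> \<in> A" if \<beta>: "\<beta> \<in> N1 w" for \<beta>
  proof (rule ccontr)
    assume "\<beta> \<notin> A"
    then have "A \<subseteq> N w - {\<beta>}" using \<open>A \<subseteq> N w\<close> by blast
    moreover have "\<beta> \<in> convex_cone hull A" using \<beta> A(2) by (auto simp: N1_def root_cone_def)
    ultimately have "\<beta> \<in> convex_cone hull (N w - {\<beta>})" using hull_mono by blast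
    then show False using N1_extreme w \<beta> by blast
  qed
  then show "w \<in> carrier G \<and> N1 w \<subseteq> small_roots n" using w A by blast
next
  assume w: "w \<in> carrier G \<and> N1 w \<subseteq> small_roots n"
  have "N w = root_cone (N1 w)"
  proof
    show "N w \<subseteq> root_cone (N1 w)"
      using N_subset_hull_N1 N_root w by (auto simp: root_cone_def)
    show "root_cone (N1 w) \<subseteq> N w" using w by (intro root_cone_subset_N) (auto simp: N1_def)
  qed
  then show "w \<in> low_elements n" using w by (auto simp: low_elements_def)
qed

text \<open>
  If \<open>a\<close> and \<open>b\<close> are consecutive roots in a plane, their reflections can lead from \<open>w\<close>, and from an element
  \<open>u\<close> shorter by two, to the same element. Its length is then strictly between the two, which makes \<open>b\<close>
  an extreme inversion of \<open>w\<close>.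
\<close>

lemma in_N1_of_consecutive:
  assumes w: "w \<in> carrier G" and u: "u \<in> carrier G" "len w = Suc (Suc (len u))"
    and a: "a \<in> \<Phi>" "pos a" "a \<notin> N u" and b: "b \<in> N w"
    and eq: "refl_elt b \<otimes> w = refl_elt a \<otimes> u"
  shows "b \<in> N1 w"
proof -
  have "len u < len (refl_elt a \<otimes> u)" using len_refl_greater u a by blast
  moreover have "len (refl_elt b \<otimes> w) < len w" using len_refl_less w b by blast
  ultimately show ?thesis using b u(2) eq by (simp add: N1_def)
qed

text \<open>
  If \<open>s(\<beta>)\<close> is an extreme inversion of \<open>s w\<close>, it is small, and the depth of \<open>\<beta>\<close> is at most that of \<open>s(\<beta>)\<close>
  because \<open>\<beta>\<close> does not dominate \<open>\<alpha> s\<close>. Otherwise \<open>\<alpha> s\<close> and \<open>s(\<beta>)\<close> are the first two in the sequence of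
  those roots of their plane that are inversions of \<open>s w\<close>. The last root of this sequence is an extreme
  inversion of \<open>s w\<close> by the previous lemma, and either it is \<open>\<beta>\<close> or it dominates \<open>s(\<beta>)\<close>.
\<close>

lemma dp_le_of_N1_S:
  assumes w: "w \<in> carrier G" and s: "s \<in> S" "len (s \<otimes> w) = Suc (len w)"
    and \<beta>: "\<beta> \<in> N1 w" and small: "N1 (s \<otimes> w) \<subseteq> small_roots n"
  shows "dp \<beta> \<le> n"
proof -
  define g where "g = s \<otimes> w"
  have g: "g \<in> carrier G" "s \<otimes> g = w" "len g = Suc (len w)"
    using w s by (auto simp: g_def S_cancel)
  have small_dp: "dp b \<le> n" if "b \<in> N1 g" for b
    using small that by (auto simp: g_def small_roots_iff)
  have \<beta>': "\<beta> \<in> N w" "\<beta> \<in> \<Phi>" "pos \<beta>" "neg (\<rho> (inv w) \<beta>)" "len w = Suc (len (refl_elt \<beta> \<otimes> w))"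
    using \<beta> w by (auto simp: N1_def in_N_iff)
  have \<alpha>w: "\<alpha> s \<notin> N w" and Ng: "N g = insert (\<alpha> s) (\<rho> s ` N w)"
    using N_mult[OF s(1) w s(2)] by (auto simp: g_def)
  then have w\<alpha>: "pos (\<rho> (inv w) (\<alpha> s))" using left_ascent_iff w s by simp
  have g_inv: "\<rho> (inv g) z = \<rho> (inv w) (\<rho> s z)" for z
    using w s by (simp add: g_def inv_mult_group S_inv rho_mult)
  have not_dom: "\<not> dom (\<alpha> s) \<beta>"
  proof
    assume "dom (\<alpha> s) \<beta>"
    then have "neg (\<rho> (inv w) (\<alpha> s))" using \<beta>' w by (simp add: dom_def)
    then show False
      using w\<alpha> rho_not_pos_and_neg[of "inv w" "\<alpha> s"] alpha_root w s by auto
  qed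
  then have dp_s: "dp \<beta> \<le> dp (\<rho> s \<beta>)" using dp_le_dp_S \<beta>' s by blast
  have s\<beta>: "\<rho> s \<beta> \<in> N g" "\<rho> s \<beta> \<in> \<Phi>" using Ng \<beta>' s by (auto simp: rho_root)
  show ?thesis
  proof (cases "\<rho> s \<beta> \<in> N1 g")
    case True
    then show ?thesis using small_dp dp_s by (meson le_trans)
  next
    case False
    define r where "r = refl_elt \<beta>"
    have r: "r \<in> carrier G" "inv r = r" using \<beta>' by (auto simp: r_def refl_inv)
    have rho_r: "\<rho> r z = z - (2 * B \<beta> z) *\<^sub>R \<beta>" for z using \<beta>' by (simp add: r_def rho_refl)
    have rr: "\<rho> r (\<rho> r z) = z" for z using \<beta>' by (simp add: r_def rho_refl_twice)
    define u where "u = r \<otimes> w"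
    have u: "u \<in> carrier G" "len w = Suc (len u)" "len g = Suc (Suc (len u))"
      using \<beta>' r w g by (auto simp: u_def r_def)
    have u_inv: "\<rho> (inv u) z = \<rho> (inv w) (\<rho> r z)" for z
      using w r by (simp add: u_def inv_mult_group rho_mult)
    have "refl_elt (\<rho> s \<beta>) \<otimes> g = s \<otimes> u"
      using \<beta>' s w by (simp add: refl_S_conj g_def u_def r_def m_assoc S_cancel)
    then have "len (s \<otimes> u) \<noteq> Suc (len u)" using False s\<beta> u by (auto simp: N1_def)
    then have "\<alpha> s \<in> N u" using alpha_in_N_iff len_S_mult u s by blast
    then have r\<alpha>: "neg (\<rho> (inv w) (\<rho> r (\<alpha> s)))" using u by (simp add: in_N_iff u_inv)
    define \<gamma> where "\<gamma> = \<rho> r (\<alpha> s)"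
    have \<gamma>: "\<gamma> \<in> \<Phi>" using r s alpha_root by (simp add: \<gamma>_def rho_root)
    have \<gamma>_eq: "\<gamma> = \<alpha> s + (- (2 * B \<beta> (\<alpha> s))) *\<^sub>R \<beta>" by (simp add: \<gamma>_def rho_r)
    have "B \<beta> (\<alpha> s) < 0"
    proof (rule ccontr)
      assume "\<not> ?thesis"
      then have "pos (\<rho> (inv w) (\<alpha> s) + (2 * B \<beta> (\<alpha> s)) *\<^sub>R - \<rho> (inv w) \<beta>)"
        using w\<alpha> \<beta>' by (intro pos_add pos_scale) auto
      then have "pos (\<rho> (inv w) \<gamma>)" using w by (simp add: \<gamma>_eq rho_simps)
      then show False using r\<alpha> not_pos_and_neg rho_root \<gamma> w inv_closed unfolding \<gamma>_def by blast
    qed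
    then consider "B \<beta> (\<alpha> s) = -1/2" | "B \<beta> (\<alpha> s) \<le> -1"
      using B_root_neg_cases \<beta>' s alpha_root by blast
    then show ?thesis
    proof cases
      case 1
      \<comment> \<open>Here \<open>\<alpha> s\<close> and \<open>\<beta>\<close> are the simple roots of a subsystem of type A2, all of whose positive
        roots are inversions of \<open>g\<close>, and \<open>\<beta>\<close> comes last.\<close>
      have B': "B (\<alpha> s) \<beta> = -1/2" using 1 B_sym by simp
      have \<gamma>_sum: "\<gamma> = \<alpha> s + \<beta>" using 1 by (simp add: \<gamma>_eq)
      have s\<beta>_sum: "\<rho> s \<beta> = \<gamma>" using B' s by (simp add: rho_S \<gamma>_sum)
      have \<beta>g: "\<beta> \<in> N g"
        using r\<alpha> \<beta>' g by (simp add: in_N_iff g_inv s\<beta>_sum flip: \<gamma>_def)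
      have "\<gamma> \<notin> N u"
      proof
        assume "\<gamma> \<in> N u"
        then have "neg (\<rho> (inv w) (\<alpha> s))" using u by (simp add: in_N_iff u_inv \<gamma>_def rr)
        then show False
          using w\<alpha> rho_not_pos_and_neg[of "inv w" "\<alpha> s"] alpha_root w s by auto
      qed
      moreover have "refl_elt \<beta> \<otimes> g = refl_elt \<gamma> \<otimes> u"
      proof -
        have "refl_elt \<gamma> = r \<otimes> s \<otimes> r"
          unfolding \<gamma>_def using r s alpha_root by (simp add: refl_rho refl_alpha)
        then have "refl_elt \<gamma> \<otimes> u = r \<otimes> s \<otimes> (r \<otimes> (r \<otimes> w))"
          using r s w by (simp add: u_def m_assoc)
        also have "\<dots> = r \<otimes> g" using r s w refl_cancel[of \<beta> w] \<beta>' by (simp add: r_def g_def m_assoc)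
        finally show ?thesis by (simp add: r_def)
      qed
      moreover have "pos \<gamma>" using N_pos[OF g(1) s\<beta>(1)] s\<beta>_sum by simp
      ultimately have "\<beta> \<in> N1 g" using in_N1_of_consecutive[of g u \<gamma> \<beta>] g u \<gamma> \<beta>g by blast
      then show ?thesis by (rule small_dp)
    next
      case 2
      \<comment> \<open>The positive roots of the plane on the side of \<open>\<alpha> s\<close>, in their order.\<close>
      define q where "q = s \<otimes> r"
      have q: "q \<in> carrier G" "inv q = r \<otimes> s" using s r by (auto simp: q_def inv_mult_group S_inv)
      define c where "c k = (\<rho> q ^^ (k div 2)) (if even k then \<alpha> s else \<rho> s \<beta>)" for k :: nat
      have c0: "c 0 = \<alpha> s" and c1: "c (Suc 0) = \<rho> s \<beta>" and c2: "c (Suc (Suc k)) = \<rho> q (c k)" for k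
        by (simp_all add: c_def)
      have c_2: "c (Suc (Suc 0)) = \<rho> s \<gamma>" using s r by (simp add: c2 c0 q_def rho_mult \<gamma>_def)
      have c_root: "c k \<in> \<Phi>" for k
        by (induction k rule: induct_nat_012) (use c0 c1 c2 s\<beta> s q alpha_root in \<open>auto simp: rho_root\<close>)
      have dom_01: "dom (\<alpha> s) (\<rho> s \<beta>)"
      proof (rule dom_of_B_ge_1)
        have "B (\<alpha> s) (\<rho> s \<beta>) = - B (\<alpha> s) \<beta>" using s by (simp add: rho_S B_simps)
        then show "1 \<le> B (\<alpha> s) (\<rho> s \<beta>)" using 2 B_sym[of "\<alpha> s" \<beta>] by simp
        show "pos (\<rho> (refl_elt (\<alpha> s)) (\<rho> s \<beta>))" using s \<beta>' by (simp add: refl_alpha rho_S_twice)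
      qed (use s s\<beta> alpha_root in auto)
      have "dom \<beta> \<gamma>"
      proof (rule dom_of_B_ge_1)
        have "B \<beta> \<gamma> = - B \<beta> (\<alpha> s)" using B_root[OF \<beta>'(2)] by (simp add: \<gamma>_eq B_simps)
        then show "1 \<le> B \<beta> \<gamma>" using 2 by simp
        show "pos (\<rho> (refl_elt \<beta>) \<gamma>)" using s rr by (simp add: \<gamma>_def flip: r_def)
      qed (use \<beta>' \<gamma> in auto)
      then have dom_12: "dom (\<rho> s \<beta>) (\<rho> s \<gamma>)" using dom_rho s by simp
      have c_dom: "dom (c k) (c (Suc k))" for k
        by (induction k rule: induct_nat_012) (use dom_01 dom_12 c0 c1 c_2 q in \<open>auto simp: c2 dom_rho\<close>)
      have c_pos: "pos (c k)" for k
        by (induction k) (use c0 s dom_pos[OF c_root c_root c_dom] in auto)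
      have neq_minus: "\<beta> \<noteq> - \<alpha> s"
      proof
        assume "\<beta> = - \<alpha> s"
        then have "neg (\<alpha> s)" using \<beta>' by simp
        then show False using not_neg_alpha s by blast
      qed
      have ne_01: "\<alpha> s \<noteq> \<rho> s \<beta>" using eq_minus_alpha[OF s(1)] neq_minus by blast
      have ne_12: "\<beta> \<noteq> \<gamma>"
      proof
        assume "\<beta> = \<gamma>"
        then have "\<rho> r \<beta> = \<alpha> s" by (simp add: \<gamma>_def rr)
        moreover have "\<rho> r \<beta> = - \<beta>" using \<beta>' by (simp add: r_def rho_refl_self)
        ultimately show False using neq_minus by (metis minus_minus)
      qed
      have c_neq: "c k \<noteq> c (Suc k)" for k
      proof (induction k rule: induct_nat_012)
        show "c 0 \<noteq> c (Suc 0)" using c0 c1 ne_01 by simp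
        show "c (Suc 0) \<noteq> c (Suc (Suc 0))" using c1 c_2 ne_12 s by (simp add: rho_eq_iff)
      qed (use q in \<open>simp add: c2 rho_eq_iff\<close>)
      have dp_c: "dp (c k) < dp (c (Suc k))" for k
        using dp_less c_root c_pos c_dom c_neq by blast
      then have "strict_mono (\<lambda>k. dp (c k))" by (simp add: strict_mono_Suc_iff)
      then have "inj (\<lambda>k. dp (c k))" by (rule strict_mono_imp_inj_on)
      then have "inj c" by (auto simp: inj_def)
      then have "\<not> range c \<subseteq> N g" using finite_N[OF g(1)] by (meson finite_subset range_inj_infinite)
      then have "\<exists>k. c k \<notin> N g" by blast
      define m where "m = (LEAST k. c k \<notin> N g)"
      have m: "c m \<notin> N g" using \<open>\<exists>k. c k \<notin> N g\<close> unfolding m_def by (rule LeastI_ex)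
      have below: "c k \<in> N g" if "k < m" for k using not_less_Least[of k "\<lambda>k. c k \<notin> N g"] that m_def by blast
      have "c 0 \<in> N g" "c (Suc 0) \<in> N g" using c0 c1 s\<beta> Ng by auto
      then have "m \<noteq> 0" "m \<noteq> Suc 0" using m by metis+
      then obtain j where j: "m = Suc (Suc j)" by (metis not0_implies_Suc)
      have "refl_elt (c (Suc k)) = refl_elt (c k) \<otimes> inv q" for k
      proof (induction k rule: induct_nat_012)
        show "refl_elt (c (Suc 0)) = refl_elt (c 0) \<otimes> inv q"
          using c0 c1 s \<beta>' r q by (simp add: refl_alpha refl_S_conj m_assoc flip: r_def)
        have "refl_elt (c (Suc (Suc 0))) = q \<otimes> s \<otimes> inv q"
          using q s alpha_root by (simp add: c2 c0 refl_rho refl_alpha)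
        moreover have "refl_elt (c (Suc 0)) = q \<otimes> s"
          using c1 s \<beta>' r by (simp add: refl_S_conj q_def m_assoc flip: r_def)
        ultimately show "refl_elt (c (Suc (Suc 0))) = refl_elt (c (Suc 0)) \<otimes> inv q" by simp
      next
        fix k assume "refl_elt (c (Suc k)) = refl_elt (c k) \<otimes> inv q"
        then show "refl_elt (c (Suc (Suc (Suc k)))) = refl_elt (c (Suc (Suc k))) \<otimes> inv q"
          using q(1) c_root by (simp add: c2 refl_rho m_assoc)
      qed
      then have "refl_elt (c (Suc j)) \<otimes> g = refl_elt (c j) \<otimes> inv q \<otimes> g" by simp
      also have "\<dots> = refl_elt (c j) \<otimes> u"
        using c_root q r s w g by (simp add: u_def m_assoc)
      finally have eq: "refl_elt (c (Suc j)) \<otimes> g = refl_elt (c j) \<otimes> u" .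
      have "c j \<notin> N u"
      proof
        assume "c j \<in> N u"
        then have "neg (\<rho> (inv w) (\<rho> r (c j)))" using u by (simp add: in_N_iff u_inv)
        moreover have "\<rho> (inv g) (c m) = \<rho> (inv w) (\<rho> r (c j))"
          using s r by (simp add: j c2 q_def rho_mult g_inv rho_S_twice)
        ultimately have "c m \<in> N g" using c_root c_pos g by (simp add: in_N_iff)
        then show False using m by blast
      qed
      then have "c (Suc j) \<in> N1 g"
        using in_N1_of_consecutive[of g u "c j" "c (Suc j)"] g u c_root c_pos below[of "Suc j"] j eq
        by simp
      then have "dp (c (Suc j)) \<le> n" by (rule small_dp)
      moreover have "dp (c (Suc 0)) \<le> dp (c (Suc j))"
      proof (rule lift_Suc_mono_le[of "\<lambda>k. dp (c k)"])
        show "dp (c k) \<le> dp (c (Suc k))" for k using dp_c[of k] by simp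
      qed simp
      ultimately show ?thesis using dp_s c1 by simp
    qed
  qed
qed

lemma low_suffix:
  assumes g: "g \<in> low_elements n" and v: "is_suffix v g"
  shows "v \<in> low_elements n"
proof -
  obtain x where x: "x \<in> carrier G" and vG: "v \<in> carrier G" "g = x \<otimes> v" "len g = len x + len v"
    using v by (auto simp: is_suffix_def)
  from x have "x \<otimes> v \<in> low_elements n \<Longrightarrow> len (x \<otimes> v) = len x + len v \<Longrightarrow> v \<in> low_elements n"
  proof (induction rule: len_induct)
    case one
    then show ?case using vG by simp
  next
    case (mult s x)
    define w where "w = x \<otimes> v"
    have w: "w \<in> carrier G" "s \<otimes> x \<otimes> v = s \<otimes> w" using mult.hyps vG by (auto simp: w_def m_assoc)
    have "len w \<le> len x + len v" "len (s \<otimes> w) \<le> Suc (len w)"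
      using len_mult_le[of x v] len_S_mult[of w s] w mult.hyps vG unfolding w_def by auto
    then have len: "len w = len x + len v" "len (s \<otimes> w) = Suc (len w)"
      using mult.prems(2) mult.hyps w by simp_all
    have "N1 (s \<otimes> w) \<subseteq> small_roots n" using mult.prems(1) w by (simp add: low_elements_iff)
    then have "dp \<beta> \<le> n" if "\<beta> \<in> N1 w" for \<beta>
      using dp_le_of_N1_S[OF w(1) mult.hyps(1) len(2)] that by blast
    moreover have "\<beta> \<in> \<Phi> \<and> pos \<beta>" if "\<beta> \<in> N1 w" for \<beta>
      using that w(1) by (simp add: N1_def in_N_iff)
    ultimately have "N1 w \<subseteq> small_roots n" by (simp add: small_roots_iff subset_iff)
    then have "w \<in> low_elements n" using w by (simp add: low_elements_iff)
    then show ?case using mult.IH len(1) by (simp add: w_def)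
  qed
  then show ?thesis using g vG by simp
qed

lemma S_low:
  assumes s: "s \<in> S"
  shows "s \<in> low_elements n"
proof -
  have "D (\<alpha> s) = {}"
  proof (rule ccontr)
    assume "D (\<alpha> s) \<noteq> {}"
    then obtain \<beta> where \<beta>: "\<beta> \<in> \<Phi>" "pos \<beta>" "dom \<beta> (\<alpha> s)" "\<beta> \<noteq> \<alpha> s" by (auto simp: D_def)
    have "neg (\<rho> s (\<alpha> s))" using s by (simp add: rho_S_alpha)
    then have "neg (\<rho> s \<beta>)" using \<beta>(3) s by (simp add: dom_def)
    moreover have "pos (\<rho> s \<beta>)" using S_permutes_pos s \<beta> by blast
    ultimately show False using not_pos_and_neg rho_root \<beta>(1) s S_closed by blast
  qed
  then have small: "\<alpha> s \<in> small_roots n" using s alpha_root by (simp add: small_roots_iff dp_def)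
  have "N1 s \<subseteq> {\<alpha> s}" using N_S s by (auto simp: N1_def)
  then show ?thesis using small s by (auto simp: low_elements_iff)
qed

theorem low_elements_garside_shadow: "garside_shadow (low_elements n)"
  unfolding garside_shadow_def
proof (intro conjI allI impI ballI)
  show "low_elements n \<subseteq> carrier G" by (auto simp: low_elements_def)
  show "S \<subseteq> low_elements n" using S_low by blast
qed (use join_low low_suffix in blast)+

end

theorem theorem5p1:
  fixes G :: "('a, 'b) monoid_scheme" and S :: "'a set"
    and B :: "'v::real_vector \<Rightarrow> 'v \<Rightarrow> real"
    and \<alpha> :: "'a \<Rightarrow> 'v" and \<rho> :: "'a \<Rightarrow> 'v \<Rightarrow> 'v" and n :: nat
  assumes "coxeter_system G S" and "finite S"
    and "geometric_representation G S B \<alpha> \<rho>"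
    and "\<forall>s\<in>S. \<forall>t\<in>S. group.coxeter_matrix G s t \<in> {1, 2, 3, \<infinity>}"
  shows "geometric_representation.bipodal G S B \<alpha> \<rho>
           (geometric_representation.small_roots G S \<alpha> \<rho> n) \<and>
         finite (geometric_representation.low_elements G S \<alpha> \<rho> n) \<and>
         coxeter_system.garside_shadow G S
           (geometric_representation.low_elements G S \<alpha> \<rho> n)"
proof -
  interpret laced_representation G S B \<alpha> \<rho>
    using assms(3,4) by (simp add: laced_representation_def laced_representation_axioms_def)
  show ?thesis
    using bipodal_small_roots finite_low_elements low_elements_garside_shadow by blast
qed

end
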